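(* Let $g:\mathbb{R}\to(0,\infty)$ be an even real-analytic function. Then the domain $\Omega=\{(x_1,x_2,x_3,x_4)\in\mathbb{R}^4:\sqrt{x_2^2+x_3^2+x_4^2}<g(x_1)\}$ (which is rotationally symmetric about the $x_1$-axis, contains this axis, and has boundary obtained by rotating the graph $\{y=g(x)\}$ about the $x$-axis) is not an exceptional domain.
   Context: A domain $\Omega\subset\mathbb{R}^n$ is exceptional if it admits a roof function: a positive harmonic function $u$ on $\Omega$ with $u=0$ on $\partial\Omega$ and constant normal derivative (normalized to $1$) on $\partial\Omega$. *)

theory Defs
  imports "HOL-Analysis.Analysis"
begin

definition real_analytic :: "(real \<Rightarrow> real) \<Rightarrow> bool" where
  "real_analytic g \<longleftrightarrow>
     (\<forall>x0. \<exists>r>0. \<exists>a::nat \<Rightarrow> real.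
        \<forall>x. \<bar>x - x0\<bar> < r \<longrightarrow> (\<lambda>n. a n * (x - x0) ^ n) sums g x)"

definition partial :: "(real^'n \<Rightarrow> real) \<Rightarrow> 'n \<Rightarrow> real^'n \<Rightarrow> real" where
  "partial f i x = frechet_derivative f (at x) (axis i 1)"

definition grad :: "(real^'n \<Rightarrow> real) \<Rightarrow> real^'n \<Rightarrow> real^'n" where
  "grad f x = (\<chi> i. partial f i x)"

definition harmonic_on :: "(real^'n) set \<Rightarrow> (real^'n \<Rightarrow> real) \<Rightarrow> bool" where
  "harmonic_on S u \<longleftrightarrow>
     (\<forall>x\<in>S. u differentiable (at x)) \<and>
     (\<forall>i. \<forall>x\<in>S. partial u i differentiable (at x)) \<and>
     (\<forall>i j. continuous_on S (partial (partial u i) j)) \<and>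
     (\<forall>x\<in>S. (\<Sum>i\<in>UNIV. partial (partial u i) i x) = 0)"

text \<open>Roof function: positive harmonic in the domain, C^1 up to the boundary,
  vanishing on the boundary, with gradient of norm 1 (constant normal derivative,
  normalized) on the boundary.\<close>
definition roof_function :: "(real^'n) set \<Rightarrow> (real^'n \<Rightarrow> real) \<Rightarrow> bool" where
  "roof_function \<Omega> u \<longleftrightarrow>
     harmonic_on \<Omega> u \<and>
     (\<forall>x\<in>\<Omega>. u x > 0) \<and>
     (\<forall>p\<in>frontier \<Omega>.
        (u \<longlongrightarrow> 0) (at p within \<Omega>) \<and>
        (\<exists>v. (grad u \<longlongrightarrow> v) (at p within \<Omega>) \<and> norm v = 1))"

definition exceptional_domain :: "(real^'n) set \<Rightarrow> bool" where
  "exceptional_domain \<Omega> \<longleftrightarrow> open \<Omega> \<and> connected \<Omega> \<and> (\<exists>u. roof_function \<Omega> u)"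

end

theory Submission
  imports Defs
begin

text \<open>
  Let \<open>u\<close> be a roof function on \<open>\<Omega>\<close> and integrate over the slices \<open>x\<^sub>1 = t\<close>, which are balls of radius
  \<open>g t\<close> in three-space: \<open>N t = \<integral> u\<close> and \<open>V t\<close> = volume. The Hopf lemma and Harnack's inequality give
  \<open>u \<le> C dist(x, frontier \<Omega>)\<close>, hence a bounded gradient, and then a Phragmen-Lindelof argument with the
  superharmonic barrier \<open>log (1 + x\<^sub>1\<^sup>2) / 2 + B / (1 + |x|\<^sup>2)\<close> sharpens this to \<open>|\<partial>\<^sub>1 u| \<le> 1\<close>.
  The boundary condition makes \<open>N''\<close> the density of the surface area, so \<open>|V'| \<le> N''\<close> and
  \<open>3 V \<le> g N''\<close>, and it makes the axial flux \<open>\<integral> ((\<partial>\<^sub>1 u)\<^sup>2 - |\<nabla>\<^sub>y u|\<^sup>2 - 1)\<close> of the stress tensor independent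
  of the slice. As \<open>|\<partial>\<^sub>1 u| \<le> 1\<close>, the transverse energy \<open>\<integral> |\<nabla>\<^sub>y u|\<^sup>2\<close> of a slice is bounded, whence
  \<open>N \<le> C V\<^sup>5\<^sup>/\<^sup>6\<close> by Poincare's inequality. But \<open>N'\<close> dominates \<open>V\<close> up to a constant and tends to infinity
  in one direction, so \<open>N' \<ge> c N\<^sup>6\<^sup>/\<^sup>5\<close> and \<open>N\<close> blows up at a finite \<open>t\<close>, although \<open>g\<close> is
  defined everywhere. A smooth bump in \<open>x\<^sub>1\<close> stands in for the slices, and cutoffs along the level
  sets of \<open>u\<close> for the surface integrals, so that no regularity of the frontier is needed.
\<close>

section \<open>Integrals of directional derivatives\<close>

text \<open>The dimension enters through an exponent. If the slices had dimension k, then V would be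
  of order g^k, and bounded transverse energy would give N <= C g V^(1/2), which is C V^(1/k + 1/2).
  The power is below 1, and the differential inequality superlinear, exactly when k >= 3. The bound
  |\<partial>_1 u| <= 1 has to be sharp: the conserved flux is minus the integral of |\<nabla>_y
  u|^2 + 1 - (\<partial>_1 u)^2, and it controls the first term only because the rest is
  nonnegative. The order of choices shapes the final argument. The bump must be so narrow that g
  hardly varies across it on [-L-1, L+1], hence the time L of the contradiction has to be known
  before the width \<delta>. All slice integrals are therefore divided by the mass of the bump on a
  unit cylinder; the constants \<open>c0\<close>, \<open>Vb\<close>, \<open>D\<close>, and with them
  L, then depend only on g over [-2, 2].\<close>

lemma has_real_derivative_integral:
  fixes F :: "real \<Rightarrow> 'a \<Rightarrow> real"
  assumes e: "0 < e"
    and int: "\<And>t. \<bar>t - t0\<bar> < e \<Longrightarrow> integrable M (F t)"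
    and der: "\<And>t x. \<bar>t - t0\<bar> < e \<Longrightarrow> x \<in> space M \<Longrightarrow> DERIV (\<lambda>t. F t x) t :> F' t x"
    and bnd: "\<And>t x. \<bar>t - t0\<bar> < e \<Longrightarrow> x \<in> space M \<Longrightarrow> \<bar>F' t x\<bar> \<le> B x"
    and B: "integrable M B"
  shows "DERIV (\<lambda>t. LINT x|M. F t x) t0 :> (LINT x|M. F' t0 x)"
proof -
  have "((\<lambda>h. ((LINT x|M. F (t0 + h) x) - (LINT x|M. F t0 x)) / h) \<longlongrightarrow> (LINT x|M. F' t0 x)) (at 0 within ball 0 e)"
    unfolding tendsto_at_iff_sequentially
  proof (intro allI impI)
    fix X :: "nat \<Rightarrow> real"
    assume X: "\<forall>i. X i \<in> ball 0 e - {0}" and X0: "X \<longlonglongrightarrow> 0"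
    define s where "s n x = (F (t0 + X n) x - F t0 x) / X n" for n x
    have Xe: "\<bar>X n\<bar> < e" "X n \<noteq> 0" for n
      using X[rule_format, of n] by auto
    have ints: "integrable M (s n)" for n
      unfolding s_def using Xe(1)[of n] e by (intro integrable_divide_zero Bochner_Integration.integrable_diff int) auto
    have lim: "(\<lambda>n. s n x) \<longlonglongrightarrow> F' t0 x" if x: "x \<in> space M" for x
    proof -
      have "((\<lambda>h. (F (t0 + h) x - F t0 x) / h) \<longlongrightarrow> F' t0 x) (at 0)"
        using der[of t0 x] e x by (simp add: DERIV_def)
      moreover have "filterlim X (at 0) sequentially"
        using X0 Xe by (simp add: filterlim_at)
      ultimately show ?thesis
        unfolding s_def by (rule filterlim_compose)
    qed
    \<comment> \<open>The mean value inequality bounds the difference quotients by \<open>B\<close>,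
      so dominated convergence applies along every sequence.\<close>
    have bound: "norm (s n x) \<le> B x" if x: "x \<in> space M" for n x
    proof -
      have "norm (F (t0 + X n) x - F t0 x) \<le> B x * norm (t0 + X n - t0)"
      proof (rule field_differentiable_bound[of "ball t0 e" "\<lambda>t. F t x" "\<lambda>t. F' t x" "B x"])
        show "((\<lambda>t. F t x) has_field_derivative F' t x) (at t within ball t0 e)" if "t \<in> ball t0 e" for t
          using der[of t x] that x by (auto simp: dist_real_def abs_minus_commute intro: has_field_derivative_at_within)
        show "norm (F' t x) \<le> B x" if "t \<in> ball t0 e" for t
          using bnd[of t x] that x by (auto simp: dist_real_def abs_minus_commute)
      qed (use Xe[of n] e in \<open>auto simp: dist_real_def\<close>)
      then show ?thesis
        unfolding s_def using Xe[of n] by (simp add: divide_simps)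
    qed
    have meas: "F' t0 \<in> borel_measurable M"
      by (rule borel_measurable_LIMSEQ_real[of _ s]) (use lim ints in auto)
    have "(\<lambda>n. LINT x|M. s n x) \<longlonglongrightarrow> (LINT x|M. F' t0 x)"
      by (rule integral_dominated_convergence[where w = B]) (use meas ints B lim bound in \<open>auto intro!: AE_I2\<close>)
    moreover have "(LINT x|M. s n x) = ((LINT x|M. F (t0 + X n) x) - (LINT x|M. F t0 x)) / X n" for n
      unfolding s_def using Xe(1)[of n] e int by (simp add: Bochner_Integration.integral_diff)
    ultimately show "((\<lambda>h. ((LINT x|M. F (t0 + h) x) - (LINT x|M. F t0 x)) / h) \<circ> X) \<longlonglongrightarrow> (LINT x|M. F' t0 x)"
      by (simp add: o_def)
  qed
  then show ?thesis
    using e by (simp add: DERIV_def at_within_open[of 0 "ball 0 e"])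
qed

text \<open>Differentiate the constant \<open>t \<mapsto> \<integral> f (x + t e) dx\<close>.\<close>
lemma has_bochner_integral_directional_derivative:
  fixes f :: "'a::euclidean_space \<Rightarrow> real"
  assumes S: "open S" and K: "compact K" "K \<subseteq> A" and A: "A \<in> sets borel" "A \<subseteq> S"
    and der: "\<And>x. x \<in> S \<Longrightarrow> (f has_derivative f' x) (at x)"
    and cont: "continuous_on S (\<lambda>x. f' x e)"
    and zero: "\<And>x. x \<in> S - K \<Longrightarrow> f x = 0"
  shows "has_bochner_integral (restrict_space lborel A) (\<lambda>x. f' x e) 0"
proof -
  have KS: "K \<subseteq> S" using K A by blast
  define F where "F x = (if x \<in> S then f x else 0)" for x
  \<comment> \<open>The derivative vanishes on \<open>S - K\<close>, so \<open>F'\<close> may be cut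
    off at the compact set \<open>K\<close> rather than at the edge of \<open>S\<close>, near which
    nothing bounds \<open>f'\<close>.\<close>
  define F' where "F' x = (if x \<in> K then f' x e else 0)" for x
  have clK: "closed K" using K compact_imp_closed by blast
  have zero': "f' x e = 0" if "x \<in> S - K" for x
  proof -
    have "((\<lambda>x. 0) has_derivative f' x) (at x)"
      by (rule has_derivative_transform_within_open[of f _ _ _ "S - K"])
        (use der zero that S clK in auto)
    then have "f' x = (\<lambda>h. 0)"
      using has_derivative_unique has_derivative_const by blast
    then show ?thesis by simp
  qed
  have derF: "DERIV (\<lambda>t. F (x + t *\<^sub>R e)) t :> F' (x + t *\<^sub>R e)" for x t
  proof (cases "x + t *\<^sub>R e \<in> K")
    case True
    let ?T = "(\<lambda>t. x + t *\<^sub>R e) -` S"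
    have oT: "open ?T" by (intro open_vimage S continuous_intros)
    have tT: "t \<in> ?T" using True KS by auto
    have "((\<lambda>t. f (x + t *\<^sub>R e)) has_derivative (\<lambda>h. f' (x + t *\<^sub>R e) (h *\<^sub>R e))) (at t)"
      by (rule has_derivative_compose[of "\<lambda>t. x + t *\<^sub>R e" "\<lambda>h. h *\<^sub>R e", OF _ der])
        (use tT in \<open>auto intro!: derivative_eq_intros\<close>)
    moreover have "f' (x + t *\<^sub>R e) (h *\<^sub>R e) = f' (x + t *\<^sub>R e) e * h" for h
      using der[of "x + t *\<^sub>R e"] tT by (simp add: has_derivative_bounded_linear bounded_linear.linear linear_scale)
    ultimately have "DERIV (\<lambda>t. f (x + t *\<^sub>R e)) t :> f' (x + t *\<^sub>R e) e"
      by (simp add: has_field_derivative_def)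
    then have "DERIV (\<lambda>t. F (x + t *\<^sub>R e)) t :> f' (x + t *\<^sub>R e) e"
      by (rule has_field_derivative_transform_within_open[OF _ oT tT]) (auto simp: F_def)
    then show ?thesis using True by (simp add: F'_def)
  next
    case False
    let ?T = "(\<lambda>t. x + t *\<^sub>R e) -` (- K)"
    have oT: "open ?T" by (intro open_vimage continuous_intros) (use clK in auto)
    have tT: "t \<in> ?T" using False by auto
    have "DERIV (\<lambda>t. 0) t :> 0" by simp
    then have "DERIV (\<lambda>t. F (x + t *\<^sub>R e)) t :> 0"
      by (rule has_field_derivative_transform_within_open[OF _ oT tT]) (auto simp: F_def zero)
    then show ?thesis using False by (simp add: F'_def)
  qed
  have contK: "continuous_on K (\<lambda>x. f' x e)" using cont KS continuous_on_subset by blast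
  obtain M where M: "\<And>x. x \<in> K \<Longrightarrow> \<bar>f' x e\<bar> \<le> M"
    using compact_imp_bounded[OF compact_continuous_image[OF contK K(1)]] by (auto simp: bounded_iff)
  obtain R where R: "\<And>x. x \<in> K \<Longrightarrow> norm x \<le> R"
    using compact_imp_bounded[OF K(1)] by (auto simp: bounded_iff)
  have contF: "continuous_on UNIV F"
  proof -
    have "isCont F x" for x
    proof (cases "x \<in> S")
      case True
      have "isCont f x" using der[OF True] has_derivative_continuous by blast
      then show ?thesis
        using True S by (subst isCont_cong[of F f]) (auto simp: F_def eventually_nhds)
    next
      case False
      then have "x \<in> - K" using KS by auto
      then show ?thesis
        using clK by (subst isCont_cong[of F "\<lambda>_. 0"]) (auto simp: F_def zero eventually_nhds)
    qed
    then show ?thesis by (simp add: continuous_at_imp_continuous_on)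
  qed
  have F0: "F x = 0" if "x \<notin> K" for x using that zero by (auto simp: F_def)
  have intF: "integrable lborel F"
  proof -
    have "integrable lborel (\<lambda>x. indicator K x *\<^sub>R F x)"
      by (rule borel_integrable_compact[OF K(1)]) (rule continuous_on_subset[OF contF], simp)
    moreover have "(\<lambda>x. indicator K x *\<^sub>R F x) = F" by (auto simp: F0 indicator_def fun_eq_iff)
    ultimately show ?thesis by simp
  qed
  have intF': "integrable lborel F'"
  proof -
    have "integrable lborel (\<lambda>x. indicator K x *\<^sub>R f' x e)"
      by (rule borel_integrable_compact[OF K(1) contK])
    moreover have "(\<lambda>x. indicator K x *\<^sub>R f' x e) = F'" by (auto simp: F'_def indicator_def fun_eq_iff)
    ultimately show ?thesis by simp
  qed
  have intFt: "integrable lborel (\<lambda>x. F (x + t *\<^sub>R e))" "(LINT x|lborel. F (x + t *\<^sub>R e)) = (LINT x|lborel. F x)" for t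
  proof -
    have "(+) (t *\<^sub>R e) = (\<lambda>x. x + t *\<^sub>R e)" by (simp add: fun_eq_iff)
    then have eq: "lborel = distr lborel borel (\<lambda>x. x + t *\<^sub>R e)"
      using lborel_distr_plus[of "t *\<^sub>R e"] by metis
    show "integrable lborel (\<lambda>x. F (x + t *\<^sub>R e))"
      using intF borel_measurable_integrable[OF intF] by (subst (asm) eq) (simp add: integrable_distr_eq)
    show "(LINT x|lborel. F (x + t *\<^sub>R e)) = (LINT x|lborel. F x)"
      using borel_measurable_integrable[OF intF]
      by (subst (2) eq) (simp add: integral_distr)
  qed
  \<comment> \<open>For |t| < 1 the translates of \<open>K\<close> stay in the ball of radius
    \<open>R + norm e\<close>, so a constant on that ball dominates the derivatives.\<close>
  have "DERIV (\<lambda>t. LINT x|lborel. F (x + t *\<^sub>R e)) 0 :> (LINT x|lborel. F' (x + 0 *\<^sub>R e))"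
  proof (rule has_real_derivative_integral[where e = 1 and F' = "\<lambda>t x. F' (x + t *\<^sub>R e)"
        and B = "\<lambda>x. indicator (cball 0 (R + norm e)) x *\<^sub>R \<bar>M\<bar>"])
    show "integrable lborel (\<lambda>x. indicator (cball 0 (R + norm e)) x *\<^sub>R \<bar>M\<bar>)"
      by (rule borel_integrable_compact) auto
    fix t x assume t: "\<bar>t - 0\<bar> < (1::real)"
    show "\<bar>F' (x + t *\<^sub>R e)\<bar> \<le> indicator (cball 0 (R + norm e)) x *\<^sub>R \<bar>M\<bar>"
    proof (cases "x + t *\<^sub>R e \<in> K")
      case True
      have "norm x \<le> norm (x + t *\<^sub>R e) + norm (t *\<^sub>R e)"
        using norm_triangle_ineq4[of "x + t *\<^sub>R e" "t *\<^sub>R e"] by simp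
      also have "\<dots> \<le> R + norm e"
        using R[OF True] t mult_right_mono[of "\<bar>t\<bar>" 1 "norm e"] by simp
      finally show ?thesis using M[OF True] True by (simp add: F'_def)
    qed (simp add: F'_def)
  qed (use intFt derF in auto)
  then have "DERIV (\<lambda>t. LINT x|lborel. F x) 0 :> (LINT x|lborel. F' x)"
    by (simp add: intFt(2))
  then have I0: "(LINT x|lborel. F' x) = 0"
    using DERIV_unique DERIV_const by blast
  have eq: "(\<lambda>x. indicator A x * f' x e) = F'"
    using K A zero' by (auto simp: F'_def indicator_def fun_eq_iff)
  show ?thesis
    using intF' I0 A by (simp add: has_bochner_integral_iff integrable_restrict_space integral_restrict_space eq)
qed

section \<open>Mean values of harmonic functions\<close>

text \<open>Radial weights, level cutoffs and bumps are all assembled from truncated powers, which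
  keeps their derivatives explicit. The exponent must be at least two for differentiability at the
  kink.\<close>

lemma has_real_derivative_max_power:
  "DERIV (\<lambda>x::real. (max 0 x) ^ Suc (Suc n)) x :> real (Suc (Suc n)) * (max 0 x) ^ Suc n"
proof (cases x "0::real" rule: linorder_cases)
  case less
  have "DERIV (\<lambda>x::real. 0) x :> 0" by simp
  then have "DERIV (\<lambda>x::real. (max 0 x) ^ Suc (Suc n)) x :> 0"
    by (rule has_field_derivative_transform_within_open[of _ _ _ "{..<0}"]) (use less in auto)
  then show ?thesis using less by simp
next
  case equal
  have "((\<lambda>h::real. (max 0 h) ^ Suc n) \<longlongrightarrow> (max 0 0) ^ Suc n) (at 0)"
    by (intro tendsto_intros)
  then have "((\<lambda>h::real. ((max 0 (0 + h)) ^ Suc (Suc n) - (max 0 0) ^ Suc (Suc n)) / h) \<longlongrightarrow> 0) (at 0)"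
    by (subst LIM_equal[where g = "\<lambda>h. (max 0 h) ^ Suc n"]) (auto simp: max_def)
  then show ?thesis using equal by (simp add: DERIV_def)
next
  case greater
  have "DERIV (\<lambda>x::real. x ^ Suc (Suc n)) x :> real (Suc (Suc n)) * x ^ Suc n"
    using DERIV_pow[of "Suc (Suc n)" x] by (simp only: diff_Suc_Suc diff_zero)
  then have "DERIV (\<lambda>x::real. (max 0 x) ^ Suc (Suc n)) x :> real (Suc (Suc n)) * x ^ Suc n"
    by (rule has_field_derivative_transform_within_open[of _ _ _ "{0<..}"]) (use greater in auto)
  then show ?thesis using greater by simp
qed

text \<open>Used along the coordinate lines through an interior minimum; summed over the directions
  it serves as the maximum principle for strictly subharmonic or superharmonic barriers.\<close>

lemma second_derivative_nonneg_at_local_min: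
  fixes f f1 :: "real \<Rightarrow> real"
  assumes e: "0 < e"
    and f: "\<And>s. \<bar>s\<bar> < e \<Longrightarrow> DERIV f s :> f1 s"
    and f1: "DERIV f1 0 :> c"
    and min: "\<And>s. \<bar>s\<bar> < e \<Longrightarrow> f 0 \<le> f s"
  shows "0 \<le> c"
proof (rule ccontr)
  assume c: "\<not> 0 \<le> c"
  have f10: "f1 0 = 0"
    by (rule DERIV_local_min[OF f[of 0] e]) (use e min in auto)
  obtain d where d: "d > 0" "\<And>h. 0 < h \<Longrightarrow> h < d \<Longrightarrow> f1 h < 0"
    using DERIV_neg_dec_right[OF f1] c f10 by auto
  define h where "h = min d e / 2"
  have h: "0 < h" "h < d" "h < e" using d e by (auto simp: h_def)
  obtain z where z: "0 < z" "z < h" "f h - f 0 = (h - 0) * f1 z"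
    using MVT2[of 0 h f f1] h f by auto
  have "f1 z < 0" using d z h by auto
  then have "f h - f 0 < 0" using z h by (simp add: mult_pos_neg)
  then show False using min[of h] h by auto
qed

lemma has_derivative_partial:
  fixes f :: "real^'n \<Rightarrow> real"
  assumes "f differentiable (at x)"
  shows "(f has_derivative (\<lambda>h. grad f x \<bullet> h)) (at x)"
proof -
  have D: "(f has_derivative frechet_derivative f (at x)) (at x)"
    using assms frechet_derivative_works by blast
  then have lin: "linear (frechet_derivative f (at x))"
    using has_derivative_linear by blast
  have "frechet_derivative f (at x) h = grad f x \<bullet> h" for h
  proof -
    have "frechet_derivative f (at x) h = frechet_derivative f (at x) (\<Sum>i\<in>UNIV. h $ i *\<^sub>R axis i 1)"
      by (metis (no_types, lifting) basis_expansion scalar_mult_eq_scaleR sum.cong)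
    also have "\<dots> = (\<Sum>i\<in>UNIV. h $ i * partial f i x)"
      by (simp add: linear_sum[OF lin] linear_scale[OF lin] partial_def)
    also have "\<dots> = grad f x \<bullet> h"
      by (simp add: inner_vec_def grad_def mult.commute)
    finally show ?thesis .
  qed
  then have "frechet_derivative f (at x) = (\<lambda>h. grad f x \<bullet> h)" by auto
  then show ?thesis using D by simp
qed

abbreviation step :: "'n::finite \<Rightarrow> real \<Rightarrow> real^'n" where
  "step i s \<equiv> s *\<^sub>R axis i 1"

abbreviation partial2 :: "(real^'n \<Rightarrow> real) \<Rightarrow> 'n \<Rightarrow> 'n \<Rightarrow> real^'n \<Rightarrow> real" where
  "partial2 u i j \<equiv> partial (partial u i) j"

abbreviation ball_measure :: "(real^'n) measure" where
  "ball_measure \<equiv> restrict_space lborel (cball 0 1)"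

lemma cont_der:
  "(\<And>x. x \<in> S \<Longrightarrow> (f has_derivative f' x) (at x)) \<Longrightarrow> continuous_on S f"
  by (meson continuous_at_imp_continuous_on has_derivative_continuous)

lemma grad_inner_axis: "grad f x \<bullet> axis i 1 = partial f i x"
  by (simp add: inner_axis grad_def)

lemma has_real_derivative_along:
  fixes f :: "real^'n \<Rightarrow> real"
  assumes "f differentiable (at (x + s *\<^sub>R e))"
  shows "DERIV (\<lambda>s. f (x + s *\<^sub>R e)) s :> grad f (x + s *\<^sub>R e) \<bullet> e"
proof -
  have "((\<lambda>s. f (x + s *\<^sub>R e)) has_derivative (\<lambda>h. grad f (x + s *\<^sub>R e) \<bullet> (h *\<^sub>R e))) (at s)"
    by (rule has_derivative_compose[of "\<lambda>t. x + t *\<^sub>R e" "\<lambda>h. h *\<^sub>R e", OF _ has_derivative_partial[OF assms]])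
      (auto intro!: derivative_eq_intros)
  then show ?thesis by (simp add: has_field_derivative_def mult_commute_abs)
qed

context
  fixes S :: "(real^'n) set" and u :: "real^'n \<Rightarrow> real"
  assumes S: "open S" and harm: "harmonic_on S u"
begin

lemma harmonic_diff: "x \<in> S \<Longrightarrow> u differentiable (at x)"
  and harmonic_diff2: "x \<in> S \<Longrightarrow> partial u i differentiable (at x)"
  and harmonic_laplace: "x \<in> S \<Longrightarrow> (\<Sum>i\<in>UNIV. partial2 u i i x) = 0"
  and harmonic_cont2: "continuous_on S (partial2 u i j)"
  using harm by (auto simp: harmonic_on_def)

lemma harmonic_cont: "continuous_on S u"
  using harmonic_diff by (meson continuous_at_imp_continuous_on differentiable_imp_continuous_within)

lemma harmonic_cont1: "continuous_on S (partial u i)"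
  using harmonic_diff2 by (meson continuous_at_imp_continuous_on differentiable_imp_continuous_within)

lemma harmonic_cont_grad: "continuous_on S (grad u)"
  unfolding grad_def by (intro continuous_on_vec_lambda harmonic_cont1)

text \<open>Integrate the divergence of (1 - |z|^2)^3 grad u(x0 + r z), which vanishes on the unit
  sphere. Harmonicity removes the term in which the cube is not differentiated, and the other one is
  -6 times the integrand. Solid averages with a polynomial weight make surface measure on spheres
  unnecessary.\<close>

lemma integral_radial_derivative:
  assumes sub: "\<And>z. z \<in> cball 0 1 \<Longrightarrow> x0 + r *\<^sub>R z \<in> S"
  shows "(LINT z|ball_measure. (1 - z \<bullet> z)\<^sup>2 * (grad u (x0 + r *\<^sub>R z) \<bullet> z)) = 0"
proof -
  define T where "T = (\<lambda>z. x0 + r *\<^sub>R z) -` S"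
  have T: "open T" unfolding T_def by (intro open_vimage S continuous_intros)
  have cT: "cball 0 1 \<subseteq> T" using sub by (auto simp: T_def)
  define c where "c z = max 0 (1 - z \<bullet> z)" for z :: "real^'n"
  define D where "D i z h = c z ^ 3 * (r * (grad (partial u i) (x0 + r *\<^sub>R z) \<bullet> h)) - 6 * c z ^ 2 * (z \<bullet> h) * partial u i (x0 + r *\<^sub>R z)"
    for i z h
  have der: "((\<lambda>z. c z ^ 3 * partial u i (x0 + r *\<^sub>R z)) has_derivative D i z) (at z)" if "z \<in> T" for i z
  proof -
    have 1: "((\<lambda>z. partial u i (x0 + r *\<^sub>R z)) has_derivative (\<lambda>h. grad (partial u i) (x0 + r *\<^sub>R z) \<bullet> (r *\<^sub>R h))) (at z)"
      by (rule has_derivative_compose[of "\<lambda>z. x0 + r *\<^sub>R z" "\<lambda>h. r *\<^sub>R h", OF _ has_derivative_partial])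
        (use that in \<open>auto intro!: derivative_eq_intros harmonic_diff2 simp: T_def\<close>)
    have 2: "((\<lambda>z. 1 - z \<bullet> z) has_derivative (\<lambda>h. - 2 * (z \<bullet> h))) (at z)"
      by (auto intro!: derivative_eq_intros simp: inner_commute)
    have 3: "((\<lambda>z. c z ^ 3) has_derivative (\<lambda>h. (- 2 * (z \<bullet> h)) * (3 * c z ^ 2))) (at z)"
      using DERIV_compose_FDERIV[OF has_real_derivative_max_power[of 1] 2]
      by (simp add: c_def numeral_eq_Suc)
    show ?thesis
      by (rule derivative_eq_intros 1 3 refl)+ (auto simp: D_def fun_eq_iff algebra_simps)
  qed
  have contT: "continuous_on T (\<lambda>z. f (x0 + r *\<^sub>R z))" if "continuous_on S f" for f :: "real^'n \<Rightarrow> real"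
    by (rule continuous_on_compose2[OF that]) (auto intro!: continuous_intros simp: T_def)
  have "has_bochner_integral ball_measure (\<lambda>z. D i z (axis i 1)) 0" for i
  proof (rule has_bochner_integral_directional_derivative[OF T _ _ _ cT der])
    show "continuous_on T (\<lambda>z. D i z (axis i 1))"
      unfolding D_def c_def grad_inner_axis
      by (intro continuous_intros contT harmonic_cont1 harmonic_cont2)
    show "c z ^ 3 * partial u i (x0 + r *\<^sub>R z) = 0" if "z \<in> T - cball 0 1" for z
    proof -
      have "1 < norm z" using that by auto
      then have "1 \<le> z \<bullet> z" by (simp add: dot_square_norm one_le_power)
      then show ?thesis by (simp add: c_def)
    qed
  qed auto
  then have "has_bochner_integral ball_measure (\<lambda>z. \<Sum>i\<in>UNIV. D i z (axis i 1)) (\<Sum>i\<in>(UNIV::'n set). 0)"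
    by (rule has_bochner_integral_sum)
  then have I0: "(LINT z|ball_measure. (\<Sum>i\<in>UNIV. D i z (axis i 1))) = 0"
    by (simp add: has_bochner_integral_iff)
  have "(\<Sum>i\<in>UNIV. D i z (axis i 1)) = - 6 * ((1 - z \<bullet> z)\<^sup>2 * (grad u (x0 + r *\<^sub>R z) \<bullet> z))" if "z \<in> cball 0 1" for z
  proof -
    have "norm z \<le> 1" using that by simp
    then have "z \<bullet> z \<le> 1" by (simp add: dot_square_norm power_le_one)
    then have cz: "c z = 1 - z \<bullet> z" by (simp add: c_def)
    have "(\<Sum>i\<in>UNIV. D i z (axis i 1)) = c z ^ 3 * r * (\<Sum>i\<in>UNIV. partial2 u i i (x0 + r *\<^sub>R z))
       - 6 * c z ^ 2 * (\<Sum>i\<in>UNIV. z $ i * partial u i (x0 + r *\<^sub>R z))"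
      unfolding D_def grad_inner_axis
      by (simp add: sum_subtractf sum_distrib_left inner_axis mult.assoc)
    also have "\<dots> = - 6 * ((1 - z \<bullet> z)\<^sup>2 * (grad u (x0 + r *\<^sub>R z) \<bullet> z))"
      using harmonic_laplace[OF sub[OF that]] by (simp add: cz inner_vec_def grad_def mult.commute)
    finally show ?thesis .
  qed
  then have "(LINT z|ball_measure. (\<Sum>i\<in>UNIV. D i z (axis i 1)))
    = (LINT z|ball_measure. - 6 * ((1 - z \<bullet> z)\<^sup>2 * (grad u (x0 + r *\<^sub>R z) \<bullet> z)))"
    by (intro Bochner_Integration.integral_cong refl) (simp add: space_restrict_space)
  with I0 have "(LINT z|ball_measure. - 6 * ((1 - z \<bullet> z)\<^sup>2 * (grad u (x0 + r *\<^sub>R z) \<bullet> z))) = 0"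
    by (simp only:)
  then show ?thesis by simp
qed

text \<open>The derivative in r of the left-hand side is the integral just shown to vanish, so the
  value is the one at r = 0.\<close>

lemma harmonic_mean_unit:
  assumes sub: "ball x0 R \<subseteq> S" and r: "0 \<le> r" "r < R"
  shows "(LINT z|ball_measure. (1 - z \<bullet> z)\<^sup>2 * u (x0 + r *\<^sub>R z))
    = u x0 * (LINT z|ball_measure. (1 - z \<bullet> (z::real^'n))\<^sup>2)"
proof -
  define M where "M = (ball_measure :: (real^'n) measure)"
  define B where "B t = (LINT z|M. (1 - z \<bullet> z)\<^sup>2 * u (x0 + t *\<^sub>R z))" for t
  have inS: "x0 + t *\<^sub>R z \<in> S" if "z \<in> cball 0 1" "\<bar>t\<bar> < R" for t z
  proof -
    have "\<bar>t\<bar> * norm z \<le> \<bar>t\<bar> * 1" using that by (intro mult_left_mono) auto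
    then show ?thesis using that sub by (intro subsetD[OF sub]) (simp add: dist_norm)
  qed
  have int: "integrable M f" if "continuous_on (cball 0 1) f" for f :: "real^'n \<Rightarrow> real"
    using borel_integrable_compact[OF compact_cball that] unfolding M_def
    by (simp add: integrable_restrict_space)
  have der: "DERIV B t :> 0" if t: "\<bar>t\<bar> < R" for t
  proof -
    \<comment> \<open>Half of the remaining gap: all radii within \<open>e\<close> of t stay in one
      closed ball inside \<open>S\<close>, on which the gradient is bounded.\<close>
    define e where "e = (R - \<bar>t\<bar>) / 2"
    have e: "0 < e" using t by (simp add: e_def)
    have te: "\<bar>s\<bar> \<le> \<bar>t\<bar> + e" "\<bar>s\<bar> < R" if "\<bar>s - t\<bar> < e" for s
      using that t abs_triangle_ineq[of "s - t" t] unfolding e_def by (auto simp: field_simps)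
    have "\<bar>t\<bar> + e < R" using t by (simp add: e_def field_simps)
    then have "cball x0 (\<bar>t\<bar> + e) \<subseteq> S" using sub by (intro order_trans[OF _ sub]) auto
    then have "bounded (grad u ` cball x0 (\<bar>t\<bar> + e))"
      by (intro compact_imp_bounded compact_continuous_image compact_cball continuous_on_subset[OF harmonic_cont_grad])
    then obtain G where G: "\<And>x. x \<in> cball x0 (\<bar>t\<bar> + e) \<Longrightarrow> norm (grad u x) \<le> G"
      unfolding bounded_iff by blast
    have "DERIV B t :> (LINT z|M. (1 - z \<bullet> z)\<^sup>2 * (grad u (x0 + t *\<^sub>R z) \<bullet> z))"
      unfolding B_def
    proof (rule has_real_derivative_integral[OF e, where B = "\<lambda>_. G" and F' = "\<lambda>t z. (1 - z \<bullet> z)\<^sup>2 * (grad u (x0 + t *\<^sub>R z) \<bullet> z)"])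
      show "integrable M (\<lambda>z. (1 - z \<bullet> z)\<^sup>2 * u (x0 + s *\<^sub>R z))" if "\<bar>s - t\<bar> < e" for s
        by (intro int continuous_intros continuous_on_compose2[OF harmonic_cont]) (use inS te[OF that] in auto)
      show "integrable M (\<lambda>_. G)" by (rule int) auto
      fix s z assume s: "\<bar>s - t\<bar> < e" and "z \<in> space M"
      then have z: "z \<in> cball 0 1" by (simp add: M_def space_restrict_space)
      show "DERIV (\<lambda>s. (1 - z \<bullet> z)\<^sup>2 * u (x0 + s *\<^sub>R z)) s :> (1 - z \<bullet> z)\<^sup>2 * (grad u (x0 + s *\<^sub>R z) \<bullet> z)"
        by (intro DERIV_cmult has_real_derivative_along harmonic_diff inS z te[OF s])
      have nz: "norm z \<le> 1" using z by simp
      have "z \<bullet> z \<le> 1" using nz by (simp add: dot_square_norm power_le_one)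
      then have 1: "(1 - z \<bullet> z)\<^sup>2 \<le> 1" by (intro power_le_one) auto
      have "\<bar>s\<bar> * norm z \<le> \<bar>s\<bar> * 1" using nz by (intro mult_left_mono) auto
      then have "x0 + s *\<^sub>R z \<in> cball x0 (\<bar>t\<bar> + e)" using te[OF s] by (simp add: dist_norm)
      then have gr: "norm (grad u (x0 + s *\<^sub>R z)) \<le> G" by (rule G)
      have "\<bar>grad u (x0 + s *\<^sub>R z) \<bullet> z\<bar> \<le> norm (grad u (x0 + s *\<^sub>R z)) * norm z"
        by (rule Cauchy_Schwarz_ineq2)
      also have "\<dots> \<le> G * 1" using gr nz by (intro mult_mono) (auto intro: order_trans[OF norm_ge_zero])
      finally have 2: "\<bar>grad u (x0 + s *\<^sub>R z) \<bullet> z\<bar> \<le> G" by simp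
      show "\<bar>(1 - z \<bullet> z)\<^sup>2 * (grad u (x0 + s *\<^sub>R z) \<bullet> z)\<bar> \<le> G"
        using mult_mono[OF 1 2] by (simp add: abs_mult)
    qed
    also have "(LINT z|M. (1 - z \<bullet> z)\<^sup>2 * (grad u (x0 + t *\<^sub>R z) \<bullet> z)) = 0"
      unfolding M_def by (rule integral_radial_derivative) (use inS t in auto)
    finally show ?thesis .
  qed
  have "B r = B 0"
  proof (cases "r = 0")
    case False
    have "\<exists>z>0. z < r \<and> B r - B 0 = (r - 0) * 0"
      by (rule MVT2[of 0 r B "\<lambda>_. 0"]) (use r der False in auto)
    then show ?thesis by auto
  qed simp
  then show ?thesis unfolding B_def M_def[symmetric] by (simp add: mult.commute)
qed

end

section \<open>Harnack's inequality\<close>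

lemma integral_lborel_affine_euclidean:
  fixes f :: "'a::euclidean_space \<Rightarrow> real"
  assumes c: "\<And>j. j \<in> Basis \<Longrightarrow> c j \<noteq> 0" and f: "f \<in> borel_measurable borel"
  shows "(LINT x|lborel. f x) = (\<Prod>j\<in>Basis. \<bar>c j\<bar>) * (LINT x|lborel. f (t + (\<Sum>j\<in>Basis. (c j * (x \<bullet> j)) *\<^sub>R j)))"
proof -
  define T where "T x = t + (\<Sum>j\<in>Basis. (c j * (x \<bullet> j)) *\<^sub>R j)" for x
  have T: "T \<in> borel_measurable borel"
    unfolding T_def by (intro borel_measurable_continuous_onI continuous_intros)
  have "lborel = density (distr lborel borel T) (\<lambda>_. (\<Prod>j\<in>Basis. \<bar>c j\<bar>))"
    unfolding T_def using lborel_affine_euclidean[of c t] c by simp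
  then have "(LINT x|lborel. f x) = (\<integral>x. f x \<partial>density (distr lborel borel T) (\<lambda>_. (\<Prod>j\<in>Basis. \<bar>c j\<bar>)))"
    by simp
  also have "\<dots> = (\<integral>x. (\<Prod>j\<in>Basis. \<bar>c j\<bar>) *\<^sub>R f x \<partial>distr lborel borel T)"
    by (rule integral_density) (use f in \<open>auto intro!: AE_I2 prod_nonneg\<close>)
  also have "\<dots> = (\<Prod>j\<in>Basis. \<bar>c j\<bar>) * (LINT x|lborel. f (T x))"
    using f T by (simp add: integral_distr)
  finally show ?thesis by (simp add: T_def)
qed

lemma integral_lborel_affine:
  fixes f :: "'a::euclidean_space \<Rightarrow> real"
  assumes "c \<noteq> 0" and f: "f \<in> borel_measurable borel"
  shows "(LINT x|lborel. f x) = \<bar>c\<bar> ^ DIM('a) * (LINT x|lborel. f (t + c *\<^sub>R x))"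
proof -
  have "(\<Sum>j\<in>Basis. (c * (x \<bullet> j)) *\<^sub>R j) = c *\<^sub>R x" for x :: 'a
    unfolding scaleR_scaleR[symmetric] scaleR_sum_right[symmetric] euclidean_representation ..
  then show ?thesis
    using integral_lborel_affine_euclidean[of "\<lambda>_. c" f t] assms by simp
qed

lemma lborel_integral_pos:
  fixes f :: "'a::euclidean_space \<Rightarrow> real"
  assumes int: "integrable lborel f" and nn: "\<And>x. 0 \<le> f x"
    and U: "open U" "U \<noteq> {}" and pos: "\<And>x. x \<in> U \<Longrightarrow> 0 < f x"
  shows "0 < (LINT x|lborel. f x)"
proof -
  obtain a r where r: "0 < r" "ball a r \<subseteq> U" using U open_contains_ball by blast
  have "(LINT x|lborel. f x) \<noteq> 0"
  proof
    assume "(LINT x|lborel. f x) = 0"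
    then have "AE x in lborel. f x = 0"
      using integral_nonneg_eq_0_iff_AE[OF int] nn by simp
    then have "AE x in lborel. x \<notin> ball a r"
      by eventually_elim (use r pos in fastforce)
    then have "ball a r \<in> null_sets lborel"
      by (subst AE_iff_null_sets) auto
    then have "measure lborel (ball a r) = 0"
      by (simp add: null_sets_def measure_def)
    then show False using content_ball_pos[OF r(1), of a] by simp
  qed
  moreover have "0 \<le> (LINT x|lborel. f x)" using nn by simp
  ultimately show ?thesis by simp
qed

text \<open>The mean value weight moved to the ball of radius R about y, without dividing by R^4: in
  this normalization the weights of nested balls are ordered pointwise, which is what Harnack's
  inequality rests on.\<close>

definition radial_weight :: "'a::real_inner \<Rightarrow> real \<Rightarrow> 'a \<Rightarrow> real" where
  "radial_weight y R w = (max 0 (R\<^sup>2 - (w - y) \<bullet> (w - y)))\<^sup>2"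

lemma radial_weight_eq_0: "w \<notin> cball y R \<Longrightarrow> 0 \<le> R \<Longrightarrow> radial_weight y R w = 0"
proof -
  assume "w \<notin> cball y R" "0 \<le> R"
  then have "R \<le> norm (w - y)" by (simp add: dist_norm norm_minus_commute)
  then have "R\<^sup>2 \<le> (w - y) \<bullet> (w - y)"
    using \<open>0 \<le> R\<close> by (simp add: dot_square_norm power_mono)
  then show ?thesis by (simp add: radial_weight_def)
qed

lemma continuous_on_radial_weight: "continuous_on A (radial_weight y R)"
  unfolding radial_weight_def by (intro continuous_intros)

text \<open>If a = |w - x| is at most R - h, then |w - y| <= a + h, and (a + h)^2 - a^2 = 2 h a +
  h^2 is at most 2 h (R - h) + h^2 = R^2 - (R - h)^2. Otherwise the smaller weight is zero.\<close>

lemma radial_weight_mono: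
  assumes "dist x y \<le> h" "h \<le> R"
  shows "radial_weight x (R - h) w \<le> radial_weight y R w"
proof -
  have "(R - h)\<^sup>2 - (norm (w - x))\<^sup>2 \<le> max 0 (R\<^sup>2 - (norm (w - y))\<^sup>2)"
  proof (cases "norm (w - x) \<le> R - h")
    case True
    have "norm (w - y) \<le> norm (w - x) + dist x y"
      using norm_triangle_ineq[of "w - x" "x - y"] by (simp add: dist_norm)
    then have "norm (w - y) \<le> norm (w - x) + h" using assms by simp
    then have 1: "(norm (w - y))\<^sup>2 \<le> (norm (w - x) + h)\<^sup>2" by (intro power_mono) auto
    have "0 \<le> h" using assms(1) zero_le_dist order_trans by blast
    then have "h * norm (w - x) \<le> h * (R - h)" using True by (intro mult_left_mono) auto
    then have "(R - h)\<^sup>2 - (norm (w - x))\<^sup>2 \<le> R\<^sup>2 - (norm (w - x) + h)\<^sup>2"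
      by (simp add: power2_eq_square algebra_simps)
    then show ?thesis using 1 by simp
  next
    case False
    then have "(R - h)\<^sup>2 \<le> (norm (w - x))\<^sup>2" using assms by (intro power_mono) auto
    then show ?thesis by simp
  qed
  then show ?thesis
    unfolding radial_weight_def dot_square_norm by (intro power_mono) auto
qed

text \<open>A constant of the dimension alone, named by the type argument. It cancels in Harnack's
  inequality, so only its sign matters.\<close>

definition radial_mass :: "(real^'n) itself \<Rightarrow> real" where
  "radial_mass _ = (LINT z|ball_measure. (1 - z \<bullet> (z::real^'n))\<^sup>2)"

lemma radial_mass_pos: "0 < radial_mass TYPE(real^'n)"
proof -
  have int: "integrable lborel (\<lambda>z. indicator (cball 0 1) z *\<^sub>R (1 - z \<bullet> (z::real^'n))\<^sup>2)"
    by (rule borel_integrable_compact) (auto intro!: continuous_intros)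
  have "0 < (LINT z|lborel. indicator (cball 0 1) z *\<^sub>R (1 - z \<bullet> (z::real^'n))\<^sup>2)"
  proof (rule lborel_integral_pos[OF int, of "ball 0 1"])
    fix z :: "real^'n" assume z: "z \<in> ball 0 1"
    have "z \<bullet> z < 1" using z by (simp add: dot_square_norm power_less_one_iff)
    then show "0 < indicator (cball 0 1) z *\<^sub>R (1 - z \<bullet> z)\<^sup>2" using z by (simp add: less_imp_le)
  qed auto
  then show ?thesis
    unfolding radial_mass_def by (simp add: integral_restrict_space)
qed

context
  fixes S :: "(real^'n) set" and u :: "real^'n \<Rightarrow> real"
  assumes S: "open S" and harm: "harmonic_on S u"
begin

text \<open>The dilation of the unit ball contributes R^n and the unnormalized weight R^4. The
  factor \<open>indicator S w\<close> makes the integrand global, so that averages about two centres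
  can be compared under one integral.\<close>

lemma harmonic_mean:
  assumes sub: "ball y \<rho> \<subseteq> S" and R: "0 < R" "R < \<rho>"
  shows "has_bochner_integral lborel (\<lambda>w. radial_weight y R w * (indicator S w * u w))
    (R ^ (CARD('n) + 4) * radial_mass TYPE(real^'n) * u y)"
proof -
  let ?f = "\<lambda>w. radial_weight y R w * (indicator S w * u w)"
  have cS: "cball y R \<subseteq> S" using sub R by auto
  have f_eq: "?f = (\<lambda>w. indicator (cball y R) w *\<^sub>R (radial_weight y R w * u w))"
    using cS R by (auto simp: fun_eq_iff indicator_def radial_weight_eq_0)
  have int: "integrable lborel ?f"
    unfolding f_eq
    by (intro borel_integrable_compact compact_cball continuous_intros continuous_on_radial_weight
        continuous_on_subset[OF harmonic_cont[OF S harm] cS])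
  then have meas: "?f \<in> borel_measurable borel"
    using borel_measurable_integrable by fastforce
  have "(LINT w|lborel. ?f w) = R ^ CARD('n) * (LINT z|lborel. ?f (y + R *\<^sub>R z))"
    using integral_lborel_affine[OF _ meas, of R y] R by simp
  also have "(\<lambda>z. ?f (y + R *\<^sub>R z)) = (\<lambda>z. R ^ 4 * (indicator (cball 0 1) z *\<^sub>R ((1 - z \<bullet> z)\<^sup>2 * u (y + R *\<^sub>R z))))"
  proof
    fix z
    show "?f (y + R *\<^sub>R z) = R ^ 4 * (indicator (cball 0 1) z *\<^sub>R ((1 - z \<bullet> z)\<^sup>2 * u (y + R *\<^sub>R z)))"
    proof (cases "z \<in> cball 0 1")
      case True
      have nz: "norm z \<le> 1" using True by simp
      then have zz: "z \<bullet> z \<le> 1" by (simp add: dot_square_norm power_le_one)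
      have "y + R *\<^sub>R z \<in> cball y R" using nz R by (simp add: dist_norm mult_left_le)
      then have "y + R *\<^sub>R z \<in> S" using cS by auto
      moreover have "radial_weight y R (y + R *\<^sub>R z) = R ^ 4 * (1 - z \<bullet> z)\<^sup>2"
      proof -
        have "R\<^sup>2 - (R *\<^sub>R z) \<bullet> (R *\<^sub>R z) = R\<^sup>2 * (1 - z \<bullet> z)"
          by (simp add: power2_eq_square algebra_simps)
        then show ?thesis
          using zz by (simp add: radial_weight_def power_mult_distrib power_mult[symmetric])
      qed
      ultimately show ?thesis using True by simp
    next
      case False
      then have "y + R *\<^sub>R z \<notin> cball y R" using R by (simp add: dist_norm)
      then show ?thesis using False R by (simp add: radial_weight_eq_0)
    qed
  qed
  also have "(LINT z|lborel. R ^ 4 * (indicator (cball 0 1) z *\<^sub>R ((1 - z \<bullet> z)\<^sup>2 * u (y + R *\<^sub>R z))))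
    = R ^ 4 * (LINT z|ball_measure. ((1 - z \<bullet> z)\<^sup>2 * u (y + R *\<^sub>R z)))"
    by (simp add: integral_restrict_space)
  also have "\<dots> = R ^ 4 * (u y * radial_mass TYPE(real^'n))"
    using harmonic_mean_unit[OF S harm sub, of R] R by (simp add: radial_mass_def)
  finally show ?thesis
    using int by (simp add: has_bochner_integral_iff power_add algebra_simps)
qed

text \<open>For u >= 0 the ordering of the weights compares the average about x of radius R - h with
  the one about y of radius R. At h = 0 both sides coincide, so the inequality can be
  differentiated; \<open>harmonic_grad_bound\<close> does so.\<close>

lemma harmonic_harnack:
  assumes sub: "ball y \<rho> \<subseteq> S" and h: "dist x y \<le> h" "h < R" and R: "R < \<rho>"
    and nn: "\<And>w. w \<in> S \<Longrightarrow> 0 \<le> u w"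
  shows "(R - h) ^ (CARD('n) + 4) * u x \<le> R ^ (CARD('n) + 4) * u y"
proof -
  have h0: "0 \<le> h" using h(1) zero_le_dist order_trans by blast
  have "ball x (\<rho> - h) \<subseteq> ball y \<rho>"
    using h by (auto intro: le_less_trans[OF dist_triangle2[of _ _ x]] simp: dist_commute) (smt (verit) dist_commute dist_triangle)
  then have "ball x (\<rho> - h) \<subseteq> S" using sub by auto
  then have 1: "has_bochner_integral lborel (\<lambda>w. radial_weight x (R - h) w * (indicator S w * u w))
    ((R - h) ^ (CARD('n) + 4) * radial_mass TYPE(real^'n) * u x)"
    using h R by (intro harmonic_mean) auto
  have 2: "has_bochner_integral lborel (\<lambda>w. radial_weight y R w * (indicator S w * u w))
    (R ^ (CARD('n) + 4) * radial_mass TYPE(real^'n) * u y)"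
    using h h0 R by (intro harmonic_mean[OF sub]) auto
  have "(R - h) ^ (CARD('n) + 4) * radial_mass TYPE(real^'n) * u x \<le> R ^ (CARD('n) + 4) * radial_mass TYPE(real^'n) * u y"
    unfolding has_bochner_integral_integral_eq[OF 1, symmetric] has_bochner_integral_integral_eq[OF 2, symmetric]
    using 1 2 by (intro integral_mono mult_right_mono radial_weight_mono)
      (use h nn in \<open>auto simp: has_bochner_integral_iff indicator_def\<close>)
  then have "((R - h) ^ (CARD('n) + 4) * u x) * radial_mass TYPE(real^'n) \<le> (R ^ (CARD('n) + 4) * u y) * radial_mass TYPE(real^'n)"
    by (simp add: mult_ac)
  then show ?thesis using radial_mass_pos[where 'n='n] by (simp only: mult_le_cancel_right_pos)
qed

text \<open>Moving from x by s along the direction \<open>e\<close> of steepest descent, Harnack's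
  inequality says u(x + s e) >= (1 - s/r)^k u(x), with equality at s = 0. Comparing the derivatives
  there gives |grad u(x)| <= k u(x) / r; then r tends to R.\<close>

lemma harmonic_grad_bound:
  assumes sub: "ball x R \<subseteq> S" and R: "0 < R"
    and nn: "\<And>w. w \<in> S \<Longrightarrow> 0 \<le> u w"
  shows "norm (grad u x) \<le> (CARD('n) + 4) * u x / R"
proof (cases "grad u x = 0")
  case True
  have "x \<in> S" using sub R by auto
  then show ?thesis using True nn R by simp
next
  case False
  define k where "k = CARD('n) + 4"
  define e where "e = (- 1 / norm (grad u x)) *\<^sub>R grad u x"
  have e: "norm e = 1" using False by (simp add: e_def)
  have xS: "x \<in> S" using sub R by auto
  have bound: "norm (grad u x) \<le> real k * u x / r" if r: "0 < r" "r < R" for r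
  proof (rule ccontr)
    assume neg: "\<not> ?thesis"
    define f where "f s = u (x + s *\<^sub>R e) - (1 - s / r) ^ k * u x" for s
    have du: "DERIV (\<lambda>s. u (x + s *\<^sub>R e)) 0 :> grad u (x + 0 *\<^sub>R e) \<bullet> e"
      by (rule has_real_derivative_along) (use harmonic_diff[OF S harm xS] in simp)
    have "DERIV (\<lambda>s. 1 - s / r) 0 :> - (1 / r)"
      using r by (auto intro!: derivative_eq_intros)
    from DERIV_power[OF this, of k]
    have "DERIV (\<lambda>s. (1 - s / r) ^ k) 0 :> - (real k / r)" by simp
    from DERIV_diff[OF du DERIV_cmult_right[OF this, of "u x"]]
    have "DERIV f 0 :> (grad u x \<bullet> e + real k * u x / r)"
      by (simp add: f_def[abs_def])
    moreover have "grad u x \<bullet> e = - norm (grad u x)"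
      using False by (simp add: e_def dot_square_norm power2_eq_square)
    ultimately have "DERIV f 0 :> (real k * u x / r - norm (grad u x))" by simp
    from DERIV_neg_dec_right[OF this] neg
    obtain d where d: "d > 0" "\<And>h. 0 < h \<Longrightarrow> h < d \<Longrightarrow> f (0 + h) < f 0" by (auto simp: not_le)
    \<comment> \<open>\<open>r + s < R\<close> makes r an admissible radius in the ball of radius R
      - s about the shifted centre.\<close>
    define s where "s = min d (min r (R - r)) / 2"
    have s: "0 < s" "s < d" "s < r" "r + s < R" using d r by (auto simp: s_def min_def field_simps)
    have ball: "ball (x + s *\<^sub>R e) (R - s) \<subseteq> S"
    proof (rule order_trans[OF _ sub], rule subsetI)
      fix w assume "w \<in> ball (x + s *\<^sub>R e) (R - s)"
      then have "dist (x + s *\<^sub>R e) w < R - s" by simp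
      moreover have "dist x (x + s *\<^sub>R e) = s" using s e by (simp add: dist_norm)
      ultimately show "w \<in> ball x R" using dist_triangle[of x w "x + s *\<^sub>R e"] by simp
    qed
    have "(r - s) ^ k * u x \<le> r ^ k * u (x + s *\<^sub>R e)"
      unfolding k_def by (rule harmonic_harnack[OF ball]) (use s e nn in \<open>auto simp: dist_norm\<close>)
    moreover have "(r - s) ^ k = r ^ k * (1 - s / r) ^ k"
      using r by (simp add: power_mult_distrib[symmetric] field_simps)
    ultimately have "r ^ k * ((1 - s / r) ^ k * u x) \<le> r ^ k * u (x + s *\<^sub>R e)" by (simp add: mult.assoc)
    then have "0 \<le> f s" using r by (simp add: f_def)
    moreover have "f 0 = 0" by (simp add: f_def)
    ultimately show False using d(2)[of s] s by simp
  qed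
  have "((\<lambda>r. real k * u x / r) \<longlongrightarrow> real k * u x / R) (at_left R)"
    using R by (intro tendsto_intros) auto
  moreover have "eventually (\<lambda>r. norm (grad u x) \<le> real k * u x / r) (at_left R)"
    using eventually_at_left_real[OF R] by eventually_elim (use bound in auto)
  ultimately show ?thesis
    unfolding k_def by (intro tendsto_lowerbound) auto
qed

end

section \<open>The Hopf lemma\<close>

lemma inner_add_axis:
  fixes z :: "real^'n"
  shows "(z + step i s) \<bullet> (z + step i s) = z \<bullet> z + 2 * s * z $ i + s\<^sup>2"
  by (simp add: inner_add_left inner_add_right inner_axis inner_axis' power2_eq_square algebra_simps)

text \<open>The convex function r^-4 lies above its tangent at r = d. This turns the Hopf barrier
  into a bound linear in the distance s to the sphere.\<close>

lemma one_div_power4_ge: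
  fixes d s :: real
  assumes "0 \<le> s" "s < d"
  shows "1 / d ^ 4 + 4 * s / d ^ 5 \<le> 1 / (d - s) ^ 4"
proof -
  have d: "0 < d" using assms by simp
  have "- 1 \<le> s / d" using assms d divide_nonneg_pos[of s d] by linarith
  then have "1 + 4 * (s / d) \<le> (1 + s / d) ^ 4"
    using Bernoulli_inequality[of "s / d" 4] by simp
  also have "\<dots> \<le> (1 / (1 - s / d)) ^ 4"
  proof (rule power_mono)
    have "(1 + s / d) * (1 - s / d) \<le> 1" by (simp add: algebra_simps)
    then show "1 + s / d \<le> 1 / (1 - s / d)" using assms d by (simp add: field_simps)
  qed (use assms d in auto)
  also have "\<dots> = d ^ 4 / (d - s) ^ 4"
  proof -
    have "1 / (1 - s / d) = d / (d - s)" using assms d by (simp add: field_simps)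
    then show ?thesis by (simp add: power_divide)
  qed
  finally have "(1 + 4 * (s / d)) / d ^ 4 \<le> (d ^ 4 / (d - s) ^ 4) / d ^ 4"
    using d by (intro divide_right_mono) auto
  moreover have "(1 + 4 * (s / d)) / d ^ 4 = 1 / d ^ 4 + 4 * s / d ^ 5"
    using d by (simp add: field_simps numeral_eq_Suc)
  moreover have "(d ^ 4 / (d - s) ^ 4) / d ^ 4 = 1 / (d - s) ^ 4" using d by simp
  ultimately show ?thesis by simp
qed

context
  fixes S :: "(real^4) set" and u :: "real^4 \<Rightarrow> real"
  assumes S: "open S" and harm: "harmonic_on S u" and pos: "\<And>x. x \<in> S \<Longrightarrow> 0 < u x"
begin

text \<open>The barrier \<open>|x - x0|\<^sup>-\<^sup>4\<close> is strictly subharmonic in dimension four.\<close>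
lemma hopf_barrier:
  assumes sub: "ball x0 d \<subseteq> S" and d: "0 < d" and x: "d / 4 \<le> dist x0 x" "dist x0 x < d"
  shows "u x0 * d ^ 4 / 2 ^ 16 * (1 / dist x0 x ^ 4 - 1 / d ^ 4) \<le> u x"
proof (rule ccontr)
  \<comment> \<open>2^16 = 2^8 * 4^4: Harnack's inequality loses the factor 2^8 from the centre to
    the sphere of radius d/4, where r^-4 equals 4^4 / d^4. The barrier is then strictly below u on
    that sphere.\<close>
  define c where "c = u x0 * d ^ 4 / 2 ^ 16"
  define b where "b r = c * (1 / r ^ 4 - 1 / d ^ 4)" for r
  assume "\<not> ?thesis"
  then have neg: "u x < b (dist x0 x)" by (simp add: b_def c_def)
  have x0S: "x0 \<in> S" using sub d by auto
  have c: "0 < c" using pos[OF x0S] d by (simp add: c_def)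
  have inner: "b (d / 4) < u y" if y: "dist x0 y = d / 4" for y
  proof -
    have "ball y (3 * d / 4) \<subseteq> S"
    proof (rule order_trans[OF _ sub], rule subsetI)
      fix w assume "w \<in> ball y (3 * d / 4)"
      then show "w \<in> ball x0 d" using dist_triangle[of x0 w y] y by simp
    qed
    then have "(d / 2 - d / 4) ^ (CARD(4) + 4) * u x0 \<le> (d / 2) ^ (CARD(4) + 4) * u y"
      by (rule harmonic_harnack[OF S harm]) (use d y pos less_imp_le in auto)
    then have "u x0 \<le> 2 ^ 8 * u y" using d by (simp add: field_simps)
    moreover have "b (d / 4) = u x0 * 255 / 2 ^ 16"
      using d by (simp add: b_def c_def field_simps)
    ultimately show ?thesis using pos[OF x0S] by simp
  qed
  \<comment> \<open>The minimum of u - b over the shell is at most -\<eta>. On the inner sphere u -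
    b is positive, and on an outer sphere of radius close enough to d it exceeds -\<eta>, since
    there u > 0 and b < \<eta>. So the minimum is attained in the interior.\<close>
  define \<eta> where "\<eta> = b (dist x0 x) - u x"
  have \<eta>: "0 < \<eta>" using neg by (simp add: \<eta>_def)
  have "(b \<longlongrightarrow> b d) (at_left d)"
    unfolding b_def using d by (intro tendsto_intros) auto
  then have "eventually (\<lambda>r. b r < \<eta>) (at_left d)"
    by (rule order_tendstoD) (use \<eta> in \<open>simp add: b_def\<close>)
  moreover have "eventually (\<lambda>r. r \<in> {dist x0 x<..<d}) (at_left d)"
    using eventually_at_left_real x by blast
  ultimately have "eventually (\<lambda>r. b r < \<eta> \<and> r \<in> {dist x0 x<..<d}) (at_left d)"
    by eventually_elim simp
  then obtain r where r: "b r < \<eta>" "dist x0 x < r" "r < d"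
    using eventually_happens[of _ "at_left d"] by auto
  define A where "A = cball x0 r - ball x0 (d / 4)"
  have A: "compact A" unfolding A_def by (intro compact_diff) auto
  have AS: "A \<subseteq> S" using r sub by (auto simp: A_def)
  have pA: "0 < dist x0 y" if "y \<in> A" for y using that d by (auto simp: A_def)
  have "continuous_on A (\<lambda>y. u y - b (dist x0 y))"
    unfolding b_def using pA
    by (intro continuous_intros continuous_on_subset[OF harmonic_cont[OF S harm] AS]) force
  moreover have xA: "x \<in> A" using x r by (auto simp: A_def)
  ultimately have "\<exists>y\<in>A. \<forall>w\<in>A. u y - b (dist x0 y) \<le> u w - b (dist x0 w)"
    by (intro continuous_attains_inf A) auto
  then obtain y where y: "y \<in> A" and ymin: "\<And>w. w \<in> A \<Longrightarrow> u y - b (dist x0 y) \<le> u w - b (dist x0 w)"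
    by blast
  have "u y - b (dist x0 y) \<le> - \<eta>"
    using ymin[OF xA] by (simp add: \<eta>_def)
  moreover have "0 < u y" using y AS pos by auto
  ultimately have "dist x0 y \<noteq> d / 4" "dist x0 y \<noteq> r" using inner[of y] \<eta> r(1) by auto
  then have yi: "d / 4 < dist x0 y" "dist x0 y < r" using y by (auto simp: A_def)
  define e where "e = min (dist x0 y - d / 4) (r - dist x0 y)"
  have e: "0 < e" using yi by (simp add: e_def)
  have eA: "y + step i s \<in> A" if "\<bar>s\<bar> < e" for s i
  proof -
    have "dist y (y + step i s) < e" using that by (simp add: dist_norm)
    then show ?thesis
      using dist_triangle[of x0 "y + step i s" y] dist_triangle2[of x0 y "y + step i s"]
      by (auto simp: A_def e_def)
  qed
  define z where "z = y - x0"
  define q where "q = z \<bullet> z"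
  have dist4: "dist x0 w ^ 4 = ((w - x0) \<bullet> (w - x0)) ^ 2" for w
    by (simp add: dist_norm norm_minus_commute dot_square_norm power_mult[symmetric])
  have "0 < dist x0 y" using pA y by simp
  then have q: "0 < q" by (simp add: q_def z_def)
  have second: "0 \<le> partial2 u i i y - c * (24 * (z $ i)\<^sup>2 / q ^ 4 - 4 / q ^ 3)" for i
  proof -
    define Q where "Q s = q + 2 * s * z $ i + s\<^sup>2" for s
    have Q: "Q s = (y + step i s - x0) \<bullet> (y + step i s - x0)" for s
      using inner_add_axis[of z s i] by (simp add: Q_def q_def z_def algebra_simps)
    have Qpos: "0 < Q s" if "\<bar>s\<bar> < e" for s
      using pA[OF eA[OF that, of i]] by (auto simp: Q)
    define f where "f s = u (y + step i s) - c * (1 / (Q s)\<^sup>2 - 1 / d ^ 4)" for s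
    define f1 where "f1 s = partial u i (y + step i s) - c * (- 2 * (2 * z $ i + 2 * s) / (Q s) ^ 3)" for s
    have dQ: "DERIV Q s :> (2 * z $ i + 2 * s)" for s
      unfolding Q_def by (auto intro!: derivative_eq_intros)
    show ?thesis
    proof (rule second_derivative_nonneg_at_local_min[OF e, of f f1])
      fix s assume s: "\<bar>s\<bar> < e"
      have "DERIV (\<lambda>s. u (y + step i s)) s :> partial u i (y + step i s)"
        using has_real_derivative_along[OF harmonic_diff[OF S harm], of y s "axis i 1"] eA[OF s] AS
        by (auto simp: grad_inner_axis)
      then show "DERIV f s :> f1 s"
        unfolding f_def f1_def using Qpos[OF s]
        by (auto intro!: derivative_eq_intros dQ simp: power2_eq_square power3_eq_cube field_simps)
      show "f 0 \<le> f s"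
        using ymin[OF eA[OF s, of i]] Q[of 0] Q[of s] by (simp add: f_def b_def dist4)
    next
      have 1: "DERIV (\<lambda>s. partial u i (y + step i s)) 0 :> partial2 u i i (y + step i 0)"
        using has_real_derivative_along[OF harmonic_diff2[OF S harm], of y 0 "axis i 1" i] eA[of 0 i] e AS
        by (auto simp: grad_inner_axis)
      have 2: "((\<lambda>s. - 2 * (2 * z $ i + 2 * s) / (Q s) ^ 3) has_real_derivative
          (- 4 / q ^ 3 + 24 * (z $ i)\<^sup>2 / q ^ 4)) (at 0)"
        using q by (auto intro!: derivative_eq_intros dQ simp: Q_def power2_eq_square numeral_eq_Suc field_simps)
      show "DERIV f1 0 :> partial2 u i i y - c * (24 * (z $ i)\<^sup>2 / q ^ 4 - 4 / q ^ 3)"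
        unfolding f1_def using DERIV_diff[OF 1 DERIV_cmult[OF 2, of c]] by simp
    qed
  qed
  \<comment> \<open>With q = |z|^2 the Laplacian of |z|^-4 is 24/q^3 - 16/q^3 = 8/q^3, strictly
    positive, whereas the minimum of u - b forces it to be at most zero.\<close>
  have "0 \<le> (\<Sum>i\<in>UNIV. partial2 u i i y - c * (24 * (z $ i)\<^sup>2 / q ^ 4 - 4 / q ^ 3))"
    by (intro sum_nonneg second)
  also have "\<dots> = (\<Sum>i\<in>UNIV. partial2 u i i y) - c * (24 * (\<Sum>i\<in>UNIV. (z $ i)\<^sup>2) / q ^ 4 - 16 / q ^ 3)"
    by (simp add: sum_subtractf sum_distrib_left right_diff_distrib sum_divide_distrib)
  also have "(\<Sum>i\<in>UNIV. (z $ i)\<^sup>2) = q"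
    by (simp add: q_def inner_vec_def power2_eq_square)
  also have "(\<Sum>i\<in>UNIV. partial2 u i i y) = 0"
    using y AS by (intro harmonic_laplace[OF S harm]) auto
  also have "24 * q / q ^ 4 - 16 / q ^ 3 = 8 / q ^ 3" using q by (simp add: field_simps numeral_eq_Suc)
  finally have "c * (8 / q ^ 3) \<le> 0" by simp
  moreover have "0 < c * (8 / q ^ 3)" using c q by (intro mult_pos_pos divide_pos_pos) auto
  ultimately show False by linarith
qed

text \<open>Squeeze u at distance s from p on the segment to x0. The barrier bounds it below by 4 s
  u(x0) / (2^16 d), while the gradient, of norm below 2 near p, bounds it above by 2 s; the quotient
  of the two is the constant 2^15.\<close>

lemma hopf_bound:
  assumes sub: "ball x0 d \<subseteq> S" and d: "0 < d" "dist x0 p = d"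
    and u0: "(u \<longlongrightarrow> 0) (at p within S)" and gr: "(grad u \<longlongrightarrow> v) (at p within S)" and v: "norm v = 1"
  shows "u x0 \<le> 2 ^ 15 * d"
proof -
  define n where "n = (x0 - p) /\<^sub>R d"
  have n: "norm n = 1" using d by (simp add: n_def dist_norm)
  have dn: "x0 - p = d *\<^sub>R n" using d by (simp add: n_def)
  have dX: "dist x0 (p + s *\<^sub>R n) = d - s" if "s \<le> d" for s
  proof -
    have "x0 - (p + s *\<^sub>R n) = (d - s) *\<^sub>R n"
      using dn by (simp add: algebra_simps)
    then show ?thesis using n that by (simp add: dist_norm)
  qed
  have XS: "p + s *\<^sub>R n \<in> S" if "0 < s" "s \<le> d" for s
    using dX[OF that(2)] that sub by auto
  have "filterlim (\<lambda>s. p + s *\<^sub>R n) (at p within S) (at_right 0)"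
    unfolding filterlim_at
  proof
    have "eventually (\<lambda>s. s \<in> {0<..<d}) (at_right 0)"
      by (rule eventually_at_right_real) (rule d)
    then show "eventually (\<lambda>s. p + s *\<^sub>R n \<in> S \<and> p + s *\<^sub>R n \<noteq> p) (at_right 0)"
      by eventually_elim (use XS n in auto)
    have "((\<lambda>s. p + s *\<^sub>R n) \<longlongrightarrow> p + 0 *\<^sub>R n) (at_right 0)" by (intro tendsto_intros)
    then show "((\<lambda>s. p + s *\<^sub>R n) \<longlongrightarrow> p) (at_right 0)" by simp
  qed
  then have lim_u: "((\<lambda>s. u (p + s *\<^sub>R n)) \<longlongrightarrow> 0) (at_right 0)"
    and lim_g: "((\<lambda>s. norm (grad u (p + s *\<^sub>R n))) \<longlongrightarrow> 1) (at_right 0)"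
    using filterlim_compose[OF u0] filterlim_compose[OF tendsto_norm[OF gr]] v by auto
  have "eventually (\<lambda>s. norm (grad u (p + s *\<^sub>R n)) < 2) (at_right 0)"
    by (rule order_tendstoD[OF lim_g]) simp
  then obtain \<epsilon> where \<epsilon>: "0 < \<epsilon>" "\<And>s. 0 < s \<Longrightarrow> s < \<epsilon> \<Longrightarrow> norm (grad u (p + s *\<^sub>R n)) < 2"
    by (auto simp: eventually_at_right_field)
  \<comment> \<open>Besides the gradient bound, s has to leave the point in the shell of
    \<open>hopf_barrier\<close>, at distance at least d/4 from x0.\<close>
  define s where "s = min \<epsilon> (d / 2) / 2"
  have s: "0 < s" "s < \<epsilon>" "s < d" "s \<le> 3 * d / 4" using \<epsilon> d by (auto simp: s_def min_def field_simps)
  \<comment> \<open>Nothing is known about differentiability at p itself, so u <= 2 s is obtained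
    from monotonicity on the open segment and the limit of u at p.\<close>
  have mono: "u (p + s *\<^sub>R n) - 2 * s \<le> u (p + t *\<^sub>R n) - 2 * t" if t: "0 < t" "t < s" for t
  proof (rule DERIV_nonpos_imp_nonincreasing[of t s "\<lambda>s. u (p + s *\<^sub>R n) - 2 * s"])
    fix r assume r: "t \<le> r" "r \<le> s"
    have "p + r *\<^sub>R n \<in> S" using XS[of r] r s t by simp
    then have "DERIV (\<lambda>s. u (p + s *\<^sub>R n) - 2 * s) r :> (grad u (p + r *\<^sub>R n) \<bullet> n - 2)"
      by (intro DERIV_diff has_real_derivative_along harmonic_diff[OF S harm]) (auto intro!: derivative_eq_intros)
    moreover have "grad u (p + r *\<^sub>R n) \<bullet> n \<le> 2"
      using norm_cauchy_schwarz[of "grad u (p + r *\<^sub>R n)" n] n \<epsilon>(2)[of r] r s t by simp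
    ultimately show "\<exists>y. DERIV (\<lambda>s. u (p + s *\<^sub>R n) - 2 * s) r :> y \<and> y \<le> 0" by fastforce
  qed (use t in simp)
  have "((\<lambda>t. u (p + t *\<^sub>R n) - 2 * t) \<longlongrightarrow> 0 - 2 * 0) (at_right 0)"
    by (intro tendsto_intros lim_u)
  moreover have "eventually (\<lambda>t. u (p + s *\<^sub>R n) - 2 * s \<le> u (p + t *\<^sub>R n) - 2 * t) (at_right 0)"
    using eventually_at_right_real[OF s(1)] by eventually_elim (use mono in auto)
  ultimately have up: "u (p + s *\<^sub>R n) - 2 * s \<le> 0 - 2 * 0"
    by (rule tendsto_lowerbound) simp
  have x0S: "x0 \<in> S" using sub d by auto
  have "u x0 * d ^ 4 / 2 ^ 16 * (4 * s / d ^ 5) \<le> u x0 * d ^ 4 / 2 ^ 16 * (1 / (d - s) ^ 4 - 1 / d ^ 4)"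
    using one_div_power4_ge[of s d] s d pos[OF x0S] by (intro mult_left_mono) auto
  also have "\<dots> \<le> u (p + s *\<^sub>R n)"
    using hopf_barrier[OF sub d(1), of "p + s *\<^sub>R n"] dX[of s] s by simp
  also have "\<dots> \<le> 2 * s" using up by simp
  finally show ?thesis using s d by (simp add: field_simps numeral_eq_Suc)
qed

end

section \<open>The gradient bound in the axial direction\<close>

text \<open>The logarithm tends to infinity along the axis but is superharmonic only for |x_1| >= 1.
  The second term is superharmonic everywhere and repairs the part |x_1| <= 1, where the domain is
  bounded.\<close>

definition log_barrier :: "real \<Rightarrow> real^4 \<Rightarrow> real" where
  "log_barrier B x = ln (1 + (x $ 1)\<^sup>2) / 2 + B / (1 + x \<bullet> x)"

definition log_barrier1 :: "real \<Rightarrow> 4 \<Rightarrow> real^4 \<Rightarrow> real" where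
  "log_barrier1 B i x = of_bool (i = 1) * (x $ 1) / (1 + (x $ 1)\<^sup>2) - B * (2 * x $ i) / (1 + x \<bullet> x)\<^sup>2"

definition log_barrier2 :: "real \<Rightarrow> 4 \<Rightarrow> real^4 \<Rightarrow> real" where
  "log_barrier2 B i x = of_bool (i = 1) * (1 - (x $ 1)\<^sup>2) / (1 + (x $ 1)\<^sup>2)\<^sup>2
    - 2 * B / (1 + x \<bullet> x)\<^sup>2 + 8 * B * (x $ i)\<^sup>2 / (1 + x \<bullet> x) ^ 3"

lemma one_add_square_pos [simp]: "0 < 1 + (a::real)\<^sup>2" "1 + (a::real)\<^sup>2 \<noteq> 0"
  by (simp_all add: add_pos_nonneg add_nonneg_eq_0_iff)

lemma one_add_inner_pos [simp]: "0 < 1 + x \<bullet> x" "1 + x \<bullet> x \<noteq> 0" for x :: "'a::real_inner"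
  using inner_ge_zero[of x] by linarith+

lemma has_real_derivative_log_barrier:
  "DERIV (\<lambda>s. log_barrier B (x + step i s)) s :> log_barrier1 B i (x + step i s)"
proof -
  define \<delta> where "\<delta> = (of_bool (i = 1) :: real)"
  have comp: "(x + step i s) $ 1 = x $ 1 + s * \<delta>" "(x + step i s) $ i = x $ i + s" for s
    by (auto simp: \<delta>_def axis_def)
  have p: "0 < 1 + (x \<bullet> x + 2 * s * x $ i + s\<^sup>2)"
    using one_add_inner_pos(1)[of "x + step i s"] by (simp only: inner_add_axis)
  have 1: "DERIV (\<lambda>s. ln (1 + (x $ 1 + s * \<delta>)\<^sup>2) / 2) s :> \<delta> * (x $ 1 + s * \<delta>) / (1 + (x $ 1 + s * \<delta>)\<^sup>2)"
  proof -
    have "DERIV (\<lambda>s. 1 + (x $ 1 + s * \<delta>)\<^sup>2) s :> 2 * \<delta> * (x $ 1 + s * \<delta>)"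
      by (auto intro!: derivative_eq_intros)
    note D = DERIV_cdivide[OF DERIV_chain2[OF DERIV_ln_divide[OF one_add_square_pos(1)] this], of 2]
    have "1 / P * (2 * \<delta> * X) / 2 = \<delta> * X / P" for P X :: real by simp
    from D[unfolded this] show ?thesis .
  qed
  have 2: "((\<lambda>s. B / (1 + (x \<bullet> x + 2 * s * x $ i + s\<^sup>2))) has_real_derivative
     - (B * (2 * (x $ i + s)) / (1 + (x \<bullet> x + 2 * s * x $ i + s\<^sup>2))\<^sup>2)) (at s)"
    using p by (auto intro!: derivative_eq_intros simp: power2_eq_square)
  show ?thesis
    unfolding log_barrier_def log_barrier1_def comp inner_add_axis \<delta>_def[symmetric]
    using DERIV_add[OF 1 2] by simp
qed

lemma has_real_derivative_log_barrier1:
  "DERIV (\<lambda>s. log_barrier1 B i (x + step i s)) 0 :> log_barrier2 B i x"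
proof -
  define \<delta> where "\<delta> = (of_bool (i = 1) :: real)"
  have comp: "(x + step i s) $ 1 = x $ 1 + s * \<delta>" "(x + step i s) $ i = x $ i + s" for s
    by (auto simp: \<delta>_def axis_def)
  have \<delta>2: "\<delta> = 0 \<or> \<delta> = 1" by (simp add: \<delta>_def)
  have 1: "((\<lambda>s. \<delta> * (x $ 1 + s * \<delta>) / (1 + (x $ 1 + s * \<delta>)\<^sup>2)) has_real_derivative
      \<delta> * (1 - (x $ 1)\<^sup>2) / (1 + (x $ 1)\<^sup>2)\<^sup>2) (at 0)"
  proof -
    have "DERIV (\<lambda>s. (x $ 1 + s) / (1 + (x $ 1 + s)\<^sup>2)) 0 :> (1 - (x $ 1)\<^sup>2) / (1 + (x $ 1)\<^sup>2)\<^sup>2"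
      by (rule derivative_eq_intros refl | simp)+ (simp add: power2_eq_square algebra_simps)
    then show ?thesis using \<delta>2 by auto
  qed
  have 2: "((\<lambda>s. B * (2 * (x $ i + s)) / (1 + (x \<bullet> x + 2 * s * x $ i + s\<^sup>2))\<^sup>2) has_real_derivative
     2 * B / (1 + x \<bullet> x)\<^sup>2 - 8 * B * (x $ i)\<^sup>2 / (1 + x \<bullet> x) ^ 3) (at 0)"
  proof -
    define q where "q = 1 + x \<bullet> x"
    have q: "0 < q" by (simp add: q_def)
    have "((\<lambda>s. B * (2 * (x $ i + s)) / (q + 2 * s * x $ i + s\<^sup>2)\<^sup>2) has_real_derivative
      2 * B / q\<^sup>2 - 8 * B * (x $ i)\<^sup>2 / q ^ 3) (at 0)"
      using q by (auto intro!: derivative_eq_intros simp: power2_eq_square power3_eq_cube field_simps)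
    then show ?thesis by (simp add: q_def add.assoc)
  qed
  have "log_barrier2 B i x = \<delta> * (1 - (x $ 1)\<^sup>2) / (1 + (x $ 1)\<^sup>2)\<^sup>2
      - (2 * B / (1 + x \<bullet> x)\<^sup>2 - 8 * B * (x $ i)\<^sup>2 / (1 + x \<bullet> x) ^ 3)"
    by (simp add: log_barrier2_def \<delta>_def)
  then show ?thesis
    unfolding log_barrier1_def comp inner_add_axis \<delta>_def[symmetric]
    using DERIV_diff[OF 1 2] by simp
qed

text \<open>With q = |x|^2, the four second derivatives of 1 / (1 + q) add up to -8 / (1 + q)^2 + 8
  q / (1 + q)^3, which collapses to the single negative term -8 / (1 + q)^3.\<close>

lemma sum_log_barrier2:
  "(\<Sum>i\<in>UNIV. log_barrier2 B i x) = (1 - (x $ 1)\<^sup>2) / (1 + (x $ 1)\<^sup>2)\<^sup>2 - 8 * B / (1 + x \<bullet> x) ^ 3"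
proof -
  define q where "q = x \<bullet> x"
  have q: "0 < 1 + q" by (simp add: q_def)
  have "(\<Sum>i\<in>UNIV. log_barrier2 B i x) = (1 - (x $ 1)\<^sup>2) / (1 + (x $ 1)\<^sup>2)\<^sup>2
      - 8 * B / (1 + q)\<^sup>2 + 8 * B * (\<Sum>i\<in>UNIV. (x $ i)\<^sup>2) / (1 + q) ^ 3"
    by (simp add: log_barrier2_def sum.distrib sum_subtractf sum_distrib_left sum_divide_distrib of_bool_def q_def
        if_distrib[of "\<lambda>a. a * _"] if_distrib[of "\<lambda>a. a / _"] sum.delta cong: if_cong)
  also have "(\<Sum>i\<in>UNIV. (x $ i)\<^sup>2) = q"
    by (simp add: q_def inner_vec_def power2_eq_square)
  also have "8 * B * q / (1 + q) ^ 3 = 8 * B / (1 + q)\<^sup>2 - 8 * B / (1 + q) ^ 3"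
  proof -
    have "8 * B * (r - 1) / r ^ 3 = 8 * B / r\<^sup>2 - 8 * B / r ^ 3" if "0 < r" for r
      using that by (simp add: field_simps power2_eq_square power3_eq_cube)
    from this[OF q] show ?thesis by simp
  qed
  finally show ?thesis by (simp add: q_def)
qed

lemma continuous_on_log_barrier: "continuous_on A (log_barrier B)"
  unfolding log_barrier_def by (intro continuous_intros) auto

definition transverse :: "real^4 \<Rightarrow> real^4" where
  "transverse x = x - x $ 1 *\<^sub>R axis 1 1"

abbreviation radius :: "real^4 \<Rightarrow> real" where "radius x \<equiv> norm (transverse x)"

lemma transverse_nth: "transverse x $ i = (if i = 1 then 0 else x $ i)"
  by (simp add: transverse_def axis_def)

lemma norm_transverse: "radius x = sqrt ((x $ 2)\<^sup>2 + (x $ 3)\<^sup>2 + (x $ 4)\<^sup>2)"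
  unfolding norm_eq_sqrt_inner inner_vec_def
  by (simp add: sum_4 transverse_nth power2_eq_square)

lemma inner_self_transverse: "x \<bullet> x = (x $ 1)\<^sup>2 + (radius x)\<^sup>2"
  unfolding norm_transverse
  by (simp add: inner_vec_def sum_4 power2_eq_square)

lemma continuous_on_transverse: "continuous_on A transverse"
  unfolding transverse_def[abs_def] by (intro continuous_intros)

section \<open>Distance to the frontier and the global gradient bound\<close>

locale roof_domain =
  fixes g :: "real \<Rightarrow> real" and \<Omega> :: "(real^4) set" and u :: "real^4 \<Rightarrow> real"
  assumes g_cont: "continuous_on UNIV g" and g_pos: "\<And>t. 0 < g t"
    and \<Omega>_eq: "\<Omega> = {x. radius x < g (x $ 1)}"
    and roof: "roof_function \<Omega> u"
begin

lemma open_\<Omega>: "open \<Omega>"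
  unfolding \<Omega>_eq
  by (intro open_Collect_less continuous_intros continuous_on_transverse continuous_on_compose2[OF g_cont]) auto

lemma harm: "harmonic_on \<Omega> u" and u_pos: "x \<in> \<Omega> \<Longrightarrow> 0 < u x"
  and u_boundary: "p \<in> frontier \<Omega> \<Longrightarrow> (u \<longlongrightarrow> 0) (at p within \<Omega>)"
  and grad_boundary: "p \<in> frontier \<Omega> \<Longrightarrow> \<exists>v. (grad u \<longlongrightarrow> v) (at p within \<Omega>) \<and> norm v = 1"
  using roof by (auto simp: roof_function_def)

lemmas \<Omega>_harm = open_\<Omega> harm

lemma g_bounded: "\<exists>G>0. \<forall>t. \<bar>t\<bar> \<le> X \<longrightarrow> g t \<le> G"
proof -
  have "compact (g ` {-X..X})"
    by (intro compact_continuous_image continuous_on_subset[OF g_cont]) auto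
  then obtain G where G: "\<And>t. t \<in> {-X..X} \<Longrightarrow> \<bar>g t\<bar> \<le> G"
    using compact_imp_bounded by (force simp: bounded_iff)
  have "g t \<le> max G 1" if "\<bar>t\<bar> \<le> X" for t
    using G[of t] that by (auto simp: abs_le_iff)
  then show ?thesis by (intro exI[of _ "max G 1"]) auto
qed

lemma bounded_slab: "bounded {x \<in> \<Omega>. \<bar>x $ 1\<bar> \<le> X}"
proof -
  obtain G where G: "\<And>t. \<bar>t\<bar> \<le> X \<Longrightarrow> g t \<le> G" using g_bounded by blast
  have "norm x \<le> X + G" if "x \<in> \<Omega>" "\<bar>x $ 1\<bar> \<le> X" for x
  proof -
    have "norm x \<le> norm (x $ 1 *\<^sub>R axis 1 1 :: real^4) + radius x"
      using norm_triangle_ineq[of "x $ 1 *\<^sub>R axis 1 1" "transverse x"] by (simp add: transverse_def)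
    then show ?thesis using that G[of "x $ 1"] by (simp add: \<Omega>_eq)
  qed
  then show ?thesis by (auto simp: bounded_iff)
qed

lemma axis_in: "a *\<^sub>R axis 1 1 \<in> \<Omega>"
  using g_pos by (simp add: \<Omega>_eq transverse_def)

lemma frontier_nonempty: "frontier \<Omega> \<noteq> {}"
proof -
  have "transverse (g 0 *\<^sub>R axis 2 1) = g 0 *\<^sub>R axis 2 1"
    by (simp add: transverse_def axis_def)
  moreover have "(axis 2 1 :: real^4) $ 1 = 0" by (simp add: axis_def)
  ultimately have "g 0 *\<^sub>R axis 2 1 \<notin> \<Omega>"
    using g_pos[of 0] by (simp add: \<Omega>_eq)
  then show ?thesis using axis_in[of 0] by (auto simp: frontier_eq_empty)
qed

lemma frontier_closure: "p \<in> closure \<Omega> \<Longrightarrow> p \<notin> \<Omega> \<Longrightarrow> p \<in> frontier \<Omega>"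
  by (simp add: frontier_def interior_open[OF open_\<Omega>])

text \<open>A connected set that meets \<open>\<Omega>\<close> but not its frontier lies in
  \<open>\<Omega>\<close>; take the open ball that reaches up to a nearest frontier point.\<close>

lemma nearest_frontier:
  assumes "x \<in> \<Omega>"
  obtains d p where "0 < d" "ball x d \<subseteq> \<Omega>" "dist x p = d" "p \<in> frontier \<Omega>" "\<And>q. q \<in> frontier \<Omega> \<Longrightarrow> d \<le> dist x q"
proof -
  obtain p where p: "p \<in> frontier \<Omega>" "\<And>q. q \<in> frontier \<Omega> \<Longrightarrow> dist x p \<le> dist x q"
    using distance_attains_inf[OF frontier_closed frontier_nonempty] by blast
  have "x \<notin> frontier \<Omega>" using assms open_\<Omega> by (simp add: frontier_def interior_open)
  then have "0 < dist x p" using p by auto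
  moreover have "ball x (dist x p) \<subseteq> \<Omega>"
  proof (rule ccontr)
    assume "\<not> ?thesis"
    moreover have "x \<in> ball x (dist x p) \<inter> \<Omega>" using assms \<open>0 < dist x p\<close> by simp
    ultimately have "ball x (dist x p) \<inter> frontier \<Omega> \<noteq> {}"
      using connected_Int_frontier[OF connected_ball, of x "dist x p" \<Omega>] by blast
    then show False using p by force
  qed
  ultimately show ?thesis using that p by blast
qed

text \<open>The Hopf bound is applied only at a frontier point nearest to x, where the ball about x
  touches. An interior tangent ball thus exists automatically, with no smoothness of the
  frontier.\<close>

lemma u_le_dist:
  assumes "x \<in> \<Omega>" "p \<in> frontier \<Omega>"
  shows "u x \<le> 2 ^ 15 * dist x p"
proof -
  obtain d q where d: "0 < d" "ball x d \<subseteq> \<Omega>" "dist x q = d" "q \<in> frontier \<Omega>" "\<And>q. q \<in> frontier \<Omega> \<Longrightarrow> d \<le> dist x q"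
    using nearest_frontier[OF assms(1)] by blast
  obtain v where v: "(grad u \<longlongrightarrow> v) (at q within \<Omega>)" "norm v = 1" using grad_boundary[OF d(4)] by blast
  have "u x \<le> 2 ^ 15 * d"
    by (rule hopf_bound[OF \<Omega>_harm u_pos d(2,1,3) u_boundary[OF d(4)] v])
  also have "\<dots> \<le> 2 ^ 15 * dist x p" using d(5)[OF assms(2)] by simp
  finally show ?thesis .
qed

text \<open>On the largest ball about x the radius d in the gradient estimate cancels against u(x)
  <= 2^15 d. The remaining factor is 4 + 4 = 2^3.\<close>

lemma norm_grad_bounded:
  assumes "x \<in> \<Omega>"
  shows "norm (grad u x) \<le> 2 ^ 18"
proof -
  obtain d q where d: "0 < d" "ball x d \<subseteq> \<Omega>" "dist x q = d" "q \<in> frontier \<Omega>"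
    by (rule nearest_frontier[OF assms])
  have "norm (grad u x) \<le> (CARD(4) + 4) * u x / d"
    by (rule harmonic_grad_bound[OF \<Omega>_harm d(2,1)]) (use u_pos less_imp_le in auto)
  also have "\<dots> \<le> 8 * (2 ^ 15 * d) / d"
    using u_le_dist[OF assms d(4)] d by (intro divide_right_mono) auto
  finally show ?thesis using d by simp
qed

lemma frontier_seq:
  assumes X: "\<And>n. X n \<in> \<Omega>" and lim: "X \<longlonglongrightarrow> p" and p: "p \<notin> \<Omega>"
  shows "p \<in> frontier \<Omega>" "filterlim X (at p within \<Omega>) sequentially"
proof -
  have "p \<in> closure \<Omega>" using X lim closure_sequential by blast
  then show "p \<in> frontier \<Omega>" using p by (rule frontier_closure)
  show "filterlim X (at p within \<Omega>) sequentially"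
    unfolding filterlim_at using X lim p by (auto intro!: always_eventually)
qed

text \<open>Boundary values are known only as limits from within \<open>\<Omega>\<close>. The
  sequential condition \<open>bdry\<close> rules out frontier points as limits of the superlevel
  set, without extending \<open>h\<close> to the closure.\<close>

lemma compact_superlevel:
  fixes h :: "real^4 \<Rightarrow> real"
  assumes cont: "continuous_on \<Omega> h" and bd: "bounded {x \<in> \<Omega>. s \<le> h x}"
    and bdry: "\<And>X p. (\<And>n. X n \<in> \<Omega>) \<Longrightarrow> filterlim X (at p within \<Omega>) sequentially \<Longrightarrow> p \<in> frontier \<Omega>
      \<Longrightarrow> \<exists>n. h (X n) < s"
  shows "compact {x \<in> \<Omega>. s \<le> h x}"
proof -
  have "closed {x \<in> \<Omega>. s \<le> h x}"
    unfolding closed_sequential_limits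
  proof (intro allI impI, elim conjE)
    fix X p assume X: "\<forall>n. X n \<in> {x \<in> \<Omega>. s \<le> h x}" and lim: "X \<longlonglongrightarrow> p"
    have XO: "X n \<in> \<Omega>" and hX: "s \<le> h (X n)" for n using X by auto
    show "p \<in> {x \<in> \<Omega>. s \<le> h x}"
    proof (cases "p \<in> \<Omega>")
      case True
      have "(\<lambda>n. h (X n)) \<longlonglongrightarrow> h p"
        by (rule continuous_on_tendsto_compose[OF cont lim True]) (use XO in simp)
      then have "s \<le> h p" by (rule tendsto_lowerbound) (use hX in auto)
      then show ?thesis using True by simp
    next
      case False
      then show ?thesis using bdry[OF XO frontier_seq(2,1)[OF XO lim False]] hX by (meson not_le)
    qed
  qed
  then show ?thesis using bd by (simp add: compact_eq_bounded_closed)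
qed

section \<open>Phragmen-Lindelof argument for the axial derivative\<close>

lemma laplace_log_barrier_neg: "\<exists>B>0. \<forall>x\<in>\<Omega>. (\<Sum>i\<in>UNIV. log_barrier2 B i x) < 0"
proof -
  obtain G where G: "0 < G" "\<And>t. \<bar>t\<bar> \<le> 1 \<Longrightarrow> g t \<le> G" using g_bounded by blast
  \<comment> \<open>For |x_1| <= 1 one has 1 + |x|^2 <= 2 + G^2, so the correction contributes at
    most -8 to the Laplacian, against at most 1 from the logarithm.\<close>
  define B where "B = (2 + G\<^sup>2) ^ 3"
  have B: "0 < B" using G by (auto simp: B_def intro!: zero_less_power add_pos_nonneg)
  have "(\<Sum>i\<in>UNIV. log_barrier2 B i x) < 0" if x: "x \<in> \<Omega>" for x
  proof (cases "\<bar>x $ 1\<bar> \<le> 1")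
    case True
    have a: "(x $ 1)\<^sup>2 \<le> 1" using True by (simp add: abs_square_le_1)
    have "radius x \<le> G" using x G(2)[OF True] by (simp add: \<Omega>_eq)
    then have "(radius x)\<^sup>2 \<le> G\<^sup>2" by (intro power_mono) auto
    then have "1 + x \<bullet> x \<le> 2 + G\<^sup>2" using a by (simp add: inner_self_transverse)
    then have "(1 + x \<bullet> x) ^ 3 \<le> B" unfolding B_def by (intro power_mono) (auto intro: less_imp_le)
    then have "8 \<le> 8 * B / (1 + x \<bullet> x) ^ 3" by (simp add: le_divide_eq)
    moreover have "(1 - (x $ 1)\<^sup>2) / (1 + (x $ 1)\<^sup>2)\<^sup>2 \<le> 1 / 1"
      using a by (intro frac_le) (auto intro: one_le_power)
    ultimately show ?thesis unfolding sum_log_barrier2 by linarith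
  next
    case False
    then have "1 \<le> (x $ 1)\<^sup>2" by (metis abs_square_le_1 nle_le)
    then have "(1 - (x $ 1)\<^sup>2) / (1 + (x $ 1)\<^sup>2)\<^sup>2 \<le> 0" by (intro divide_nonpos_nonneg) auto
    moreover have "0 < 8 * B / (1 + x \<bullet> x) ^ 3" using B by simp
    ultimately show ?thesis by (simp add: sum_log_barrier2)
  qed
  then show ?thesis using B by blast
qed

text \<open>A second derivative test cannot be applied to \<open>partial u 1\<close>, which is only known to be \<open>C\<^sup>1\<close>;
  its difference quotients are \<open>C\<^sup>2\<close> and harmonic and converge locally uniformly.\<close>
lemma partial_le_barrier:
  assumes \<sigma>: "\<bar>\<sigma>\<bar> = 1" and \<epsilon>: "0 < \<epsilon>" and B: "0 < B"
    and neg: "\<And>x. x \<in> \<Omega> \<Longrightarrow> (\<Sum>i\<in>UNIV. log_barrier2 B i x) < 0" and x0: "x0 \<in> \<Omega>"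
  shows "\<sigma> * partial u 1 x0 \<le> 1 + \<epsilon> * log_barrier B x0"
proof (rule ccontr)
  define h where "h x = \<sigma> * partial u 1 x - 1 - \<epsilon> * log_barrier B x" for x
  define s where "s = h x0"
  assume "\<not> ?thesis"
  then have s: "0 < s" by (simp add: s_def h_def)
  have conth: "continuous_on \<Omega> h"
    unfolding h_def by (intro continuous_intros harmonic_cont1[OF \<Omega>_harm] continuous_on_log_barrier)
  \<comment> \<open>The set where the violation is at least half of that at \<open>x0\<close>. The
    bounded gradient and the growing logarithm confine it to a slab, and at the frontier |v_1| <=
    |v| = 1 makes the limit of \<open>h\<close> negative, so \<open>K\<close> is compact inside
    \<open>\<Omega>\<close>.\<close>
  define K where "K = {x \<in> \<Omega>. s / 2 \<le> h x}"
  have barrier_nonneg: "0 < log_barrier B x" for x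
  proof -
    have "0 \<le> ln (1 + (x $ 1)\<^sup>2)" by (intro ln_ge_zero) simp
    moreover have "0 < B / (1 + x \<bullet> x)" using B by (intro divide_pos_pos one_add_inner_pos)
    ultimately show ?thesis unfolding log_barrier_def by linarith
  qed
  have "\<sigma> = 1 \<or> \<sigma> = - 1" using \<sigma> by linarith
  then have \<sigma>_le: "\<sigma> * a \<le> \<bar>a\<bar>" for a by auto
  have partial_le: "\<bar>partial u 1 x\<bar> \<le> norm (grad u x)" for x
    using component_le_norm_cart[of "grad u x" 1] by (simp add: grad_def)
  have KO: "K \<subseteq> \<Omega>" by (auto simp: K_def)
  have "bounded K"
  proof (rule bounded_subset[OF bounded_slab])
    let ?c = "2 * (2 ^ 18 / \<epsilon>) :: real"
    show "K \<subseteq> {x \<in> \<Omega>. \<bar>x $ 1\<bar> \<le> exp ?c}"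
    proof
      fix x assume x: "x \<in> K"
      then have xO: "x \<in> \<Omega>" and hx: "0 \<le> h x" using s by (auto simp: K_def)
      have "\<sigma> * partial u 1 x \<le> \<bar>partial u 1 x\<bar>" by (rule \<sigma>_le)
      also have "\<dots> \<le> 2 ^ 18" using partial_le norm_grad_bounded[OF xO] order_trans by blast
      finally have "\<epsilon> * log_barrier B x \<le> 2 ^ 18" using hx by (simp add: h_def)
      then have "log_barrier B x \<le> 2 ^ 18 / \<epsilon>" using \<epsilon> by (simp add: field_simps)
      moreover have "0 < B / (1 + x \<bullet> x)" using B by simp
      ultimately have "ln (1 + (x $ 1)\<^sup>2) \<le> ?c" by (simp add: log_barrier_def)
      then have 1: "1 + (x $ 1)\<^sup>2 \<le> exp ?c" by (metis exp_le_cancel_iff exp_ln one_add_square_pos(1))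
      have "\<bar>x $ 1\<bar> \<le> 1 + (x $ 1)\<^sup>2"
      proof -
        have "(\<bar>x $ 1\<bar> - 1)\<^sup>2 = (x $ 1)\<^sup>2 - 2 * \<bar>x $ 1\<bar> + 1" by (simp add: power2_diff)
        then show ?thesis using zero_le_power2[of "\<bar>x $ 1\<bar> - 1"] by linarith
      qed
      then show "x \<in> {x \<in> \<Omega>. \<bar>x $ 1\<bar> \<le> exp ?c}" using 1 xO by simp
    qed
  qed
  then have K: "compact K"
    unfolding K_def
  proof (rule compact_superlevel[OF conth])
    fix X p assume fr: "filterlim X (at p within \<Omega>) sequentially" "p \<in> frontier \<Omega>"
    obtain v where v: "(grad u \<longlongrightarrow> v) (at p within \<Omega>)" "norm v = 1" using grad_boundary[OF fr(2)] by blast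
    have "(\<lambda>n. grad u (X n)) \<longlonglongrightarrow> v" by (rule filterlim_compose[OF v(1) fr(1)])
    then have "(\<lambda>n. grad u (X n) $ 1) \<longlonglongrightarrow> v $ 1" by (intro tendsto_intros)
    then have 1: "(\<lambda>n. partial u 1 (X n)) \<longlonglongrightarrow> v $ 1" by (simp add: grad_def)
    have "X \<longlonglongrightarrow> p" using fr(1) by (simp add: filterlim_at)
    then have 2: "(\<lambda>n. log_barrier B (X n)) \<longlonglongrightarrow> log_barrier B p"
      by (rule continuous_on_tendsto_compose[OF continuous_on_log_barrier[of UNIV]]) auto
    have "(\<lambda>n. h (X n)) \<longlonglongrightarrow> \<sigma> * v $ 1 - 1 - \<epsilon> * log_barrier B p"
      unfolding h_def by (intro tendsto_intros 1 2)
    moreover have "\<sigma> * v $ 1 \<le> \<bar>v $ 1\<bar>" by (rule \<sigma>_le)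
    moreover have "\<bar>v $ 1\<bar> \<le> 1" using component_le_norm_cart[of v 1] v by simp
    moreover have "0 < \<epsilon> * log_barrier B p" using \<epsilon> barrier_nonneg by simp
    ultimately have "eventually (\<lambda>n. h (X n) < s / 2) sequentially"
      using s by (intro order_tendstoD(2)) auto
    then show "\<exists>n. h (X n) < s / 2" using eventually_happens'[OF sequentially_bot] by blast
  qed
  obtain r where r: "0 < r" "(\<Union>x\<in>K. cball x r) \<subseteq> \<Omega>"
    using compact_subset_open_imp_cball_epsilon_subset[OF K open_\<Omega> KO] by blast
  define K' where "K' = {x + y |x y. x \<in> K \<and> y \<in> cball 0 r}"
  have K': "compact K'" unfolding K'_def by (intro compact_sums K compact_cball)
  have K'O: "K' \<subseteq> \<Omega>"
  proof
    fix w assume "w \<in> K'"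
    then obtain x y where "w = x + y" "x \<in> K" "y \<in> cball 0 r" by (auto simp: K'_def)
    then have "w \<in> (\<Union>x\<in>K. cball x r)" by (auto intro!: bexI[of _ x] simp: dist_norm)
    then show "w \<in> \<Omega>" using r by blast
  qed
  have "uniformly_continuous_on K' (partial u 1)"
    by (intro compact_uniformly_continuous K' continuous_on_subset[OF harmonic_cont1[OF \<Omega>_harm] K'O])
  then obtain \<delta> where \<delta>: "0 < \<delta>" "\<And>x y. x \<in> K' \<Longrightarrow> y \<in> K' \<Longrightarrow> dist y x < \<delta> \<Longrightarrow> dist (partial u 1 y) (partial u 1 x) < s / 8"
    unfolding uniformly_continuous_on_def using s by (metis zero_less_divide_iff zero_less_numeral)
  define t where "t = min r \<delta> / 2"
  have t: "0 < t" "t < r" "t < \<delta>" using r \<delta> by (auto simp: t_def)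
  have inK': "x + step 1 a \<in> K'" if "x \<in> K" "\<bar>a\<bar> \<le> t" for x a
    unfolding K'_def mem_Collect_eq
    by (rule exI[of _ x], rule exI[of _ "a *\<^sub>R axis 1 1"]) (use that t in auto)
  have inO: "x + step 1 a \<in> \<Omega>" if "x \<in> K" "\<bar>a\<bar> \<le> t" for x a
    using inK'[OF that] K'O by (rule rev_subsetD)
  define D where "D x = (u (x + step 1 t) - u x) / t" for x
  have D: "\<bar>D x - partial u 1 x\<bar> < s / 8" if x: "x \<in> K" for x
  proof -
    have der: "DERIV (\<lambda>a. u (x + step 1 a)) a :> partial u 1 (x + step 1 a)"
      if "\<bar>a\<bar> \<le> t" for a
      using has_real_derivative_along[OF harmonic_diff[OF \<Omega>_harm inO[OF x that]]]
      by (simp add: grad_inner_axis)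
    obtain z where z: "0 < z" "z < t" "u (x + step 1 t) - u (x + step 1 0) = (t - 0) * partial u 1 (x + step 1 z)"
      using MVT2[of 0 t "\<lambda>a. u (x + step 1 a)" "\<lambda>a. partial u 1 (x + step 1 a)"] t der by auto
    then have "D x = partial u 1 (x + step 1 z)" using t by (simp add: D_def)
    moreover have "dist (partial u 1 (x + step 1 z)) (partial u 1 x) < s / 8"
      by (rule \<delta>(2)) (use inK'[OF x, of 0] inK'[OF x, of z] z t in \<open>auto simp: dist_norm\<close>)
    ultimately show ?thesis by (simp add: dist_real_def)
  qed
  define \<phi> where "\<phi> x = \<epsilon> * log_barrier B x - \<sigma> * D x" for x
  have \<phi>: "\<bar>\<phi> x + 1 + h x\<bar> < s / 8" if "x \<in> K" for x
  proof -
    have "\<phi> x + 1 + h x = \<sigma> * (partial u 1 x - D x)" by (simp add: \<phi>_def h_def algebra_simps)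
    then show ?thesis using D[OF that] \<sigma> by (simp add: abs_mult abs_minus_commute)
  qed
  have "continuous_on K \<phi>"
    unfolding \<phi>_def D_def using t
    by (intro continuous_intros continuous_on_log_barrier continuous_on_subset[OF harmonic_cont[OF \<Omega>_harm] KO]
        continuous_on_compose2[OF harmonic_cont[OF \<Omega>_harm]]) (use inO in auto)
  moreover have x0K: "x0 \<in> K" using x0 s by (simp add: K_def s_def[symmetric])
  ultimately obtain y where y: "y \<in> K" and ymin: "\<And>w. w \<in> K \<Longrightarrow> \<phi> y \<le> \<phi> w"
    using continuous_attains_inf[OF K] by (metis empty_iff)
  \<comment> \<open>\<open>\<phi>\<close> differs from -1 - h by less than s/8, so its minimizer
    satisfies h(y) > s - 2 (s/8). Hence y has a neighbourhood in \<open>K\<close>, where the second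
    derivative test can be carried out.\<close>
  have "s / 2 < h y"
    using \<phi>[OF y] \<phi>[OF x0K, folded s_def] ymin[OF x0K] s by linarith
  have yO: "y \<in> \<Omega>" using y KO by auto
  have "open (h -` {s / 2<..} \<inter> \<Omega>)"
    using conth continuous_on_open_vimage[OF open_\<Omega>] open_greaterThan by blast
  moreover have "y \<in> h -` {s / 2<..} \<inter> \<Omega>" using \<open>s / 2 < h y\<close> yO by simp
  ultimately obtain e where e: "0 < e" "ball y e \<subseteq> h -` {s / 2<..} \<inter> \<Omega>"
    by (meson open_contains_ball)
  have eK: "y + step i a \<in> K" if "\<bar>a\<bar> < e" for a i
  proof -
    have "y + step i a \<in> ball y e" using that by (simp add: dist_norm)
    then show ?thesis using e(2) by (auto simp: K_def)
  qed
  define y' where "y' = y + step 1 t"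
  have y'O: "y' \<in> \<Omega>" using inO[OF y, of t] t by (simp add: y'_def)
  have second: "0 \<le> \<epsilon> * log_barrier2 B i y - \<sigma> * ((partial2 u i i y' - partial2 u i i y) / t)" for i
  proof -
    have shift: "y + step i a + step 1 t = y' + step i a" for a by (simp add: y'_def)
    define f1 where "f1 a = \<epsilon> * log_barrier1 B i (y + step i a)
      - \<sigma> * ((partial u i (y' + step i a) - partial u i (y + step i a)) / t)" for a
    show ?thesis
    proof (rule second_derivative_nonneg_at_local_min[OF e(1), of "\<lambda>a. \<phi> (y + step i a)" f1])
      fix a assume a: "\<bar>a\<bar> < e"
      show "\<phi> (y + step i 0) \<le> \<phi> (y + step i a)" using ymin[OF eK[OF a]] by simp
      have "y' + step i a \<in> \<Omega>" using inO[OF eK[OF a, of i], of t] t by (simp add: shift)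
      then have 1: "DERIV (\<lambda>a. u (y' + step i a)) a :> partial u i (y' + step i a)"
        using has_real_derivative_along[OF harmonic_diff[OF \<Omega>_harm]] by (fastforce simp: grad_inner_axis)
      have "y + step i a \<in> \<Omega>" using eK[OF a] KO by auto
      then have 2: "DERIV (\<lambda>a. u (y + step i a)) a :> partial u i (y + step i a)"
        using has_real_derivative_along[OF harmonic_diff[OF \<Omega>_harm]] by (fastforce simp: grad_inner_axis)
      show "DERIV (\<lambda>a. \<phi> (y + step i a)) a :> f1 a"
        unfolding \<phi>_def D_def f1_def shift
        by (intro DERIV_diff DERIV_cmult DERIV_cdivide 1 2 has_real_derivative_log_barrier)
    next
      have 1: "DERIV (\<lambda>a. partial u i (w + step i a)) 0 :> partial2 u i i w"
        if "w \<in> \<Omega>" for w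
        using has_real_derivative_along[OF harmonic_diff2[OF \<Omega>_harm], of w 0 "axis i 1" i] that
        by (simp add: grad_inner_axis)
      show "DERIV f1 0 :> \<epsilon> * log_barrier2 B i y - \<sigma> * ((partial2 u i i y' - partial2 u i i y) / t)"
        unfolding f1_def
        by (intro DERIV_diff DERIV_cmult DERIV_cdivide 1 has_real_derivative_log_barrier1 yO y'O)
    qed
  qed
  have "0 \<le> (\<Sum>i\<in>UNIV. \<epsilon> * log_barrier2 B i y - \<sigma> * ((partial2 u i i y' - partial2 u i i y) / t))"
    by (intro sum_nonneg second)
  also have "\<dots> = \<epsilon> * (\<Sum>i\<in>UNIV. log_barrier2 B i y)
    - \<sigma> * (((\<Sum>i\<in>UNIV. partial2 u i i y') - (\<Sum>i\<in>UNIV. partial2 u i i y)) / t)"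
    by (simp add: sum_subtractf sum_distrib_left sum_divide_distrib diff_divide_distrib right_diff_distrib)
  also have "\<dots> = \<epsilon> * (\<Sum>i\<in>UNIV. log_barrier2 B i y)"
    using harmonic_laplace[OF \<Omega>_harm] yO y'O by simp
  finally show False using neg[OF yO] \<epsilon> by (simp add: zero_le_mult_iff)
qed

text \<open>At a fixed point the factor \<epsilon> of the barrier tends to zero; the two signs of
  \<sigma> give the two halves.\<close>

lemma partial1_bound:
  assumes "x \<in> \<Omega>"
  shows "\<bar>partial u 1 x\<bar> \<le> 1"
proof -
  obtain B where B: "0 < B" "\<And>x. x \<in> \<Omega> \<Longrightarrow> (\<Sum>i\<in>UNIV. log_barrier2 B i x) < 0"
    using laplace_log_barrier_neg by blast
  have "\<sigma> * partial u 1 x \<le> 1" if \<sigma>: "\<bar>\<sigma>\<bar> = 1" for \<sigma>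
  proof -
    have "((\<lambda>\<epsilon>. 1 + \<epsilon> * log_barrier B x) \<longlongrightarrow> 1 + 0 * log_barrier B x) (at_right 0)"
      by (intro tendsto_intros)
    moreover have "eventually (\<lambda>\<epsilon>. \<sigma> * partial u 1 x \<le> 1 + \<epsilon> * log_barrier B x) (at_right 0)"
      using eventually_at_right_less[of "0::real"]
      by eventually_elim (use partial_le_barrier[OF \<sigma> _ B assms] in auto)
    ultimately have "\<sigma> * partial u 1 x \<le> 1 + 0 * log_barrier B x"
      by (rule tendsto_lowerbound) simp
    then show ?thesis by simp
  qed
  from this[of 1] this[of "-1"] show ?thesis by simp
qed

end

section \<open>Integration by parts with cutoffs\<close>

context
  fixes S :: "(real^'n) set" and u :: "real^'n \<Rightarrow> real"
  assumes S: "open S" and harm: "harmonic_on S u"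
begin

text \<open>Two mean value steps, first in direction i and then in direction j, evaluate a
  difference that is itself symmetric in i and j.\<close>

lemma harmonic_second_difference:
  assumes h: "0 < h" and sub: "ball x (3 * h) \<subseteq> S"
  shows "\<exists>a b. 0 < a \<and> a < h \<and> 0 < b \<and> b < h \<and>
    u (x + step i h + step j h) - u (x + step i h) - u (x + step j h) + u x
    = h\<^sup>2 * partial2 u i j (x + step i a + step j b)"
proof -
  have inS: "x + step i a + step j b \<in> S" if "0 \<le> a" "a \<le> h" "0 \<le> b" "b \<le> h" for a b
  proof -
    have "norm (step i a + step j b :: real^'n) \<le> \<bar>a\<bar> + \<bar>b\<bar>"
      by (rule order_trans[OF norm_triangle_ineq]) simp
    then have "dist (x + (step i a + step j b)) x < 3 * h"
      using that h by (simp add: dist_norm)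
    then show ?thesis using sub by (auto simp: add.assoc dist_commute)
  qed
  define f where "f a = u (x + step i a + step j h) - u (x + step i a)" for a
  have "\<exists>a>0. a < h \<and> f h - f 0 = (h - 0) * (partial u i (x + step i a + step j h) - partial u i (x + step i a))"
  proof (rule MVT2[OF h])
    fix a assume a: "0 \<le> a" "a \<le> h"
    have e: "x + step i a + step j h = (x + step j h) + step i a" for a
      by (simp add: algebra_simps)
    have "(x + step j h) + step i a \<in> S" "x + step i a \<in> S"
      using inS[OF a, of h] inS[OF a, of 0] h by (auto simp: algebra_simps)
    from has_real_derivative_along[OF harmonic_diff[OF S harm this(1)]]
      has_real_derivative_along[OF harmonic_diff[OF S harm this(2)]]
    show "DERIV f a :> partial u i (x + step i a + step j h) - partial u i (x + step i a)"
      unfolding f_def e grad_inner_axis by (rule DERIV_diff)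
  qed
  then obtain a where a: "0 < a" "a < h"
    "f h - f 0 = h * (partial u i (x + step i a + step j h) - partial u i (x + step i a))"
    by auto
  have "\<exists>b>0. b < h \<and> partial u i (x + step i a + step j h) - partial u i (x + step i a + step j 0)
      = (h - 0) * partial2 u i j (x + step i a + step j b)"
  proof (rule MVT2[OF h])
    fix b assume b: "0 \<le> b" "b \<le> h"
    from has_real_derivative_along[OF harmonic_diff2[OF S harm inS[OF _ _ b]]] a
    show "DERIV (\<lambda>b. partial u i (x + step i a + step j b)) b :> partial2 u i j (x + step i a + step j b)"
      unfolding grad_inner_axis by simp
  qed
  then obtain b where b: "0 < b" "b < h"
    "partial u i (x + step i a + step j h) - partial u i (x + step i a)
      = h * partial2 u i j (x + step i a + step j b)"
    by auto
  have "f h - f 0 = h\<^sup>2 * partial2 u i j (x + step i a + step j b)"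
    unfolding a(3) b(3) by (simp add: power2_eq_square)
  then show ?thesis using a b by (intro exI[of _ a] exI[of _ b]) (simp add: f_def)
qed

text \<open>Evaluated in both orders, the same second difference shows that the mixed partials agree
  at two points arbitrarily close to x, and they are continuous. The divergence of the stress tensor
  vanishes only thanks to this symmetry.\<close>

lemma harmonic_partial_commute:
  assumes x: "x \<in> S"
  shows "partial2 u i j x = partial2 u j i x"
proof -
  have "\<bar>partial2 u i j x - partial2 u j i x\<bar> \<le> 0 + e" if e: "0 < e" for e
  proof -
    have ev: "eventually (\<lambda>y. dist (partial2 u k l y) (partial2 u k l x) < e / 2) (nhds x)" for k l
    proof -
      have "isCont (partial2 u k l) x"
        using harmonic_cont2[OF S harm, of k l] S x by (simp add: continuous_on_eq_continuous_at)
      then have "filterlim (partial2 u k l) (nhds (partial2 u k l x)) (nhds x)"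
        by (simp add: isCont_def tendsto_at_iff_tendsto_nhds)
      then show ?thesis by (rule tendstoD) (use e in simp)
    qed
    have "eventually (\<lambda>y. y \<in> S \<and> dist (partial2 u i j y) (partial2 u i j x) < e / 2
        \<and> dist (partial2 u j i y) (partial2 u j i x) < e / 2) (nhds x)"
      by (intro eventually_conj ev eventually_nhds_in_open S x)
    then obtain d where d: "0 < d" "\<And>y. dist y x < d \<Longrightarrow> y \<in> S \<and> dist (partial2 u i j y) (partial2 u i j x) < e / 2
        \<and> dist (partial2 u j i y) (partial2 u j i x) < e / 2"
      unfolding eventually_nhds_metric by blast
    define h where "h = d / 3"
    have h: "0 < h" "ball x (3 * h) \<subseteq> S" using d by (auto simp: h_def dist_commute)
    have near: "dist (x + step k a + step l b) x < d" if "0 < a" "a < h" "0 < b" "b < h" for a b k l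
    proof -
      have "norm (step k a + step l b :: real^'n) \<le> \<bar>a\<bar> + \<bar>b\<bar>"
        by (rule order_trans[OF norm_triangle_ineq]) simp
      then show ?thesis using that by (simp add: dist_norm add.assoc h_def)
    qed
    obtain a b where ab: "0 < a" "a < h" "0 < b" "b < h"
      "u (x + step i h + step j h) - u (x + step i h) - u (x + step j h) + u x
       = h\<^sup>2 * partial2 u i j (x + step i a + step j b)"
      using harmonic_second_difference[OF h, of i j] by blast
    obtain a' b' where ab': "0 < a'" "a' < h" "0 < b'" "b' < h"
      "u (x + step j h + step i h) - u (x + step j h) - u (x + step i h) + u x
       = h\<^sup>2 * partial2 u j i (x + step j a' + step i b')"
      using harmonic_second_difference[OF h, of j i] by blast
    have swap: "x + step j h + step i h = x + step i h + step j h" by (simp add: algebra_simps)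
    have "h\<^sup>2 * partial2 u i j (x + step i a + step j b)
      = h\<^sup>2 * partial2 u j i (x + step j a' + step i b')"
      using ab(5) ab'(5) unfolding swap by linarith
    then have "partial2 u i j (x + step i a + step j b)
      = partial2 u j i (x + step j a' + step i b')"
      using h by simp
    then show ?thesis
      using d(2)[OF near[OF ab(1-4)], of i j] d(2)[OF near[OF ab'(1-4)], of j i]
      unfolding dist_real_def by linarith
  qed
  then have "\<bar>partial2 u i j x - partial2 u j i x\<bar> \<le> 0"
    by (rule field_le_epsilon)
  then show ?thesis by simp
qed

end

section \<open>Cutoffs along the level sets and test functions of the axial variable\<close>

definition ramp :: "real \<Rightarrow> real" where
  "ramp s = 2 * (max 0 (s - 1))\<^sup>2 - 4 * (max 0 (s - 3/2))\<^sup>2 + 2 * (max 0 (s - 2))\<^sup>2"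

text \<open>A tent over [1, 2] with peak 2 at 3/2, so that its integral \<open>ramp\<close> is a C^1
  step from 0 to 1 made of two parabolas.\<close>

definition ramp' :: "real \<Rightarrow> real" where
  "ramp' s = 4 * max 0 (s - 1) - 8 * max 0 (s - 3/2) + 4 * max 0 (s - 2)"

lemma has_real_derivative_ramp: "DERIV ramp s :> ramp' s"
proof -
  have "DERIV (\<lambda>s. (max 0 (s - c))\<^sup>2) s :> 2 * max 0 (s - c)" for c :: real
  proof -
    have "DERIV (\<lambda>s. s - c) s :> 1" by (auto intro!: derivative_eq_intros)
    from DERIV_chain2[OF has_real_derivative_max_power[of 0] this]
    show ?thesis by (simp add: numeral_2_eq_2)
  qed
  note D = this
  have "DERIV ramp s :> 2 * (2 * max 0 (s - 1)) - 4 * (2 * max 0 (s - 3/2)) + 2 * (2 * max 0 (s - 2))"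
    unfolding ramp_def[abs_def] by (intro DERIV_add DERIV_diff DERIV_cmult D)
  then show ?thesis by (simp add: ramp'_def)
qed

lemma ramp_eq_0: "s \<le> 1 \<Longrightarrow> ramp s = 0" and ramp'_eq_0: "s \<le> 1 \<or> 2 \<le> s \<Longrightarrow> ramp' s = 0"
  and ramp'_nonneg: "0 \<le> ramp' s" and ramp'_le: "ramp' s \<le> 2"
  by (auto simp: ramp_def ramp'_def max_def)

lemma ramp_eq_1: "2 \<le> s \<Longrightarrow> ramp s = 1"
  by (simp add: ramp_def max_def power2_eq_square algebra_simps)

lemma ramp_bounds: "0 \<le> ramp s" "ramp s \<le> 1"
proof -
  have mono: "ramp a \<le> ramp b" if "a \<le> b" for a b
    by (rule DERIV_nonneg_imp_nondecreasing[OF that]) (use has_real_derivative_ramp ramp'_nonneg in blast)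
  show "0 \<le> ramp s" using mono[of "min s 1" s] by (simp add: ramp_eq_0)
  show "ramp s \<le> 1" using mono[of s "max s 2"] by (simp add: ramp_eq_1)
qed

text \<open>At \<open>u x\<close> it vanishes where u <= \<epsilon> and equals 1 where u >= 2
  \<epsilon>. Its derivative has unit mass between these two levels; by the coarea formula
  \<open>cutoff'\<close> times |grad u| averages surface measure over them.\<close>

definition cutoff :: "real \<Rightarrow> real \<Rightarrow> real" where "cutoff \<epsilon> s = ramp (s / \<epsilon>)"
definition cutoff' :: "real \<Rightarrow> real \<Rightarrow> real" where "cutoff' \<epsilon> s = ramp' (s / \<epsilon>) / \<epsilon>"

lemma has_real_derivative_cutoff: "DERIV (cutoff \<epsilon>) s :> cutoff' \<epsilon> s"
proof -
  have "DERIV (\<lambda>s. s / \<epsilon>) s :> 1 / \<epsilon>" by (rule DERIV_cdivide) simp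
  from DERIV_chain2[OF has_real_derivative_ramp this]
  show ?thesis by (simp add: cutoff_def[abs_def] cutoff'_def)
qed

lemma continuous_on_cutoff: "continuous_on A (cutoff \<epsilon>)"
  by (meson DERIV_isCont continuous_at_imp_continuous_on has_real_derivative_cutoff)

lemma continuous_on_cutoff': "continuous_on A (cutoff' \<epsilon>)"
  unfolding cutoff'_def ramp'_def divide_inverse by (intro continuous_intros)

lemma cutoff_eq_0: "0 < \<epsilon> \<Longrightarrow> s \<le> \<epsilon> \<Longrightarrow> cutoff \<epsilon> s = 0"
  by (simp add: cutoff_def ramp_eq_0)

lemma cutoff_eq_1: "0 < \<epsilon> \<Longrightarrow> 2 * \<epsilon> \<le> s \<Longrightarrow> cutoff \<epsilon> s = 1"
  by (simp add: cutoff_def ramp_eq_1 field_simps)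

lemma cutoff'_eq_0: "0 < \<epsilon> \<Longrightarrow> 2 * \<epsilon> \<le> s \<Longrightarrow> cutoff' \<epsilon> s = 0"
  by (simp add: cutoff'_def ramp'_eq_0 field_simps)

lemma cutoff'_nonneg: "0 < \<epsilon> \<Longrightarrow> 0 \<le> cutoff' \<epsilon> s"
  by (simp add: cutoff'_def ramp'_nonneg)

lemma cutoff_bounds: "\<bar>cutoff \<epsilon> s\<bar> \<le> 1"
  using ramp_bounds[of "s / \<epsilon>"] by (simp add: cutoff_def)

lemma cutoff'_bounds: "0 < \<epsilon> \<Longrightarrow> cutoff' \<epsilon> s \<le> 2 / \<epsilon>"
  using ramp'_le[of "s / \<epsilon>"] by (simp add: cutoff'_def divide_right_mono)

text \<open>\<open>cutoff'\<close> is at most 2/\<epsilon> and vanishes beyond 2 \<epsilon>. An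
  extra factor u therefore keeps the layer terms bounded, and fields of the form u p lose their
  boundary term.\<close>

lemma cutoff'_mult_bounds: assumes "0 < \<epsilon>" "0 < s" shows "\<bar>cutoff' \<epsilon> s * s\<bar> \<le> 4"
proof (cases "2 * \<epsilon> \<le> s")
  case True
  then show ?thesis using assms by (simp add: cutoff'_eq_0)
next
  case False
  then have "cutoff' \<epsilon> s * s \<le> 2 / \<epsilon> * (2 * \<epsilon>)"
    using assms cutoff'_bounds[of \<epsilon> s] by (intro mult_mono) auto
  then show ?thesis using assms cutoff'_nonneg[of \<epsilon> s] by simp
qed

text \<open>grad u is an inward normal to the level sets. Multiplied by \<open>cutoff'\<close>, the
  expression is the inward flux of p averaged over the levels between \<epsilon> and 2
  \<epsilon>.\<close>

abbreviation normal_flux :: "(real^'n \<Rightarrow> real) \<Rightarrow> ('n \<Rightarrow> real^'n \<Rightarrow> real) \<Rightarrow> real^'n \<Rightarrow> real" where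
  "normal_flux u p x \<equiv> (\<Sum>i\<in>UNIV. partial u i x * p i x)"

abbreviation divergence :: "(4 \<Rightarrow> real^4 \<Rightarrow> real^4 \<Rightarrow> real) \<Rightarrow> real^4 \<Rightarrow> real" where
  "divergence p' x \<equiv> (\<Sum>i\<in>UNIV. p' i x (axis i 1))"

definition test_function :: "real \<Rightarrow> (real \<Rightarrow> real) \<Rightarrow> (real \<Rightarrow> real) \<Rightarrow> bool" where
  "test_function Y c c' \<longleftrightarrow> (\<forall>s. DERIV c s :> c' s) \<and> continuous_on UNIV c' \<and> (\<forall>s. Y < \<bar>s\<bar> \<longrightarrow> c s = 0)"

lemma test_functionD:
  assumes "test_function Y c c'"
  shows "DERIV c s :> c' s" "continuous_on A c'" "continuous_on A c" "Y < \<bar>s\<bar> \<Longrightarrow> c s = 0"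
    "Y < \<bar>s\<bar> \<Longrightarrow> c' s = 0"
proof -
  show D: "DERIV c s :> c' s" for s using assms by (simp add: test_function_def)
  show "continuous_on A c'" using assms continuous_on_subset by (auto simp: test_function_def)
  show "continuous_on A c" using D by (meson DERIV_isCont continuous_at_imp_continuous_on)
  show Z: "Y < \<bar>s\<bar> \<Longrightarrow> c s = 0" for s using assms by (simp add: test_function_def)
  show "c' s = 0" if "Y < \<bar>s\<bar>"
  proof -
    have "open {s. Y < \<bar>s\<bar>}" by (intro open_Collect_less continuous_intros)
    then have "DERIV c s :> 0"
      by (rule has_field_derivative_transform_within_open[OF DERIV_const[of 0]]) (use that Z in auto)
    then show ?thesis using D DERIV_unique by blast
  qed
qed

lemma test_function_bounded:
  assumes "test_function Y c c'"
  shows "\<exists>C>0. \<forall>s. \<bar>c s\<bar> \<le> C \<and> \<bar>c' s\<bar> \<le> C"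
proof -
  have "compact (c ` {-Y..Y} \<union> c' ` {-Y..Y})"
    by (intro compact_Un compact_continuous_image test_functionD[OF assms]) auto
  then have "bounded (c ` {-Y..Y} \<union> c' ` {-Y..Y})" by (rule compact_imp_bounded)
  then obtain C where "\<forall>y\<in>c ` {-Y..Y} \<union> c' ` {-Y..Y}. norm y \<le> C"
    unfolding bounded_iff by blast
  then have C: "\<bar>c s\<bar> \<le> C \<and> \<bar>c' s\<bar> \<le> C" if "s \<in> {-Y..Y}" for s using that by auto
  have "\<bar>c s\<bar> \<le> max C 1 \<and> \<bar>c' s\<bar> \<le> max C 1" for s
  proof (cases "Y < \<bar>s\<bar>")
    case True
    then show ?thesis using test_functionD(4,5)[OF assms] by simp
  next
    case False
    then have "s \<in> {-Y..Y}" by auto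
    from C[OF this] show ?thesis by auto
  qed
  then show ?thesis by (intro exI[of _ "max C 1"]) auto
qed

section \<open>The divergence theorem on the truncated domain\<close>

context roof_domain
begin

lemma grad_cont: "continuous_on \<Omega> (grad u)" and partial_cont: "continuous_on \<Omega> (partial u i)"
  and u_cont: "continuous_on \<Omega> u" and partial2_cont: "continuous_on \<Omega> (partial2 u i j)"
  by (rule harmonic_cont_grad harmonic_cont1 harmonic_cont harmonic_cont2, rule open_\<Omega>, rule harm)+

text \<open>The truncation makes the measure finite, so bounded continuous functions are integrable.
  Integrands with a test function supported in |x_1| <= Y have the same integral for every X >
  Y.\<close>

definition slab :: "real \<Rightarrow> (real^4) measure" where
  "slab X = restrict_space lborel {x \<in> \<Omega>. \<bar>x $ 1\<bar> < X}"

lemma open_slab: "open {x \<in> \<Omega>. \<bar>x $ 1\<bar> < X}"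
  using open_Int[OF open_\<Omega> open_Collect_less[of "\<lambda>x. \<bar>x $ 1\<bar>" "\<lambda>_. X"]]
  by (simp add: Int_def continuous_intros)

lemma space_slab: "space (slab X) = {x \<in> \<Omega>. \<bar>x $ 1\<bar> < X}"
  by (simp add: slab_def space_restrict_space)

lemma finite_slab: "finite_measure (slab X)"
proof
  let ?D = "{x \<in> \<Omega>. \<bar>x $ 1\<bar> < X}"
  have "?D \<subseteq> {x \<in> \<Omega>. \<bar>x $ 1\<bar> \<le> X}" by auto
  then have "bounded ?D" by (rule bounded_subset[OF bounded_slab])
  then have "emeasure lborel ?D \<noteq> \<infinity>" using emeasure_bounded_finite by (auto simp: less_top)
  then show "emeasure (slab X) (space (slab X)) \<noteq> \<infinity>"
    unfolding space_slab using open_slab[of X] by (simp add: slab_def emeasure_restrict_space)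
qed

lemma slab_measurable: "continuous_on \<Omega> f \<Longrightarrow> f \<in> borel_measurable (slab X)" for f :: "real^4 \<Rightarrow> real"
  unfolding slab_def measurable_cong_sets[OF sets_restrict_space_cong[OF sets_lborel] refl]
  by (rule borel_measurable_continuous_on_restrict) (rule continuous_on_subset, auto)

lemma slab_integrable:
  fixes f :: "real^4 \<Rightarrow> real"
  assumes "continuous_on \<Omega> f" "\<And>x. x \<in> \<Omega> \<Longrightarrow> \<bar>x $ 1\<bar> < X \<Longrightarrow> \<bar>f x\<bar> \<le> C"
  shows "integrable (slab X) f"
  using assms by (intro finite_measure.integrable_const_bound[OF finite_slab, of _ C] slab_measurable AE_I2)
    (auto simp: space_slab)

text \<open>The product of \<open>cutoff \<epsilon> (u x)\<close> and f is supported in u >=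
  \<epsilon>, |x_1| <= Y, a compact subset of \<open>\<Omega>\<close> because u tends to 0 at the
  frontier.\<close>

lemma cutoff_divergence:
  assumes \<epsilon>: "0 < \<epsilon>" and YX: "Y < X"
    and der: "\<And>x. x \<in> \<Omega> \<Longrightarrow> (f has_derivative f' x) (at x)"
    and cont: "continuous_on \<Omega> (\<lambda>x. f' x (axis i 1))"
    and zero: "\<And>x. x \<in> \<Omega> \<Longrightarrow> Y < \<bar>x $ 1\<bar> \<Longrightarrow> f x = 0"
  shows "has_bochner_integral (slab X) (\<lambda>x. cutoff \<epsilon> (u x) * f' x (axis i 1) + cutoff' \<epsilon> (u x) * partial u i x * f x) 0"
proof -
  define K where "K = {x \<in> \<Omega>. \<bar>x $ 1\<bar> \<le> Y \<and> \<epsilon> \<le> u x}"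
  define F' where "F' x h = cutoff \<epsilon> (u x) * f' x h + (grad u x \<bullet> h * cutoff' \<epsilon> (u x)) * f x" for x h
  have contf: "continuous_on \<Omega> f"
    by (rule cont_der[OF der])
  have K_eq: "K = {x \<in> \<Omega>. \<epsilon> \<le> min (u x) (\<epsilon> + Y - \<bar>x $ 1\<bar>)}"
    by (auto simp: K_def)
  have K: "compact K"
    unfolding K_eq
  proof (rule compact_superlevel)
    show "continuous_on \<Omega> (\<lambda>x. min (u x) (\<epsilon> + Y - \<bar>x $ 1\<bar>))" by (intro continuous_intros u_cont)
    show "bounded {x \<in> \<Omega>. \<epsilon> \<le> min (u x) (\<epsilon> + Y - \<bar>x $ 1\<bar>)}"
      by (rule bounded_subset[OF bounded_slab[of Y]]) auto
    fix x p assume fr: "filterlim x (at p within \<Omega>) sequentially" "p \<in> frontier \<Omega>"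
    have "(\<lambda>n. u (x n)) \<longlonglongrightarrow> 0" by (rule filterlim_compose[OF u_boundary[OF fr(2)] fr(1)])
    then have "eventually (\<lambda>n. u (x n) < \<epsilon>) sequentially" by (rule order_tendstoD(2)) (rule \<epsilon>)
    then obtain n where "u (x n) < \<epsilon>" using eventually_happens'[OF sequentially_bot] by blast
    then show "\<exists>n. min (u (x n)) (\<epsilon> + Y - \<bar>x n $ 1\<bar>) < \<epsilon>" by (intro exI[of _ n]) simp
  qed
  have "has_bochner_integral (slab X) (\<lambda>x. F' x (axis i 1)) 0"
    unfolding slab_def
  proof (rule has_bochner_integral_directional_derivative[OF open_\<Omega> K, where f = "\<lambda>x. cutoff \<epsilon> (u x) * f x"])
    show "K \<subseteq> {x \<in> \<Omega>. \<bar>x $ 1\<bar> < X}" using YX by (auto simp: K_def)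
    show "{x \<in> \<Omega>. \<bar>x $ 1\<bar> < X} \<in> sets borel" using open_slab by simp
    show "((\<lambda>x. cutoff \<epsilon> (u x) * f x) has_derivative F' x) (at x)" if "x \<in> \<Omega>" for x
      unfolding F'_def[abs_def]
      by (intro has_derivative_mult DERIV_compose_FDERIV[OF has_real_derivative_cutoff] der[OF that]
          has_derivative_partial harmonic_diff[OF \<Omega>_harm that])
    show "continuous_on \<Omega> (\<lambda>x. F' x (axis i 1))"
      unfolding F'_def grad_inner_axis
      by (intro continuous_intros cont contf partial_cont continuous_on_compose2[OF continuous_on_cutoff[of UNIV]]
          continuous_on_compose2[OF continuous_on_cutoff'[of UNIV]] u_cont) auto
    show "cutoff \<epsilon> (u x) * f x = 0" if "x \<in> \<Omega> - K" for x
      using that zero[of x] cutoff_eq_0[OF \<epsilon>, of "u x"] by (auto simp: K_def not_le)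
  qed auto
  then show ?thesis
    by (simp add: F'_def grad_inner_axis mult.commute[of "partial u i _"])
qed

text \<open>The divergence theorem for the field c(x_1) p before the passage to the limit: as
  \<epsilon> tends to 0, the \<open>cutoff'\<close> term turns into the flux through the
  frontier.\<close>

lemma cutoff_divergence_field:
  fixes p :: "4 \<Rightarrow> real^4 \<Rightarrow> real"
  assumes \<epsilon>: "0 < \<epsilon>" and YX: "Y < X" and test: "test_function Y c c'"
    and der: "\<And>i x. x \<in> \<Omega> \<Longrightarrow> (p i has_derivative p' i x) (at x)"
    and cont: "\<And>i. continuous_on \<Omega> (\<lambda>x. p' i x (axis i 1))"
  shows "has_bochner_integral (slab X) (\<lambda>x. cutoff \<epsilon> (u x) * (c (x $ 1) * divergence p' x + c' (x $ 1) * p 1 x)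
     + cutoff' \<epsilon> (u x) * (c (x $ 1) * normal_flux u p x)) 0"
proof -
  have contp: "continuous_on \<Omega> (p i)" for i
    by (rule cont_der[OF der])
  define f' where "f' i x h = c (x $ 1) * p' i x h + h $ 1 * c' (x $ 1) * p i x" for i x h
  have "has_bochner_integral (slab X) (\<lambda>x. cutoff \<epsilon> (u x) * f' i x (axis i 1) + cutoff' \<epsilon> (u x) * partial u i x * (c (x $ 1) * p i x)) 0" for i
  proof (rule cutoff_divergence[OF \<epsilon> YX])
    fix x assume x: "x \<in> \<Omega>"
    have "((\<lambda>x. x $ 1) has_derivative (\<lambda>h. h $ 1)) (at x)"
      by (rule bounded_linear.has_derivative[OF bounded_linear_vec_nth]) (rule has_derivative_ident)
    from DERIV_compose_FDERIV[OF test_functionD(1)[OF test] this]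
    show "((\<lambda>x. c (x $ 1) * p i x) has_derivative f' i x) (at x)"
      unfolding f'_def[abs_def] by (intro has_derivative_mult der x)
    show "c (x $ 1) * p i x = 0" if "Y < \<bar>x $ 1\<bar>" using test_functionD(4)[OF test that] by simp
  next
    show "continuous_on \<Omega> (\<lambda>x. f' i x (axis i 1))"
      unfolding f'_def
      by (intro continuous_intros cont contp continuous_on_compose2[OF test_functionD(2)[OF test, of UNIV]]
          continuous_on_compose2[OF test_functionD(3)[OF test, of UNIV]]) auto
  qed
  then have "has_bochner_integral (slab X) (\<lambda>x. \<Sum>i\<in>UNIV. cutoff \<epsilon> (u x) * f' i x (axis i 1) + cutoff' \<epsilon> (u x) * partial u i x * (c (x $ 1) * p i x))
    (\<Sum>i\<in>(UNIV::4 set). 0)"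
    by (rule has_bochner_integral_sum)
  moreover have "(\<Sum>i\<in>UNIV. cutoff \<epsilon> (u x) * f' i x (axis i 1) + cutoff' \<epsilon> (u x) * partial u i x * (c (x $ 1) * p i x))
    = cutoff \<epsilon> (u x) * (c (x $ 1) * divergence p' x + c' (x $ 1) * p 1 x)
     + cutoff' \<epsilon> (u x) * (c (x $ 1) * normal_flux u p x)" for x
  proof -
    have "(axis 1 1 :: real^4) $ 1 = 1" "(axis 2 1 :: real^4) $ 1 = 0" "(axis 3 1 :: real^4) $ 1 = 0" "(axis 4 1 :: real^4) $ 1 = 0"
      by (simp_all add: axis_def)
    then show ?thesis
      unfolding f'_def sum_4 by (simp add: algebra_simps)
  qed
  ultimately show ?thesis by simp
qed

text \<open>The condition on grad u is pointwise at the frontier; boundedness of the slab makes it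
  uniform. Counterexamples with u tending to 0 would cluster at a frontier point and contradict
  \<open>norm v = 1\<close> there.\<close>

lemma boundary_gradient:
  assumes \<tau>: "0 < \<tau>"
  shows "\<exists>\<eta>>0. \<forall>x\<in>\<Omega>. \<bar>x $ 1\<bar> \<le> Y \<longrightarrow> u x < \<eta> \<longrightarrow> \<bar>norm (grad u x) - 1\<bar> < \<tau>"
proof (rule ccontr)
  assume neg: "\<not> ?thesis"
  have "\<exists>x\<in>\<Omega>. \<bar>x $ 1\<bar> \<le> Y \<and> u x < inverse (real (Suc n)) \<and> \<tau> \<le> \<bar>norm (grad u x) - 1\<bar>" for n
  proof (rule ccontr)
    assume "\<not> ?thesis"
    then have "\<forall>x\<in>\<Omega>. \<bar>x $ 1\<bar> \<le> Y \<longrightarrow> u x < inverse (real (Suc n)) \<longrightarrow> \<bar>norm (grad u x) - 1\<bar> < \<tau>"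
      by (auto simp: not_le)
    then show False using neg by (meson inverse_positive_iff_positive of_nat_0_less_iff zero_less_Suc)
  qed
  then obtain x where x: "\<And>n. x n \<in> \<Omega>" "\<And>n. \<bar>x n $ 1\<bar> \<le> Y" "\<And>n. u (x n) < inverse (real (Suc n))"
    "\<And>n. \<tau> \<le> \<bar>norm (grad u (x n)) - 1\<bar>" by metis
  have "bounded (range x)" by (rule bounded_subset[OF bounded_slab[of Y]]) (use x in auto)
  then obtain p r where r: "strict_mono r" "(x \<circ> r) \<longlonglongrightarrow> p"
    using bounded_imp_convergent_subsequence by blast
  have lim: "(\<lambda>n. x (r n)) \<longlonglongrightarrow> p" using r by (simp add: o_def)
  have "(\<lambda>n. inverse (real (Suc (r n)))) \<longlonglongrightarrow> 0"
    using LIMSEQ_subseq_LIMSEQ[OF LIMSEQ_inverse_real_of_nat r(1)] by (simp add: o_def)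
  then have "(\<lambda>n. u (x (r n))) \<longlonglongrightarrow> 0"
    by (rule tendsto_sandwich[OF _ _ tendsto_const, rotated 2]) (use x(1,3) u_pos in \<open>auto intro!: always_eventually less_imp_le simp del: of_nat_Suc\<close>)
  have pO: "p \<notin> \<Omega>"
  proof
    assume p: "p \<in> \<Omega>"
    have "(\<lambda>n. u (x (r n))) \<longlonglongrightarrow> u p"
      by (rule continuous_on_tendsto_compose[OF u_cont lim p]) (use x in simp)
    then have "u p = 0" using \<open>(\<lambda>n. u (x (r n))) \<longlonglongrightarrow> 0\<close> LIMSEQ_unique by blast
    then show False using u_pos[OF p] by simp
  qed
  note fr = frontier_seq[OF x(1) lim pO]
  obtain v where v: "(grad u \<longlongrightarrow> v) (at p within \<Omega>)" "norm v = 1" using grad_boundary[OF fr(1)] by blast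
  have "(\<lambda>n. \<bar>norm (grad u (x (r n))) - 1\<bar>) \<longlonglongrightarrow> \<bar>norm v - 1\<bar>"
    by (intro tendsto_intros filterlim_compose[OF v(1) fr(2)])
  then have "\<tau> \<le> \<bar>norm v - 1\<bar>" by (rule tendsto_lowerbound) (use x in auto)
  then show False using v \<tau> by simp
qed

lemma u_bounded: "\<exists>C>0. \<forall>x\<in>\<Omega>. \<bar>x $ 1\<bar> \<le> X \<longrightarrow> \<bar>u x\<bar> \<le> C"
proof -
  obtain p where p: "p \<in> frontier \<Omega>" using frontier_nonempty by blast
  obtain R where R: "\<And>x. x \<in> \<Omega> \<Longrightarrow> \<bar>x $ 1\<bar> \<le> X \<Longrightarrow> norm x \<le> R"
    using bounded_slab[of X] by (auto simp: bounded_iff)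
  have "\<bar>u x\<bar> \<le> max 1 (2 ^ 15 * (R + norm p))" if x: "x \<in> \<Omega>" "\<bar>x $ 1\<bar> \<le> X" for x
  proof -
    have "u x \<le> 2 ^ 15 * dist x p" by (rule u_le_dist[OF x(1) p])
    also have "dist x p \<le> R + norm p"
      using norm_triangle_ineq4[of x p] R[OF x] by (simp add: dist_norm)
    finally show ?thesis using u_pos[OF x(1)] by simp
  qed
  then show ?thesis by (intro exI[of _ "max 1 (2 ^ 15 * (R + norm p))"]) auto
qed

lemma partial_le_grad: "\<bar>partial u i x\<bar> \<le> norm (grad u x)"
  using component_le_norm_cart[of "grad u x" i] by (simp add: grad_def)

definition eps :: "nat \<Rightarrow> real" where "eps n = inverse (real (Suc n))"

abbreviation layer :: "nat \<Rightarrow> real^4 \<Rightarrow> real" where "layer n x \<equiv> cutoff' (eps n) (u x)"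

lemma eps_pos: "0 < eps n" by (simp add: eps_def)

lemma eps_eventually: "0 < s \<Longrightarrow> eventually (\<lambda>n. 2 * eps n \<le> s) sequentially"
proof -
  assume s: "0 < s"
  have "eventually (\<lambda>n. eps n < s / 2) sequentially"
    unfolding eps_def by (rule order_tendstoD[OF LIMSEQ_inverse_real_of_nat]) (use s in simp)
  then show ?thesis by eventually_elim simp
qed

lemma cutoff_limit:
  fixes f :: "real^4 \<Rightarrow> real"
  assumes f: "continuous_on \<Omega> f" "\<And>x. x \<in> \<Omega> \<Longrightarrow> \<bar>x $ 1\<bar> < X \<Longrightarrow> \<bar>f x\<bar> \<le> C"
  shows "(\<lambda>n. LINT x|slab X. cutoff (eps n) (u x) * f x) \<longlonglongrightarrow> (LINT x|slab X. f x)"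
    and "integrable (slab X) (\<lambda>x. cutoff e (u x) * f x)"
proof -
  have cc: "continuous_on \<Omega> (\<lambda>x. cutoff e (u x) * f x)" for e
    by (intro continuous_intros f continuous_on_compose2[OF continuous_on_cutoff[of UNIV]] u_cont) auto
  have bd: "\<bar>cutoff e (u x) * f x\<bar> \<le> C" if "x \<in> \<Omega>" "\<bar>x $ 1\<bar> < X" for x e
    using mult_mono[OF cutoff_bounds[of e "u x"] f(2)[OF that]] by (simp add: abs_mult)
  show "integrable (slab X) (\<lambda>x. cutoff e (u x) * f x)"
    by (rule slab_integrable[OF cc bd])
  have intC: "integrable (slab X) (\<lambda>x. C)"
    using finite_slab by (simp add: finite_measure.integrable_const)
  show "(\<lambda>n. LINT x|slab X. cutoff (eps n) (u x) * f x) \<longlonglongrightarrow> (LINT x|slab X. f x)"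
  proof (rule integral_dominated_convergence[OF slab_measurable[OF f(1)] slab_measurable[OF cc] intC])
    show "AE x in slab X. (\<lambda>n. cutoff (eps n) (u x) * f x) \<longlonglongrightarrow> f x"
    proof (rule AE_I2)
      fix x assume "x \<in> space (slab X)"
      then have "0 < u x" by (simp add: space_slab u_pos)
      from eps_eventually[OF this]
      have "eventually (\<lambda>n. cutoff (eps n) (u x) * f x = f x) sequentially"
        by eventually_elim (simp add: cutoff_eq_1 eps_pos)
      then show "(\<lambda>n. cutoff (eps n) (u x) * f x) \<longlonglongrightarrow> f x" by (rule tendsto_eventually)
    qed
  qed (use bd in \<open>auto simp: space_slab intro!: AE_I2\<close>)
qed

text \<open>Each point is eventually left by the layers, and the factor u bounds the integrands by 4
  C, so dominated convergence gives zero.\<close>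

lemma cutoff'_limit:
  fixes f :: "real^4 \<Rightarrow> real"
  assumes f: "continuous_on \<Omega> f" "\<And>x. x \<in> \<Omega> \<Longrightarrow> \<bar>x $ 1\<bar> < X \<Longrightarrow> \<bar>f x\<bar> \<le> C"
  shows "(\<lambda>n. LINT x|slab X. layer n x * (u x * f x)) \<longlonglongrightarrow> 0"
    and "0 < e \<Longrightarrow> integrable (slab X) (\<lambda>x. cutoff' e (u x) * (u x * f x))"
proof -
  have cc: "continuous_on \<Omega> (\<lambda>x. cutoff' e (u x) * (u x * f x))" for e
    by (intro continuous_intros f continuous_on_compose2[OF continuous_on_cutoff'[of UNIV]] u_cont) auto
  have bd: "\<bar>cutoff' e (u x) * (u x * f x)\<bar> \<le> 4 * C" if "x \<in> \<Omega>" "\<bar>x $ 1\<bar> < X" "0 < e" for x e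
    using mult_mono[OF cutoff'_mult_bounds[OF that(3) u_pos[OF that(1)]] f(2)[OF that(1,2)]]
    by (simp add: abs_mult mult.assoc)
  show "integrable (slab X) (\<lambda>x. cutoff' e (u x) * (u x * f x))" if "0 < e"
    by (rule slab_integrable[OF cc bd[OF _ _ that]])
  have intC: "integrable (slab X) (\<lambda>x. 4 * C)"
    using finite_slab by (simp add: finite_measure.integrable_const)
  have "(\<lambda>n. LINT x|slab X. layer n x * (u x * f x)) \<longlonglongrightarrow> (LINT x|slab X. 0)"
  proof (rule integral_dominated_convergence[OF _ slab_measurable[OF cc] intC])
    show "AE x in slab X. (\<lambda>n. layer n x * (u x * f x)) \<longlonglongrightarrow> 0"
    proof (rule AE_I2)
      fix x assume "x \<in> space (slab X)"
      then have "0 < u x" by (simp add: space_slab u_pos)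
      from eps_eventually[OF this]
      have "eventually (\<lambda>n. layer n x * (u x * f x) = 0) sequentially"
        by eventually_elim (simp add: cutoff'_eq_0 eps_pos)
      then show "(\<lambda>n. layer n x * (u x * f x)) \<longlonglongrightarrow> 0" by (rule tendsto_eventually)
    qed
  qed (use bd eps_pos in \<open>auto simp: space_slab intro!: AE_I2\<close>)
  then show "(\<lambda>n. LINT x|slab X. layer n x * (u x * f x)) \<longlonglongrightarrow> 0" by simp
qed

lemma cont_test:
  assumes "test_function Y c c'"
  shows "continuous_on \<Omega> (\<lambda>x. c (x $ 1))" "continuous_on \<Omega> (\<lambda>x. c' (x $ 1))"
  by (auto intro!: continuous_on_compose2[OF test_functionD(3)[OF assms, of UNIV]]
      continuous_on_compose2[OF test_functionD(2)[OF assms, of UNIV]] continuous_intros)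

text \<open>The case \<open>f = u p\<close> of the divergence theorem: there is no boundary term.\<close>
lemma integral_by_parts_u:
  fixes p :: "4 \<Rightarrow> real^4 \<Rightarrow> real"
  assumes YX: "Y < X" and test: "test_function Y c c'"
    and der: "\<And>i x. x \<in> \<Omega> \<Longrightarrow> (p i has_derivative p' i x) (at x)"
    and cont: "\<And>i. continuous_on \<Omega> (\<lambda>x. p' i x (axis i 1))"
    and bound: "\<And>i x. x \<in> \<Omega> \<Longrightarrow> \<bar>x $ 1\<bar> < X \<Longrightarrow> \<bar>p i x\<bar> \<le> C"
      "\<And>x. x \<in> \<Omega> \<Longrightarrow> \<bar>x $ 1\<bar> < X \<Longrightarrow> \<bar>\<Sum>i\<in>UNIV. p' i x (axis i 1)\<bar> \<le> C"
  shows "(LINT x|slab X. c (x $ 1) * (u x * divergence p' x + normal_flux u p x) + c' (x $ 1) * (u x * p 1 x)) = 0"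
proof -
  define d where "d x = divergence p' x" for x
  define s where "s x = normal_flux u p x" for x
  define F where "F x = c (x $ 1) * (u x * d x + s x) + c' (x $ 1) * (u x * p 1 x)" for x
  have contp: "continuous_on \<Omega> (p i)" for i
    by (rule cont_der[OF der])
  have contd: "continuous_on \<Omega> d" unfolding d_def by (intro continuous_intros cont)
  have conts: "continuous_on \<Omega> s" unfolding s_def by (intro continuous_intros contp partial_cont)
  obtain D where D: "0 < D" "\<And>s. \<bar>c s\<bar> \<le> D" "\<And>s. \<bar>c' s\<bar> \<le> D"
    using test_function_bounded[OF test] by blast
  obtain U where U: "\<And>x. x \<in> \<Omega> \<Longrightarrow> \<bar>x $ 1\<bar> \<le> X \<Longrightarrow> \<bar>u x\<bar> \<le> U" using u_bounded by blast
  have sb: "\<bar>s x\<bar> \<le> 4 * (2 ^ 18 * C)" if "x \<in> \<Omega>" "\<bar>x $ 1\<bar> < X" for x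
  proof -
    have "\<bar>s x\<bar> \<le> (\<Sum>i\<in>(UNIV::4 set). 2 ^ 18 * C)"
      unfolding s_def
    proof (rule order_trans[OF sum_abs sum_mono])
      fix i
      have "\<bar>partial u i x\<bar> \<le> 2 ^ 18" using partial_le_grad norm_grad_bounded[OF that(1)] order_trans by blast
      then show "\<bar>partial u i x * p i x\<bar> \<le> 2 ^ 18 * C"
        unfolding abs_mult using bound(1)[OF that] by (intro mult_mono) auto
    qed
    then show ?thesis by simp
  qed
  have contF: "continuous_on \<Omega> F"
    unfolding F_def by (intro continuous_intros cont_test[OF test] u_cont contd conts contp)
  have Fb: "\<bar>F x\<bar> \<le> D * (U * C + 4 * (2 ^ 18 * C)) + D * (U * C)" if "x \<in> \<Omega>" "\<bar>x $ 1\<bar> < X" for x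
  proof -
    have "\<bar>u x * d x\<bar> \<le> U * C" "\<bar>u x * p 1 x\<bar> \<le> U * C"
      unfolding abs_mult d_def using bound[OF that] U[OF that(1)] that(2) by (intro mult_mono; force)+
    then show ?thesis
      unfolding F_def using sb[OF that] D
      by (intro order_trans[OF abs_triangle_ineq] add_mono) (auto simp: abs_mult intro!: mult_mono order_trans[OF abs_triangle_ineq])
  qed
  have "has_bochner_integral (slab X) (\<lambda>x. cutoff (eps n) (u x) * F x + layer n x * (u x * (c (x $ 1) * s x))) 0" for n
  proof -
    have "has_bochner_integral (slab X) (\<lambda>x. cutoff (eps n) (u x) * (c (x $ 1) * (\<Sum>i\<in>UNIV. u x * p' i x (axis i 1) + (grad u x \<bullet> axis i 1) * p i x) + c' (x $ 1) * (u x * p 1 x))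
     + layer n x * (c (x $ 1) * (\<Sum>i\<in>UNIV. partial u i x * (u x * p i x)))) 0"
      by (rule cutoff_divergence_field[OF eps_pos YX test])
        (auto intro!: has_derivative_mult der has_derivative_partial harmonic_diff[OF \<Omega>_harm] continuous_intros
          cont u_cont contp grad_cont)
    moreover have "(\<Sum>i\<in>UNIV. u x * p' i x (axis i 1) + (grad u x \<bullet> axis i 1) * p i x) = u x * d x + s x" for x
      by (simp add: d_def s_def grad_inner_axis sum.distrib sum_distrib_left)
    moreover have "(\<Sum>i\<in>UNIV. partial u i x * (u x * p i x)) = u x * s x" for x
      by (simp add: s_def sum_distrib_left mult_ac)
    ultimately show ?thesis by (simp add: F_def mult_ac)
  qed
  note I = this
  have bchi: "\<bar>c (x $ 1) * s x\<bar> \<le> D * (4 * (2 ^ 18 * C))" if "x \<in> \<Omega>" "\<bar>x $ 1\<bar> < X" for x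
    unfolding abs_mult using sb[OF that] D by (intro mult_mono) auto
  have contchi: "continuous_on \<Omega> (\<lambda>x. c (x $ 1) * s x)" by (intro continuous_intros cont_test[OF test] conts)
  have "(LINT x|slab X. cutoff (eps n) (u x) * F x) + (LINT x|slab X. layer n x * (u x * (c (x $ 1) * s x))) = 0" for n
    using I[of n] cutoff_limit(2)[OF contF Fb] cutoff'_limit(2)[OF contchi bchi eps_pos]
    by (simp add: has_bochner_integral_iff)
  moreover have "(\<lambda>n. (LINT x|slab X. cutoff (eps n) (u x) * F x) + (LINT x|slab X. layer n x * (u x * (c (x $ 1) * s x))))
    \<longlonglongrightarrow> (LINT x|slab X. F x) + 0"
    by (intro tendsto_add cutoff_limit(1)[OF contF Fb] cutoff'_limit(1)[OF contchi bchi])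
  ultimately have "(LINT x|slab X. F x) = 0"
    by (simp add: LIMSEQ_const_iff)
  then show ?thesis by (simp add: F_def d_def s_def)
qed

section \<open>Flux identities on slabs\<close>

lemma norm_grad_square: "(norm (grad u x))\<^sup>2 = (\<Sum>i\<in>UNIV. (partial u i x)\<^sup>2)"
  unfolding power2_norm_eq_inner inner_vec_def by (simp add: grad_def power2_eq_square)

lemma test_bounded_slab:
  assumes test: "test_function Y c c'" and f: "continuous_on \<Omega> f" and b: "\<And>x. x \<in> \<Omega> \<Longrightarrow> \<bar>x $ 1\<bar> < X \<Longrightarrow> \<bar>f x\<bar> \<le> C"
  shows "integrable (slab X) (\<lambda>x. c (x $ 1) * f x)" "integrable (slab X) (\<lambda>x. c' (x $ 1) * f x)"
    "\<exists>D. \<forall>x\<in>\<Omega>. \<bar>x $ 1\<bar> < X \<longrightarrow> \<bar>c (x $ 1) * f x\<bar> \<le> D \<and> \<bar>c' (x $ 1) * f x\<bar> \<le> D"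
proof -
  obtain D where D: "0 < D" "\<And>s. \<bar>c s\<bar> \<le> D" "\<And>s. \<bar>c' s\<bar> \<le> D"
    using test_function_bounded[OF test] by blast
  have 1: "\<bar>c (x $ 1) * f x\<bar> \<le> D * C" "\<bar>c' (x $ 1) * f x\<bar> \<le> D * C" if "x \<in> \<Omega>" "\<bar>x $ 1\<bar> < X" for x
    unfolding abs_mult using b[OF that] D less_imp_le[OF D(1)] by (auto intro!: mult_mono)
  then show "\<exists>D. \<forall>x\<in>\<Omega>. \<bar>x $ 1\<bar> < X \<longrightarrow> \<bar>c (x $ 1) * f x\<bar> \<le> D \<and> \<bar>c' (x $ 1) * f x\<bar> \<le> D" by blast
  show "integrable (slab X) (\<lambda>x. c (x $ 1) * f x)"
    by (rule slab_integrable[OF _ 1(1)]) (intro continuous_intros cont_test[OF test] f)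
  show "integrable (slab X) (\<lambda>x. c' (x $ 1) * f x)"
    by (rule slab_integrable[OF _ 1(2)]) (intro continuous_intros cont_test[OF test] f)
qed

lemma slab_u_bounded: "\<exists>C. \<forall>x\<in>\<Omega>. \<bar>x $ 1\<bar> < X \<longrightarrow> \<bar>u x\<bar> \<le> C"
  using u_bounded[of X] less_imp_le by metis

lemma transverse_bounded: "\<exists>C. \<forall>x\<in>\<Omega>. \<bar>x $ 1\<bar> < X \<longrightarrow> radius x \<le> C"
proof -
  obtain G where "\<And>t. \<bar>t\<bar> \<le> X \<Longrightarrow> g t \<le> G" using g_bounded by blast
  then have "\<forall>x\<in>\<Omega>. \<bar>x $ 1\<bar> < X \<longrightarrow> radius x \<le> G"
    unfolding \<Omega>_eq by (fastforce intro: less_imp_le)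
  then show ?thesis by blast
qed

lemma transverse_has_derivative: "((\<lambda>x. transverse x $ i) has_derivative (\<lambda>h. transverse h $ i)) (at x)"
  by (cases "i = 1") (auto simp: transverse_nth intro!: bounded_linear_imp_has_derivative bounded_linear_vec_nth)

lemma transverse_divergence: "(\<Sum>i\<in>UNIV. transverse (axis i 1) $ i) = 3"
  by (simp add: sum_4 transverse_nth)

text \<open>Integration by parts with the constant field e_1. Used once for N' and, with a
  derivative of the bump as test function, once more for N''.\<close>

lemma integral_u_derivative:
  assumes YX: "Y < X" and test: "test_function Y c c'"
  shows "(LINT x|slab X. c' (x $ 1) * u x) = - (LINT x|slab X. c (x $ 1) * partial u 1 x)"
proof -
  have "(LINT x|slab X. c (x $ 1) * (u x * (\<Sum>i\<in>(UNIV::4 set). 0) + (\<Sum>i\<in>UNIV. partial u i x * of_bool (i = 1)))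
      + c' (x $ 1) * (u x * of_bool ((1::4) = 1))) = 0"
    by (rule integral_by_parts_u[OF YX test, where C = 1]) auto
  then have 1: "(LINT x|slab X. c (x $ 1) * partial u 1 x + c' (x $ 1) * u x) = 0"
    by (simp add: sum_4)
  obtain C where C: "\<forall>x\<in>\<Omega>. \<bar>x $ 1\<bar> < X \<longrightarrow> \<bar>u x\<bar> \<le> C" using slab_u_bounded by blast
  have "integrable (slab X) (\<lambda>x. c' (x $ 1) * u x)"
    by (rule test_bounded_slab(2)[OF test u_cont]) (use C in auto)
  moreover have "integrable (slab X) (\<lambda>x. c (x $ 1) * partial u 1 x)"
    by (rule test_bounded_slab(1)[OF test partial_cont partial1_bound])
  ultimately show ?thesis using 1 by simp
qed

text \<open>The radial field in the three transverse variables has divergence 3. This identity is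
  the first half of Poincare's inequality on the slices.\<close>

lemma integral_u_transverse:
  assumes YX: "Y < X" and test: "test_function Y c c'"
  shows "3 * (LINT x|slab X. c (x $ 1) * u x) = - (LINT x|slab X. c (x $ 1) * (grad u x \<bullet> transverse x))"
proof -
  obtain C where C: "\<And>x. x \<in> \<Omega> \<Longrightarrow> \<bar>x $ 1\<bar> < X \<Longrightarrow> radius x \<le> C" using transverse_bounded by blast
  have "(LINT x|slab X. c (x $ 1) * (u x * (\<Sum>i\<in>UNIV. transverse (axis i 1) $ i) + (\<Sum>i\<in>UNIV. partial u i x * transverse x $ i))
      + c' (x $ 1) * (u x * transverse x $ 1)) = 0"
  proof (rule integral_by_parts_u[OF YX test, where C = "max 3 C"])
    show "\<bar>transverse x $ i\<bar> \<le> max 3 C" if "x \<in> \<Omega>" "\<bar>x $ 1\<bar> < X" for i x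
      using component_le_norm_cart[of "transverse x" i] C[OF that] by simp
  qed (auto simp: transverse_divergence transverse_has_derivative)
  then have 1: "(LINT x|slab X. 3 * (c (x $ 1) * u x) + c (x $ 1) * (grad u x \<bullet> transverse x)) = 0"
    unfolding transverse_divergence
    by (simp add: transverse_nth[of _ 1] inner_vec_def grad_def algebra_simps)
  obtain U where U: "\<forall>x\<in>\<Omega>. \<bar>x $ 1\<bar> < X \<longrightarrow> \<bar>u x\<bar> \<le> U" using slab_u_bounded by blast
  have "integrable (slab X) (\<lambda>x. c (x $ 1) * u x)"
    by (rule test_bounded_slab(1)[OF test u_cont]) (use U in auto)
  moreover have "integrable (slab X) (\<lambda>x. c (x $ 1) * (grad u x \<bullet> transverse x))"
  proof (rule test_bounded_slab(1)[OF test])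
    show "continuous_on \<Omega> (\<lambda>x. grad u x \<bullet> transverse x)"
      by (intro continuous_intros grad_cont continuous_on_transverse)
    show "\<bar>grad u x \<bullet> transverse x\<bar> \<le> 2 ^ 18 * C" if "x \<in> \<Omega>" "\<bar>x $ 1\<bar> < X" for x
      using mult_mono[OF norm_grad_bounded[OF that(1)] C[OF that]]
      by (intro order_trans[OF Cauchy_Schwarz_ineq2]) auto
  qed
  ultimately show ?thesis using 1 by simp
qed

text \<open>Without a factor u the layer terms survive. That they converge at all is read off from
  the divergence identity, whose other terms converge by dominated convergence; no surface measure
  has to exist.\<close>

lemma flux_limit:
  fixes p :: "4 \<Rightarrow> real^4 \<Rightarrow> real"
  assumes YX: "Y < X" and test: "test_function Y c c'"
    and der: "\<And>i x. x \<in> \<Omega> \<Longrightarrow> (p i has_derivative p' i x) (at x)"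
    and cont: "\<And>i. continuous_on \<Omega> (\<lambda>x. p' i x (axis i 1))"
    and bound: "\<And>x. x \<in> \<Omega> \<Longrightarrow> \<bar>x $ 1\<bar> < X \<Longrightarrow> \<bar>p 1 x\<bar> \<le> C"
      "\<And>x. x \<in> \<Omega> \<Longrightarrow> \<bar>x $ 1\<bar> < X \<Longrightarrow> \<bar>\<Sum>i\<in>UNIV. p' i x (axis i 1)\<bar> \<le> C"
  shows "(\<lambda>n. LINT x|slab X. layer n x * (c (x $ 1) * normal_flux u p x))
      \<longlonglongrightarrow> - (LINT x|slab X. c (x $ 1) * divergence p' x + c' (x $ 1) * p 1 x)"
    and "integrable (slab X) (\<lambda>x. layer n x * (c (x $ 1) * normal_flux u p x))"
proof -
  define d where "d x = divergence p' x" for x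
  define s where "s x = normal_flux u p x" for x
  define F where "F x = c (x $ 1) * d x + c' (x $ 1) * p 1 x" for x
  have contp: "continuous_on \<Omega> (p i)" for i
    by (rule cont_der[OF der])
  have contd: "continuous_on \<Omega> d" unfolding d_def by (intro continuous_intros cont)
  have contF: "continuous_on \<Omega> F"
    unfolding F_def by (intro continuous_intros cont_test[OF test] contd contp)
  obtain D1 where D1: "\<And>x. x \<in> \<Omega> \<Longrightarrow> \<bar>x $ 1\<bar> < X \<Longrightarrow> \<bar>c (x $ 1) * d x\<bar> \<le> D1"
    using test_bounded_slab(3)[OF test contd, of X C] bound(2) unfolding d_def by blast
  obtain D2 where D2: "\<And>x. x \<in> \<Omega> \<Longrightarrow> \<bar>x $ 1\<bar> < X \<Longrightarrow> \<bar>c' (x $ 1) * p 1 x\<bar> \<le> D2"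
    using test_bounded_slab(3)[OF test contp, of X 1 C] bound(1) by blast
  have Fb: "\<bar>F x\<bar> \<le> D1 + D2" if "x \<in> \<Omega>" "\<bar>x $ 1\<bar> < X" for x
    unfolding F_def using D1[OF that] D2[OF that] by linarith
  have I: "has_bochner_integral (slab X) (\<lambda>x. cutoff (eps n) (u x) * F x + layer n x * (c (x $ 1) * s x)) 0" for n
    using cutoff_divergence_field[OF eps_pos YX test der cont] unfolding F_def d_def s_def by simp
  have int: "integrable (slab X) (\<lambda>x. layer n x * (c (x $ 1) * s x))" for n
    using Bochner_Integration.integrable_diff[OF I[of n, unfolded has_bochner_integral_iff, THEN conjunct1] cutoff_limit(2)[OF contF Fb, where e = "eps n"]] by simp
  then show "integrable (slab X) (\<lambda>x. layer n x * (c (x $ 1) * normal_flux u p x))"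
    by (simp add: s_def)
  have "(LINT x|slab X. layer n x * (c (x $ 1) * s x)) = - (LINT x|slab X. cutoff (eps n) (u x) * F x)" for n
    using has_bochner_integral_integral_eq[OF I[of n]] int[of n] cutoff_limit(2)[OF contF Fb, where e = "eps n"] by simp
  moreover have "(\<lambda>n. - (LINT x|slab X. cutoff (eps n) (u x) * F x)) \<longlonglongrightarrow> - (LINT x|slab X. F x)"
    by (intro tendsto_minus cutoff_limit(1)[OF contF Fb])
  ultimately show "(\<lambda>n. LINT x|slab X. layer n x * (c (x $ 1) * normal_flux u p x))
      \<longlonglongrightarrow> - (LINT x|slab X. c (x $ 1) * divergence p' x + c' (x $ 1) * p 1 x)"
    by (simp add: F_def d_def s_def)
qed

text \<open>The measures \<open>cutoff' \<epsilon> (u x) |\<nabla>u|\<^sup>2 dx\<close> play the role of the surface measure of the frontier.\<close>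
lemma energy_limit:
  assumes YX: "Y < X" and test: "test_function Y c c'" and test': "test_function Y c' c''"
  shows "(\<lambda>n. LINT x|slab X. layer n x * (c (x $ 1) * (norm (grad u x))\<^sup>2))
      \<longlonglongrightarrow> (LINT x|slab X. c'' (x $ 1) * u x)"
    and "integrable (slab X) (\<lambda>x. layer n x * (c (x $ 1) * (norm (grad u x))\<^sup>2))"
proof -
  have div: "(\<Sum>i\<in>UNIV. grad (partial u i) x \<bullet> axis i 1) = 0" if "x \<in> \<Omega>" for x
    unfolding grad_inner_axis by (rule harmonic_laplace[OF \<Omega>_harm that])
  have der: "(partial u i has_derivative (\<lambda>h. grad (partial u i) x \<bullet> h)) (at x)" if "x \<in> \<Omega>" for i x
    by (rule has_derivative_partial[OF harmonic_diff2[OF \<Omega>_harm that]])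
  have cont: "continuous_on \<Omega> (\<lambda>x. grad (partial u i) x \<bullet> axis i 1)" for i
    unfolding grad_inner_axis by (rule partial2_cont)
  have sq: "(\<Sum>i\<in>UNIV. partial u i x * partial u i x) = (norm (grad u x))\<^sup>2" for x
    unfolding norm_grad_square by (simp add: power2_eq_square)
  \<comment> \<open>The field is grad u, divergence-free and with normal flux |grad u|^2. What
    remains is the integral of \<open>c'\<close> times the axial derivative, and a second
    integration by parts moves it to \<open>c''\<close>.\<close>
  note F = flux_limit[OF YX test der cont, of 1, unfolded sq]
  show "integrable (slab X) (\<lambda>x. layer n x * (c (x $ 1) * (norm (grad u x))\<^sup>2))"
    by (rule F(2)) (auto simp: div partial1_bound)
  have "(LINT x|slab X. c (x $ 1) * (\<Sum>i\<in>UNIV. grad (partial u i) x \<bullet> axis i 1) + c' (x $ 1) * partial u 1 x)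
    = (LINT x|slab X. c' (x $ 1) * partial u 1 x)"
    by (intro Bochner_Integration.integral_cong refl) (simp add: space_slab div)
  also have "\<dots> = - (LINT x|slab X. c'' (x $ 1) * u x)"
    using integral_u_derivative[OF YX test'] by simp
  finally show "(\<lambda>n. LINT x|slab X. layer n x * (c (x $ 1) * (norm (grad u x))\<^sup>2))
      \<longlonglongrightarrow> (LINT x|slab X. c'' (x $ 1) * u x)"
    using F(1) by (simp add: div partial1_bound)
qed

text \<open>\<open>layer n\<close> vanishes where u >= 2 \<open>eps n\<close>, so for large n only
  the region u < \<eta> counts. There the density is compared with |grad u|^2, whose layer integrals
  converge by \<open>energy_limit\<close>.\<close>

lemma boundary_bound:
  assumes YX: "Y < X" and test: "test_function Y c c'" and test': "test_function Y c' c''"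
    and nn: "\<And>s. 0 \<le> c s" and \<eta>: "0 < \<eta>" 
    and w: "\<And>x. x \<in> \<Omega> \<Longrightarrow> c (x $ 1) \<noteq> 0 \<Longrightarrow> u x < \<eta> \<Longrightarrow> \<bar>w x\<bar> \<le> K * (norm (grad u x))\<^sup>2"
    and int: "\<And>n. integrable (slab X) (\<lambda>x. layer n x * (c (x $ 1) * w x))"
    and lim: "(\<lambda>n. LINT x|slab X. layer n x * (c (x $ 1) * w x)) \<longlonglongrightarrow> J"
  shows "\<bar>J\<bar> \<le> K * (LINT x|slab X. c'' (x $ 1) * u x)"
proof -
  have lim1: "(\<lambda>n. \<bar>LINT x|slab X. layer n x * (c (x $ 1) * w x)\<bar>) \<longlonglongrightarrow> \<bar>J\<bar>"
    by (intro tendsto_intros lim)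
  have lim2: "(\<lambda>n. K * (LINT x|slab X. layer n x * (c (x $ 1) * (norm (grad u x))\<^sup>2)))
      \<longlonglongrightarrow> K * (LINT x|slab X. c'' (x $ 1) * u x)"
    by (intro tendsto_intros energy_limit[OF YX test test'])
  have "eventually (\<lambda>n. \<bar>LINT x|slab X. layer n x * (c (x $ 1) * w x)\<bar>
      \<le> K * (LINT x|slab X. layer n x * (c (x $ 1) * (norm (grad u x))\<^sup>2))) sequentially"
    using eps_eventually[OF \<eta>]
  proof eventually_elim
    fix n assume n: "2 * eps n \<le> \<eta>"
    have "\<bar>LINT x|slab X. layer n x * (c (x $ 1) * w x)\<bar>
      \<le> (LINT x|slab X. \<bar>layer n x * (c (x $ 1) * w x)\<bar>)"
      by (rule integral_abs_bound)
    also have "\<dots> \<le> (LINT x|slab X. K * (layer n x * (c (x $ 1) * (norm (grad u x))\<^sup>2)))"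
    proof (rule integral_mono)
      show "integrable (slab X) (\<lambda>x. \<bar>layer n x * (c (x $ 1) * w x)\<bar>)"
        using int by (rule integrable_abs)
      show "integrable (slab X) (\<lambda>x. K * (layer n x * (c (x $ 1) * (norm (grad u x))\<^sup>2)))"
        by (intro integrable_mult_right energy_limit[OF YX test test'])
      fix x assume "x \<in> space (slab X)"
      then have x: "x \<in> \<Omega>" by (simp add: space_slab)
      show "\<bar>layer n x * (c (x $ 1) * w x)\<bar> \<le> K * (layer n x * (c (x $ 1) * (norm (grad u x))\<^sup>2))"
      proof (cases "c (x $ 1) = 0 \<or> \<eta> \<le> u x")
        case True
        then have "layer n x * c (x $ 1) = 0"
          using n cutoff'_eq_0[OF eps_pos[of n], of "u x"] by auto
        then show ?thesis by auto
      next
        case False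
        have "\<bar>w x\<bar> \<le> K * (norm (grad u x))\<^sup>2" by (rule w[OF x]) (use False in auto)
        then have "(layer n x * c (x $ 1)) * \<bar>w x\<bar> \<le> (layer n x * c (x $ 1)) * (K * (norm (grad u x))\<^sup>2)"
          using nn cutoff'_nonneg[OF eps_pos] by (intro mult_left_mono) auto
        then show ?thesis
          using nn cutoff'_nonneg[OF eps_pos] by (simp add: abs_mult mult_ac)
      qed
    qed
    finally show "\<bar>LINT x|slab X. layer n x * (c (x $ 1) * w x)\<bar>
      \<le> K * (LINT x|slab X. layer n x * (c (x $ 1) * (norm (grad u x))\<^sup>2))"
      by simp
  qed
  from tendsto_le[OF _ lim2 lim1 this] show ?thesis by simp
qed

text \<open>\<open>\<integral> c'' u\<close> is the \<open>c\<close>-weighted area of the frontier, and the left-hand side the flux of the field \<open>c p\<close> through it.\<close>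
lemma flux_bound:
  fixes p :: "4 \<Rightarrow> real^4 \<Rightarrow> real"
  assumes YX: "Y < X" and test: "test_function Y c c'" and test': "test_function Y c' c''"
    and nn: "\<And>s. 0 \<le> c s"
    and der: "\<And>i x. x \<in> \<Omega> \<Longrightarrow> (p i has_derivative p' i x) (at x)"
    and cont: "\<And>i. continuous_on \<Omega> (\<lambda>x. p' i x (axis i 1))"
    and bound: "\<And>x. x \<in> \<Omega> \<Longrightarrow> \<bar>x $ 1\<bar> < X \<Longrightarrow> \<bar>p 1 x\<bar> \<le> C"
      "\<And>x. x \<in> \<Omega> \<Longrightarrow> \<bar>x $ 1\<bar> < X \<Longrightarrow> \<bar>\<Sum>i\<in>UNIV. p' i x (axis i 1)\<bar> \<le> C"
    and G: "0 \<le> G" "\<And>x. x \<in> \<Omega> \<Longrightarrow> c (x $ 1) \<noteq> 0 \<Longrightarrow> \<bar>normal_flux u p x\<bar> \<le> G * norm (grad u x)"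
  shows "\<bar>LINT x|slab X. c (x $ 1) * divergence p' x + c' (x $ 1) * p 1 x\<bar>
    \<le> G * (LINT x|slab X. c'' (x $ 1) * u x)"
proof -
  define J where "J = (LINT x|slab X. c (x $ 1) * divergence p' x + c' (x $ 1) * p 1 x)"
  define A where "A = (LINT x|slab X. c'' (x $ 1) * u x)"
  \<comment> \<open>Near the frontier |grad u| >= 1 - \<tau>, hence |grad u| <= |grad u|^2 / (1 -
    \<tau>). This bridges the linear bound on the flux and the quadratic density of
    \<open>boundary_bound\<close>; \<tau> then tends to 0.\<close>
  have "(1 - \<tau>) * \<bar>J\<bar> \<le> G * A" if \<tau>: "0 < \<tau>" "\<tau> < 1" for \<tau>
  proof -
    obtain \<eta> where \<eta>: "0 < \<eta>" "\<And>x. x \<in> \<Omega> \<Longrightarrow> \<bar>x $ 1\<bar> \<le> Y \<Longrightarrow> u x < \<eta> \<Longrightarrow> \<bar>norm (grad u x) - 1\<bar> < \<tau>"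
      using boundary_gradient[OF \<tau>(1)] by blast
    have "\<bar>- J\<bar> \<le> G / (1 - \<tau>) * A"
      unfolding J_def A_def
    proof (rule boundary_bound[OF YX test test' nn \<eta>(1) _ flux_limit(2,1)[OF YX test der cont bound]])
      fix x assume x: "x \<in> \<Omega>" "c (x $ 1) \<noteq> 0" "u x < \<eta>"
      have "\<bar>x $ 1\<bar> \<le> Y" using test_functionD(4)[OF test] x(2) by (meson not_le)
      then have "1 - \<tau> \<le> norm (grad u x)" using \<eta>(2)[OF x(1) _ x(3)] by linarith
      then have "(1 - \<tau>) * norm (grad u x) \<le> (norm (grad u x))\<^sup>2"
        by (simp add: power2_eq_square mult_right_mono)
      then have "norm (grad u x) \<le> (norm (grad u x))\<^sup>2 / (1 - \<tau>)"
        using \<tau> by (simp add: field_simps)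
      then have "G * norm (grad u x) \<le> G * ((norm (grad u x))\<^sup>2 / (1 - \<tau>))"
        by (rule mult_left_mono) (rule G)
      with G(2)[OF x(1,2)] show "\<bar>normal_flux u p x\<bar> \<le> G / (1 - \<tau>) * (norm (grad u x))\<^sup>2"
        by simp
    qed
    then show ?thesis using \<tau> by (simp add: field_simps)
  qed
  then have "eventually (\<lambda>\<tau>. (1 - \<tau>) * \<bar>J\<bar> \<le> G * A) (at_right 0)"
    using eventually_at_right_real[of 0 1] by (auto elim: eventually_mono)
  moreover have "((\<lambda>\<tau>. (1 - \<tau>) * \<bar>J\<bar>) \<longlongrightarrow> (1 - 0) * \<bar>J\<bar>) (at_right 0)"
    by (intro tendsto_intros)
  ultimately have "(1 - 0) * \<bar>J\<bar> \<le> G * A"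
    by (intro tendsto_upperbound) auto
  then show ?thesis by (simp add: J_def A_def)
qed

text \<open>The constant field e_1 has normal component at most 1 in absolute value. With a bump for
  \<open>c\<close> this becomes |V'| <= N''.\<close>

lemma axial_flux_bound:
  assumes YX: "Y < X" and test: "test_function Y c c'" and test': "test_function Y c' c''" and nn: "\<And>s. 0 \<le> c s"
  shows "\<bar>LINT x|slab X. c' (x $ 1)\<bar> \<le> (LINT x|slab X. c'' (x $ 1) * u x)"
proof -
  have "\<bar>LINT x|slab X. c (x $ 1) * (\<Sum>i\<in>(UNIV::4 set). 0) + c' (x $ 1) * of_bool ((1::4) = 1)\<bar>
    \<le> 1 * (LINT x|slab X. c'' (x $ 1) * u x)"
    by (rule flux_bound[OF YX test test' nn, where C = 1 and p = "\<lambda>i x. of_bool (i = 1)" and p' = "\<lambda>_ _ _. 0"])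
      (auto simp: sum_4 partial_le_grad)
  then show ?thesis by simp
qed

text \<open>The radial transverse field has divergence 3 and length at most \<open>G\<close> on the
  support of \<open>c\<close>. With a bump for \<open>c\<close> this becomes 3 V <= G N''.\<close>

lemma transverse_flux_bound:
  assumes YX: "Y < X" and test: "test_function Y c c'" and test': "test_function Y c' c''" and nn: "\<And>s. 0 \<le> c s"
    and G: "\<And>s. c s \<noteq> 0 \<Longrightarrow> g s \<le> G" "0 \<le> G"
  shows "3 * (LINT x|slab X. c (x $ 1)) \<le> G * (LINT x|slab X. c'' (x $ 1) * u x)"
proof -
  have "\<bar>LINT x|slab X. c (x $ 1) * (\<Sum>i\<in>UNIV. transverse (axis i 1) $ i) + c' (x $ 1) * transverse x $ 1\<bar>
    \<le> G * (LINT x|slab X. c'' (x $ 1) * u x)"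
  proof (rule flux_bound[OF YX test test' nn _ _ _ _ G(2), where C = 3])
    fix x assume x: "x \<in> \<Omega>" "c (x $ 1) \<noteq> 0"
    have "(\<Sum>i\<in>UNIV. partial u i x * transverse x $ i) = grad u x \<bullet> transverse x"
      by (simp add: inner_vec_def grad_def)
    moreover have "\<bar>grad u x \<bullet> transverse x\<bar> \<le> norm (grad u x) * G"
      by (rule order_trans[OF Cauchy_Schwarz_ineq2 mult_left_mono])
        (use x G(1)[OF x(2)] in \<open>auto simp: \<Omega>_eq\<close>)
    ultimately show "\<bar>\<Sum>i\<in>UNIV. partial u i x * transverse x $ i\<bar> \<le> G * norm (grad u x)"
      by (simp add: mult.commute)
  qed (auto simp: transverse_divergence transverse_has_derivative transverse_nth[of _ 1])
  then show ?thesis unfolding transverse_divergence by (simp add: transverse_nth[of _ 1] mult.commute[of _ 3])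
qed

text \<open>Conservation of the axial component of the stress tensor \<open>\<nabla>u \<otimes> \<nabla>u - |\<nabla>u|\<^sup>2 I / 2\<close>,
  whose normal component on the frontier is half the normal vector.\<close>
lemma stress_conservation:
  assumes YX: "Y < X" and test: "test_function Y c c'" and test': "test_function Y c' c''" and nn: "\<And>s. 0 \<le> c s"
  shows "(LINT x|slab X. c' (x $ 1) * ((partial u 1 x)\<^sup>2 - (norm (grad u x))\<^sup>2 / 2 - 1 / 2)) = 0"
proof -
  \<comment> \<open>The axial row of the stress tensor minus e_1 / 2. Its normal flux, the axial
    derivative times (|grad u|^2 - 1) / 2, tends to zero at the frontier.\<close>
  define p where "p i x = partial u 1 x * partial u i x - of_bool (i = 1) * ((\<Sum>j\<in>UNIV. (partial u j x)\<^sup>2) / 2 + 1 / 2)" for i x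
  define p' where "p' i x h = partial u 1 x * (grad (partial u i) x \<bullet> h) + (grad (partial u 1) x \<bullet> h) * partial u i x
    - of_bool (i = 1) * (\<Sum>j\<in>UNIV. partial u j x * (grad (partial u j) x \<bullet> h))" for i x h
  have d2: "(partial u i has_derivative (\<lambda>h. grad (partial u i) x \<bullet> h)) (at x)" if "x \<in> \<Omega>" for i x
    by (rule has_derivative_partial[OF harmonic_diff2[OF \<Omega>_harm that]])
  have der: "(p i has_derivative p' i x) (at x)" if x: "x \<in> \<Omega>" for i x
  proof -
    have 1: "((\<lambda>x. (\<Sum>j\<in>UNIV. (partial u j x)\<^sup>2) / 2 + 1 / 2) has_derivative
        (\<lambda>h. \<Sum>j\<in>UNIV. partial u j x * (grad (partial u j) x \<bullet> h))) (at x)"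
    proof -
      have "((\<lambda>x. (partial u j x)\<^sup>2 / 2) has_derivative (\<lambda>h. partial u j x * (grad (partial u j) x \<bullet> h))) (at x)" for j
        by (auto intro!: derivative_eq_intros d2[OF x])
      then show ?thesis
        unfolding sum_divide_distrib by (intro has_derivative_add_const has_derivative_sum)
    qed
    show ?thesis
      unfolding p_def[abs_def] p'_def[abs_def]
      by (intro has_derivative_diff has_derivative_mult d2[OF x] has_derivative_mult_right 1)
  qed
  have cont: "continuous_on \<Omega> (\<lambda>x. p' i x (axis i 1))" for i
    unfolding p'_def grad_inner_axis by (intro continuous_intros partial_cont partial2_cont)
  have div: "divergence p' x = 0" if x: "x \<in> \<Omega>" for x
  proof -
    have "divergence p' x = partial u 1 x * (\<Sum>i\<in>UNIV. partial2 u i i x)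
      + (\<Sum>i\<in>UNIV. partial2 u 1 i x * partial u i x) - (\<Sum>j\<in>UNIV. partial u j x * partial2 u j 1 x)"
      unfolding p'_def grad_inner_axis by (simp add: sum_4 algebra_simps)
    also have "(\<Sum>j\<in>UNIV. partial u j x * partial2 u j 1 x) = (\<Sum>i\<in>UNIV. partial2 u 1 i x * partial u i x)"
      by (simp add: harmonic_partial_commute[OF \<Omega>_harm x, of _ 1] mult.commute)
    also have "(\<Sum>i\<in>UNIV. partial2 u i i x) = 0" by (rule harmonic_laplace[OF \<Omega>_harm x])
    finally show ?thesis by simp
  qed
  have p1: "p 1 x = (partial u 1 x)\<^sup>2 - (norm (grad u x))\<^sup>2 / 2 - 1 / 2" for x
    unfolding p_def norm_grad_square by (simp add: power2_eq_square)
  have s: "normal_flux u p x = partial u 1 x * ((norm (grad u x))\<^sup>2 - 1) / 2" for x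
    unfolding p_def norm_grad_square by (simp add: sum_4 field_simps power2_eq_square)
  have bound: "\<bar>p 1 x\<bar> \<le> 1 + (2 ^ 18)\<^sup>2" if x: "x \<in> \<Omega>" for x
  proof -
    have "(partial u 1 x)\<^sup>2 \<le> 1" using partial1_bound[OF x] by (simp add: abs_square_le_1)
    moreover have "(norm (grad u x))\<^sup>2 \<le> (2 ^ 18)\<^sup>2" using norm_grad_bounded[OF x] by (intro power_mono) auto
    moreover have "0 \<le> (partial u 1 x)\<^sup>2" "0 \<le> (norm (grad u x))\<^sup>2" by auto
    ultimately show ?thesis unfolding p1 by linarith
  qed
  define J where "J = (LINT x|slab X. c (x $ 1) * divergence p' x + c' (x $ 1) * p 1 x)"
  define A where "A = (LINT x|slab X. c'' (x $ 1) * u x)"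
  have A: "0 \<le> A"
    using axial_flux_bound[OF YX test test' nn] abs_ge_zero order_trans unfolding A_def by blast
  have "\<bar>J\<bar> \<le> 3 / 2 * \<tau> * A" if \<tau>: "0 < \<tau>" "\<tau> \<le> 1 / 2" for \<tau>
  proof -
    obtain \<eta> where \<eta>: "0 < \<eta>" "\<And>x. x \<in> \<Omega> \<Longrightarrow> \<bar>x $ 1\<bar> \<le> Y \<Longrightarrow> u x < \<eta> \<Longrightarrow> \<bar>norm (grad u x) - 1\<bar> < \<tau>"
      using boundary_gradient[OF \<tau>(1)] by blast
    have "\<bar>- J\<bar> \<le> 3 / 2 * \<tau> * A"
      unfolding J_def A_def
    proof (rule boundary_bound[OF YX test test' nn \<eta>(1) _ flux_limit(2,1)[OF YX test der cont]])
      fix x assume x: "x \<in> \<Omega>" "c (x $ 1) \<noteq> 0" "u x < \<eta>"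
      define m where "m = norm (grad u x)"
      have "\<bar>x $ 1\<bar> \<le> Y" using test_functionD(4)[OF test] x(2) by (meson not_le)
      then have m: "\<bar>m - 1\<bar> < \<tau>" using \<eta>(2)[OF x(1) _ x(3)] by (simp add: m_def)
      have "m\<^sup>2 - 1 = (m - 1) * (m + 1)" by (simp add: power2_eq_square algebra_simps)
      then have "\<bar>m\<^sup>2 - 1\<bar> = \<bar>m - 1\<bar> * \<bar>m + 1\<bar>" by (simp add: abs_mult)
      \<comment> \<open>As m > 1 - \<tau> >= 1/2, one has m + 1 <= 3 m. The extra factor m provides
        the homogeneity that \<open>boundary_bound\<close> asks for.\<close>
      also have "\<dots> \<le> \<tau> * (3 * m)" using m \<tau> by (intro mult_mono) auto
      finally have "\<bar>partial u 1 x\<bar> * \<bar>m\<^sup>2 - 1\<bar> \<le> m * (\<tau> * (3 * m))"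
        using partial_le_grad[of 1 x] by (intro mult_mono) (auto simp: m_def)
      then have "\<bar>partial u 1 x * (m\<^sup>2 - 1) / 2\<bar> \<le> m * (\<tau> * (3 * m)) / 2"
        by (simp add: abs_mult)
      then show "\<bar>normal_flux u p x\<bar> \<le> 3 / 2 * \<tau> * (norm (grad u x))\<^sup>2"
        unfolding s m_def[symmetric] by (simp add: power2_eq_square mult_ac)
    qed (use bound div in auto)
    then show ?thesis by simp
  qed
  then have "eventually (\<lambda>\<tau>. \<bar>J\<bar> \<le> 3 / 2 * \<tau> * A) (at_right 0)"
    using eventually_at_right_real[of 0 "1/2"] by (auto elim: eventually_mono)
  moreover have "((\<lambda>\<tau>. 3 / 2 * \<tau> * A) \<longlongrightarrow> 3 / 2 * 0 * A) (at_right 0)"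
    by (intro tendsto_intros)
  ultimately have "\<bar>J\<bar> \<le> 3 / 2 * 0 * A"
    by (intro tendsto_lowerbound) auto
  then have "J = 0" by simp
  moreover have "J = (LINT x|slab X. c' (x $ 1) * ((partial u 1 x)\<^sup>2 - (norm (grad u x))\<^sup>2 / 2 - 1 / 2))"
    unfolding J_def p1 by (intro Bochner_Integration.integral_cong refl) (simp add: space_slab div)
  ultimately show ?thesis by simp
qed

end

section \<open>The differential inequality for the slice integrals\<close>

text \<open>N'' >= c0 persists, so N' grows at least linearly and exceeds Vb from the time T = 1 +
  (Vb + 1)/c0 on. As V - N' never increases, V <= 2 N' from then on, and N^(6/5) <= B N' with B = 1
  + 3 D^3. Then N^(-1/5) falls at a rate of at least 1/(5B) from a value of at most 1 at T, and
  cannot stay positive until T + 5B.\<close>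

lemma slice_ode_contradiction:
  fixes N N1 N2 V V1 G :: "real \<Rightarrow> real"
  assumes L: "1 + (Vb + 1) / c0 + 5 * (1 + 3 * D ^ 3) \<le> L" and c0: "0 < c0" "c0 \<le> 1" and D: "0 < D" and Vb: "0 \<le> Vb"
    and N: "\<And>t. 1 \<le> t \<Longrightarrow> t \<le> L \<Longrightarrow> 0 < N t"
    and dN: "\<And>t. 1 \<le> t \<Longrightarrow> t \<le> L \<Longrightarrow> DERIV N t :> N1 t"
    and dN1: "\<And>t. 1 \<le> t \<Longrightarrow> t \<le> L \<Longrightarrow> DERIV N1 t :> N2 t"
    and dV: "\<And>t. 1 \<le> t \<Longrightarrow> t \<le> L \<Longrightarrow> DERIV V t :> V1 t"
    and V1: "\<And>t. 1 \<le> t \<Longrightarrow> t \<le> L \<Longrightarrow> \<bar>V1 t\<bar> \<le> N2 t"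
    and NV: "\<And>t. 1 \<le> t \<Longrightarrow> t \<le> L \<Longrightarrow> N1 t \<le> V t"
    and GN2: "\<And>t. 1 \<le> t \<Longrightarrow> t \<le> L \<Longrightarrow> 3 * V t \<le> G t * N2 t"
    and GN: "\<And>t. 1 \<le> t \<Longrightarrow> t \<le> L \<Longrightarrow> 9 * (N t)\<^sup>2 \<le> (G t)\<^sup>2 * V t * D"
    and G: "\<And>t. 1 \<le> t \<Longrightarrow> t \<le> L \<Longrightarrow> 0 < G t" "\<And>t. 1 \<le> t \<Longrightarrow> t \<le> L \<Longrightarrow> G t ^ 3 \<le> 8 * V t"
    and init: "c0 \<le> N1 1" "V 1 \<le> Vb"
  shows False
proof -
  define B where "B = 1 + 3 * D ^ 3"
  define T where "T = 1 + (Vb + 1) / c0"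
  have B: "1 \<le> B" using D by (simp add: B_def)
  have mono: "f a \<le> f b" if ab: "1 \<le> a" "a \<le> b" "b \<le> L"
    and f: "\<And>t. 1 \<le> t \<Longrightarrow> t \<le> L \<Longrightarrow> DERIV f t :> f' t \<and> 0 \<le> f' t" for f f' :: "real \<Rightarrow> real" and a b
  proof (rule DERIV_nonneg_imp_nondecreasing[OF ab(2)])
    fix x assume "a \<le> x" "x \<le> b"
    then show "\<exists>y. DERIV f x :> y \<and> 0 \<le> y" using f[of x] ab by auto
  qed
  have "0 \<le> 5 * (1 + 3 * D ^ 3)" using D by simp
  then have TL: "T \<le> L" using L by (simp add: T_def)
  have T1: "1 \<le> T" using Vb c0 by (simp add: T_def)
  have L1: "1 \<le> L" using T1 TL by simp
  have N2: "0 \<le> N2 t" if "1 \<le> t" "t \<le> L" for t using V1[OF that] by linarith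
  have N1: "c0 \<le> N1 t" if "1 \<le> t" "t \<le> L" for t
    using mono[OF order_refl that, of N1 N2] dN1 N2 init by force
  \<comment> \<open>Cubing 3 V <= G N'' and inserting G^3 <= 8 V gives 27 V^2 <= 8 (N'')^3. Since V
    >= N' >= c0 and c0 <= 1, the left side is at least 27 c0^3.\<close>
  have N2c: "c0 \<le> N2 t" if t: "1 \<le> t" "t \<le> L" for t
  proof (rule ccontr)
    assume "\<not> ?thesis"
    then have "N2 t ^ 3 < c0 ^ 3" using N2[OF t] by (intro power_strict_mono) auto
    have V: "c0 \<le> V t" using N1[OF t] NV[OF t] by simp
    have "(3 * V t) ^ 3 \<le> (G t * N2 t) ^ 3"
      using GN2[OF t] V c0 by (intro power_mono) auto
    also have "\<dots> = G t ^ 3 * N2 t ^ 3" by (simp add: power_mult_distrib)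
    also have "\<dots> \<le> 8 * V t * N2 t ^ 3"
      using G(2)[OF t] N2[OF t] by (intro mult_right_mono) auto
    finally have "V t * (27 * (V t)\<^sup>2) \<le> V t * (8 * N2 t ^ 3)"
      by (simp add: power2_eq_square power3_eq_cube)
    then have "27 * (V t)\<^sup>2 \<le> 8 * N2 t ^ 3" using V c0 by simp
    moreover have "c0\<^sup>2 \<le> (V t)\<^sup>2" using V c0 by (intro power_mono) auto
    moreover have "c0 ^ 3 \<le> c0\<^sup>2" using c0 by (intro power_decreasing) auto
    moreover have "0 < c0 ^ 3" using c0 by simp
    ultimately show False using \<open>N2 t ^ 3 < c0 ^ 3\<close> by linarith
  qed
  have grow: "c0 * (t - 1) \<le> N1 t" if t: "1 \<le> t" "t \<le> L" for t
  proof -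
    have "N1 1 - c0 * 1 \<le> N1 t - c0 * t"
      by (rule mono[OF order_refl t, of _ "\<lambda>t. N2 t - c0"]) (auto intro!: derivative_eq_intros dN1 simp: N2c)
    then show ?thesis using init c0 by (simp add: algebra_simps)
  qed
  have N1T: "Vb \<le> N1 t" if t: "T \<le> t" "t \<le> L" for t
  proof -
    have "c0 * (T - 1) = Vb + 1" using c0 by (simp add: T_def)
    moreover have "c0 * (T - 1) \<le> c0 * (t - 1)" using c0 t by simp
    ultimately show ?thesis using grow[of t] t T1 by linarith
  qed
  \<comment> \<open>Cube 9 N^2 <= G^2 V D and use G^6 <= 64 V^2 and V <= 2 N': this gives 729 N^6 <=
    2048 D^3 (N')^5, and 2048/729 < 3. Replacing B by B^5 makes the right side a fifth
    power.\<close>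
  have key: "N t powr (6/5) \<le> B * N1 t" if t: "T \<le> t" "t \<le> L" for t
  proof -
    have t': "1 \<le> t" "t \<le> L" using t T1 by auto
    have "N1 1 - V 1 \<le> N1 t - V t"
      by (rule mono[OF order_refl t', of _ "\<lambda>t. N2 t - V1 t"])
        (auto intro!: derivative_eq_intros dN1 dV dest: V1)
    then have V2: "V t \<le> 2 * N1 t" using N1T[OF t] init c0 by linarith
    have Vp: "0 < V t" using N1[OF t'] NV[OF t'] c0 by linarith
    have "(9 * (N t)\<^sup>2) ^ 3 \<le> ((G t)\<^sup>2 * V t * D) ^ 3"
      using GN[OF t'] by (intro power_mono) auto
    also have "\<dots> = (G t ^ 3)\<^sup>2 * (V t ^ 3 * D ^ 3)"
      by (simp add: power_mult_distrib power_mult[symmetric] mult.commute)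
    also have "\<dots> \<le> (8 * V t)\<^sup>2 * (V t ^ 3 * D ^ 3)"
      using G(1,2)[OF t'] Vp D by (intro mult_right_mono power_mono) auto
    also have "\<dots> = 64 * D ^ 3 * V t ^ 5" by (simp add: power2_eq_square numeral_eq_Suc)
    also have "\<dots> \<le> 64 * D ^ 3 * (2 * N1 t) ^ 5"
      using V2 Vp D by (intro mult_left_mono power_mono) auto
    finally have "729 * N t ^ 6 \<le> 2048 * (D ^ 3 * N1 t ^ 5)"
      by (simp add: power_mult_distrib power_mult[symmetric])
    moreover have N15: "0 \<le> N1 t ^ 5" using N1[OF t'] c0 by simp
    moreover have "0 \<le> D ^ 3 * N1 t ^ 5" using N15 D by simp
    ultimately have "N t ^ 6 \<le> 3 * D ^ 3 * N1 t ^ 5" by linarith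
    also have "\<dots> \<le> B * N1 t ^ 5" using N15 by (intro mult_right_mono) (simp add: B_def)
    also have "\<dots> \<le> B ^ 5 * N1 t ^ 5" using N15 B power_increasing[of 1 5 B] by (intro mult_right_mono) auto
    finally have "N t ^ 6 \<le> (B * N1 t) ^ 5" by (simp add: power_mult_distrib)
    also have "N t ^ 6 = N t powr (real 6)" by (rule powr_realpow[symmetric]) (rule N[OF t'])
    also have "\<dots> = (N t powr (6/5)) powr (real 5)" by (simp add: powr_powr)
    also have "\<dots> = (N t powr (6/5)) ^ 5" by (rule powr_realpow) (use N[OF t'] in simp)
    finally show ?thesis
      by (rule power_mono_iff[THEN iffD1, rotated -1]) (use B N1[OF t'] c0 in auto)
  qed
  have NT: "1 \<le> N T"
  proof -
    have "N 1 - c0 * 1 \<le> N T - c0 * T"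
      by (rule mono[OF order_refl T1 TL, of _ "\<lambda>t. N1 t - c0"]) (auto intro!: derivative_eq_intros dN simp: N1)
    moreover have "c0 * (T - 1) = Vb + 1" using c0 by (simp add: T_def)
    ultimately show ?thesis using N[OF order_refl L1] Vb c0 by (simp add: algebra_simps)
  qed
  \<comment> \<open>The exponent -1/5 is 1 - 6/5: the derivative of N^(-1/5) is -1/5 N^(-6/5) N', at
    most -1/(5B) by \<open>key\<close>.\<close>
  have "N L powr (-1/5) + 1 / (5 * B) * L \<le> N T powr (-1/5) + 1 / (5 * B) * T"
  proof (rule DERIV_nonpos_imp_nonincreasing[OF TL, of "\<lambda>t. N t powr (-1/5) + 1 / (5 * B) * t"])
    fix t assume t: "T \<le> t" "t \<le> L"
    have t': "1 \<le> t" "t \<le> L" using t T1 by auto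
    have "DERIV (\<lambda>t. N t powr (-1/5) + 1 / (5 * B) * t) t :> (-1/5 * N t powr (-1/5 - 1) * N1 t + 1 / (5 * B))"
      using N[OF t'] B by (auto intro!: derivative_eq_intros DERIV_fun_powr[THEN DERIV_cong] dN[OF t'])
    moreover have "N t powr (-1/5 - 1) * N t powr (6/5) = 1"
      using N[OF t'] by (simp add: powr_add[symmetric])
    then have "1 \<le> N t powr (-1/5 - 1) * (B * N1 t)"
      using mult_left_mono[OF key[OF t], of "N t powr (-1/5 - 1)"] by simp
    then have "1 / (5 * B) \<le> 1 / 5 * (N t powr (-1/5 - 1) * N1 t)"
      using B by (simp add: field_simps)
    ultimately show "\<exists>y. DERIV (\<lambda>t. N t powr (-1/5) + 1 / (5 * B) * t) t :> y \<and> y \<le> 0"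
      by (intro exI conjI) auto
  qed
  moreover have "N T powr (-1/5) \<le> 1" using NT powr_mono2'[of "-1/5" 1 "N T"] by simp
  moreover have "0 < N L powr (-1/5)" using N[OF L1 order_refl] by simp
  moreover have "1 / (5 * B) * (L - T) \<ge> 1"
    using L B by (simp add: T_def B_def[symmetric] field_simps)
  ultimately show False unfolding right_diff_distrib by linarith
qed

section \<open>Weighted slabs\<close>

text \<open>The third power makes the bump twice continuously differentiable, as the two
  integrations by parts leading to N'' require.\<close>

definition bump :: "real \<Rightarrow> real \<Rightarrow> real" where
  "bump \<delta> s = (max 0 (\<delta>\<^sup>2 - s\<^sup>2)) ^ 3"
definition bump1 :: "real \<Rightarrow> real \<Rightarrow> real" where
  "bump1 \<delta> s = - 6 * s * (max 0 (\<delta>\<^sup>2 - s\<^sup>2))\<^sup>2"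
definition bump2 :: "real \<Rightarrow> real \<Rightarrow> real" where
  "bump2 \<delta> s = 24 * s\<^sup>2 * max 0 (\<delta>\<^sup>2 - s\<^sup>2) - 6 * (max 0 (\<delta>\<^sup>2 - s\<^sup>2))\<^sup>2"

lemma has_real_derivative_bump:
  "DERIV (bump \<delta>) s :> bump1 \<delta> s" "DERIV (bump1 \<delta>) s :> bump2 \<delta> s"
proof -
  have q: "DERIV (\<lambda>s. \<delta>\<^sup>2 - s\<^sup>2) s :> - 2 * s"
    by (auto intro!: derivative_eq_intros)
  have 3: "DERIV (\<lambda>s. (max 0 (\<delta>\<^sup>2 - s\<^sup>2)) ^ 3) s :> 3 * (max 0 (\<delta>\<^sup>2 - s\<^sup>2))\<^sup>2 * (- 2 * s)"
    using DERIV_chain2[OF has_real_derivative_max_power[of 1] q] by (simp add: numeral_eq_Suc)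
  have 2: "DERIV (\<lambda>s. (max 0 (\<delta>\<^sup>2 - s\<^sup>2))\<^sup>2) s :> 2 * max 0 (\<delta>\<^sup>2 - s\<^sup>2) * (- 2 * s)"
    using DERIV_chain2[OF has_real_derivative_max_power[of 0] q] by (simp add: numeral_eq_Suc)
  show "DERIV (bump \<delta>) s :> bump1 \<delta> s"
    unfolding bump_def[abs_def] bump1_def using 3 by (simp add: mult_ac)
  have "DERIV (\<lambda>s. - 6 * s) s :> - 6"
    by (auto intro!: derivative_eq_intros)
  from DERIV_mult[OF this 2]
  show "DERIV (bump1 \<delta>) s :> bump2 \<delta> s"
    unfolding bump1_def[abs_def] bump2_def by (rule DERIV_cong) (simp add: power2_eq_square algebra_simps)
qed

lemma bump_nonneg: "0 \<le> bump \<delta> s"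
  by (simp add: bump_def)

lemma bump_pos: "\<bar>s\<bar> < \<delta> \<Longrightarrow> 0 < bump \<delta> s"
  using power_strict_mono[of "\<bar>s\<bar>" \<delta> 2] by (simp add: bump_def)

lemma bump_eq_0: "0 < \<delta> \<Longrightarrow> \<delta> \<le> \<bar>s\<bar> \<Longrightarrow> bump \<delta> s = 0 \<and> bump1 \<delta> s = 0"
  using power_mono[of \<delta> "\<bar>s\<bar>" 2] by (simp add: bump_def bump1_def)

lemma test_function_bump:
  assumes \<delta>: "0 < \<delta>"
  shows "test_function (\<bar>t\<bar> + \<delta>) (\<lambda>s. bump \<delta> (s - t)) (\<lambda>s. bump1 \<delta> (s - t))"
    "test_function (\<bar>t\<bar> + \<delta>) (\<lambda>s. bump1 \<delta> (s - t)) (\<lambda>s. bump2 \<delta> (s - t))"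
proof -
  have shift: "DERIV (\<lambda>s. s - t) s :> 1" for s by (auto intro!: derivative_eq_intros)
  have zero: "bump \<delta> (s - t) = 0 \<and> bump1 \<delta> (s - t) = 0" if "\<bar>t\<bar> + \<delta> < \<bar>s\<bar>" for s
    by (rule bump_eq_0[OF \<delta>]) (use that in linarith)
  show "test_function (\<bar>t\<bar> + \<delta>) (\<lambda>s. bump \<delta> (s - t)) (\<lambda>s. bump1 \<delta> (s - t))"
    unfolding test_function_def
    using DERIV_chain2[OF has_real_derivative_bump(1) shift] zero
    by (auto simp: bump1_def intro!: continuous_intros)
  show "test_function (\<bar>t\<bar> + \<delta>) (\<lambda>s. bump1 \<delta> (s - t)) (\<lambda>s. bump2 \<delta> (s - t))"
    unfolding test_function_def
    using DERIV_chain2[OF has_real_derivative_bump(2) shift] zero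
    by (auto simp: bump2_def intro!: continuous_intros)
qed

lemma test_function_mono: "test_function Y c c' \<Longrightarrow> Y \<le> Z \<Longrightarrow> test_function Z c c'"
  by (auto simp: test_function_def)

lemma bij_betw_axis_Basis: "bij_betw (\<lambda>i. axis i 1) UNIV (Basis :: (real^'n) set)"
  by (auto simp: bij_betw_def inj_on_def Basis_vec_def axis_eq_axis)

text \<open>The normalizing constant of the slice averages. A cylinder of radius r has weighted
  volume r^3 times it, so V compares with g^3 by constants that do not depend on \<delta>.\<close>

definition cylinder_mass :: "real \<Rightarrow> real" where
  "cylinder_mass \<delta> = (LINT x|lborel. bump \<delta> (x $ 1) * indicator {x. radius x < 1} x)"

text \<open>Substitute the dilation by \<open>r\<close> of the last three coordinates.\<close>
lemma integral_cylinder: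
  assumes r: "0 < r"
  shows "(LINT x|lborel. bump \<delta> (x $ 1 - t) * indicator {x. radius x < r} x)
    = r ^ 3 * cylinder_mass \<delta>"
proof -
  define a where "a j = (if j = axis 1 1 then 1 else r)" for j :: "real^4"
  have a_axis: "a (axis i 1) = (if i = 1 then 1 else r)" for i by (simp add: a_def axis_eq_axis)
  define T where "T x = t *\<^sub>R axis 1 1 + (\<Sum>j\<in>Basis. (a j * (x \<bullet> j)) *\<^sub>R j)" for x :: "real^4"
  let ?f = "\<lambda>x. bump \<delta> (x $ 1 - t) * indicator {x. radius x < r} x"
  have cb: "continuous_on UNIV (\<lambda>x::real^4. bump \<delta> (x $ 1 - t))"
    unfolding bump_def by (intro continuous_intros)
  have "open {x. radius x < r}"
    by (intro open_Collect_less continuous_intros continuous_on_transverse)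
  then have meas: "?f \<in> borel_measurable borel"
    using borel_measurable_continuous_onI[OF cb] by (intro borel_measurable_times borel_measurable_indicator) auto
  have "(LINT x|lborel. ?f x) = (\<Prod>j\<in>Basis. \<bar>a j\<bar>) * (LINT x|lborel. ?f (T x))"
    unfolding T_def by (rule integral_lborel_affine_euclidean[OF _ meas]) (use r in \<open>auto simp: a_def\<close>)
  also have "(\<Prod>j\<in>Basis. \<bar>a j\<bar>) = (\<Prod>i\<in>(UNIV::4 set). \<bar>a (axis i 1)\<bar>)"
    by (rule prod.reindex_bij_betw[OF bij_betw_axis_Basis, symmetric])
  also have "\<dots> = r ^ 3"
    unfolding UNIV_4 using r by (simp add: a_axis power3_eq_cube)
  also have "(\<lambda>x. ?f (T x)) = (\<lambda>x. bump \<delta> (x $ 1) * indicator {x. radius x < 1} x)"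
  proof
    fix x
    have Tx: "T x $ k = (if k = 1 then t + x $ 1 else r * x $ k)" for k
    proof -
      have "(\<Sum>j\<in>Basis. (a j * (x \<bullet> j)) *\<^sub>R j) = (\<Sum>i\<in>UNIV. (a (axis i 1) * (x \<bullet> axis i 1)) *\<^sub>R axis i 1)"
        by (rule sum.reindex_bij_betw[OF bij_betw_axis_Basis, symmetric])
      then have "T x = t *\<^sub>R axis 1 1 + (\<Sum>i\<in>UNIV. (a (axis i 1) * x $ i) *\<^sub>R axis i 1)"
        by (simp add: T_def inner_axis)
      then have "T x $ k = t * axis 1 1 $ k + (\<Sum>i\<in>UNIV. a (axis i 1) * x $ i * axis i 1 $ k)"
        by simp
      also have "(\<Sum>i\<in>UNIV. a (axis i 1) * x $ i * axis i 1 $ k) = a (axis k 1) * x $ k"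
        by (simp add: axis_def if_distrib cong: if_cong)
      finally show ?thesis by (cases "k = 1") (simp_all add: a_axis, simp_all add: axis_def)
    qed
    have "transverse (T x) = r *\<^sub>R transverse x"
      by (simp add: vec_eq_iff transverse_nth Tx)
    then have "norm (transverse (T x)) < r \<longleftrightarrow> radius x < 1"
      using r by simp
    then show "?f (T x) = bump \<delta> (x $ 1) * indicator {x. radius x < 1} x"
      by (simp add: Tx indicator_def)
  qed
  finally show ?thesis by (simp add: cylinder_mass_def)
qed

lemma integrable_cylinder:
  "integrable lborel (\<lambda>x. bump \<delta> (x $ 1 - t) * indicator {x. radius x < r} x)" if \<delta>: "0 < \<delta>"
proof -
  define K where "K = cball (0::real^4) (\<bar>t\<bar> + \<delta> + \<bar>r\<bar>)"
  have "continuous_on K (\<lambda>x. bump \<delta> (x $ 1 - t))"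
    unfolding bump_def by (intro continuous_intros)
  then have "integrable lborel (\<lambda>x. indicator K x *\<^sub>R bump \<delta> (x $ 1 - t))"
    by (intro borel_integrable_compact) (auto simp: K_def)
  moreover have "open {x. radius x < r}"
    by (intro open_Collect_less continuous_intros continuous_on_transverse)
  then have "{x. radius x < r} \<in> sets lborel" by simp
  ultimately have "integrable lborel (\<lambda>x. indicator {x. radius x < r} x *\<^sub>R (indicator K x *\<^sub>R bump \<delta> (x $ 1 - t)))"
    by (rule integrable_mult_indicator[rotated])
  moreover have "indicator {x. radius x < r} x *\<^sub>R (indicator K x *\<^sub>R bump \<delta> (x $ 1 - t))
    = bump \<delta> (x $ 1 - t) * indicator {x. radius x < r} x" for x
  proof (cases "x \<in> K \<or> radius x \<ge> r")
    case False
    have "norm x \<le> norm (x $ 1 *\<^sub>R axis 1 1 :: real^4) + radius x"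
      using norm_triangle_ineq[of "x $ 1 *\<^sub>R axis 1 1" "transverse x"] by (simp add: transverse_def)
    then have "norm x \<le> \<bar>x $ 1\<bar> + radius x" by simp
    then have "\<delta> \<le> \<bar>x $ 1 - t\<bar>" using False by (simp add: K_def) linarith
    then show ?thesis using bump_eq_0[OF \<delta>] by simp
  qed (auto simp: indicator_def)
  ultimately show ?thesis by (simp only:)
qed

text \<open>The weighted variance of e about its weighted mean \<open>l\<close> is
  nonnegative.\<close>

lemma (in finite_measure) integral_Cauchy_Schwarz:
  fixes b e :: "'a \<Rightarrow> real"
  assumes nn: "\<And>x. x \<in> space M \<Longrightarrow> 0 \<le> b x" and int: "integrable M b" "integrable M (\<lambda>x. b x * e x)" "integrable M (\<lambda>x. b x * (e x)\<^sup>2)"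
    and pos: "0 < (LINT x|M. b x)"
  shows "(LINT x|M. b x * e x)\<^sup>2 \<le> (LINT x|M. b x) * (LINT x|M. b x * (e x)\<^sup>2)"
proof -
  define l where "l = (LINT x|M. b x * e x) / (LINT x|M. b x)"
  have "0 \<le> (LINT x|M. b x * (e x - l)\<^sup>2)"
    using nn by (intro integral_nonneg_AE AE_I2) simp
  also have "(\<lambda>x. b x * (e x - l)\<^sup>2) = (\<lambda>x. b x * (e x)\<^sup>2 - 2 * l * (b x * e x) + l\<^sup>2 * b x)"
    by (auto simp: power2_eq_square algebra_simps)
  also have "(LINT x|M. \<dots> x) = (LINT x|M. b x * (e x)\<^sup>2) - 2 * l * (LINT x|M. b x * e x) + l\<^sup>2 * (LINT x|M. b x)"
    using int by simp
  also have "\<dots> = (LINT x|M. b x * (e x)\<^sup>2) - (LINT x|M. b x * e x)\<^sup>2 / (LINT x|M. b x)"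
    using pos by (simp add: l_def power2_eq_square field_simps)
  finally show ?thesis using pos by (simp add: field_simps)
qed

section \<open>Slice averages and the final contradiction\<close>

context roof_domain
begin

lemma slab_shift_derivative:
  fixes f :: "real^4 \<Rightarrow> real"
  assumes test: "test_function Y c c'" and f: "continuous_on \<Omega> f" "\<And>x. x \<in> \<Omega> \<Longrightarrow> \<bar>x $ 1\<bar> < X \<Longrightarrow> \<bar>f x\<bar> \<le> C"
  shows "DERIV (\<lambda>t. LINT x|slab X. c (x $ 1 - t) * f x) t :> - (LINT x|slab X. c' (x $ 1 - t) * f x)"
proof -
  obtain D where D: "0 < D" "\<And>s. \<bar>c s\<bar> \<le> D" "\<And>s. \<bar>c' s\<bar> \<le> D"
    using test_function_bounded[OF test] by blast
  have cont: "continuous_on \<Omega> (\<lambda>x. c (x $ 1 - t) * f x)" for t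
    by (intro continuous_intros f continuous_on_compose2[OF test_functionD(3)[OF test, of UNIV]]) auto
  have "DERIV (\<lambda>t. LINT x|slab X. c (x $ 1 - t) * f x) t :> (LINT x|slab X. - (c' (x $ 1 - t) * f x))"
  proof (rule has_real_derivative_integral[where e = 1 and B = "\<lambda>_. D * C" and F' = "\<lambda>t x. - (c' (x $ 1 - t) * f x)"])
    show "integrable (slab X) (\<lambda>x. c (x $ 1 - s) * f x)" for s
    proof (rule slab_integrable[OF cont])
      show "\<bar>c (x $ 1 - s) * f x\<bar> \<le> D * C" if "x \<in> \<Omega>" "\<bar>x $ 1\<bar> < X" for x
        unfolding abs_mult using D f(2)[OF that] by (intro mult_mono) auto
    qed
    show "integrable (slab X) (\<lambda>_. D * C)"
      using finite_slab by (simp add: finite_measure.integrable_const)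
    fix s x assume "x \<in> space (slab X)"
    then have x: "x \<in> \<Omega>" "\<bar>x $ 1\<bar> < X" by (auto simp: space_slab)
    have "DERIV (\<lambda>s. x $ 1 - s) s :> - 1" by (auto intro!: derivative_eq_intros)
    from DERIV_cmult_right[OF DERIV_chain2[OF test_functionD(1)[OF test] this], of "f x"]
    show "DERIV (\<lambda>s. c (x $ 1 - s) * f x) s :> - (c' (x $ 1 - s) * f x)" by simp
    show "\<bar>- (c' (x $ 1 - s) * f x)\<bar> \<le> D * C"
      unfolding abs_minus abs_mult using D f(2)[OF x] by (intro mult_mono) auto
  qed simp
  then show ?thesis by simp
qed

text \<open>On the support of the bump the domain contains, respectively is contained in, a cylinder
  of radius a about the axis.\<close>

lemma slab_volume_bounds:
  assumes \<delta>: "0 < \<delta>" "\<bar>t\<bar> + \<delta> \<le> X" and a: "0 < a"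
  shows "(\<And>s. \<bar>s - t\<bar> < \<delta> \<Longrightarrow> a \<le> g s) \<Longrightarrow>
      a ^ 3 * cylinder_mass \<delta> \<le> (LINT x|slab X. bump \<delta> (x $ 1 - t))"
    and "(\<And>s. \<bar>s - t\<bar> < \<delta> \<Longrightarrow> g s \<le> a) \<Longrightarrow>
      (LINT x|slab X. bump \<delta> (x $ 1 - t)) \<le> a ^ 3 * cylinder_mass \<delta>"
proof -
  let ?D = "{x \<in> \<Omega>. \<bar>x $ 1\<bar> < X}"
  note t1 = test_function_mono[OF test_function_bump(1)[OF \<delta>(1), of t] \<delta>(2)]
  have D: "?D \<in> sets lborel" using open_slab by simp
  have eq: "(LINT x|slab X. bump \<delta> (x $ 1 - t)) = (LINT x|lborel. indicator ?D x * bump \<delta> (x $ 1 - t))"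
    unfolding slab_def using D by (simp add: integral_restrict_space)
  have "integrable (slab X) (\<lambda>x. bump \<delta> (x $ 1 - t) * 1)"
    by (rule test_bounded_slab(1)[OF t1, where C = 1]) auto
  then have int: "integrable lborel (\<lambda>x. indicator ?D x * bump \<delta> (x $ 1 - t))"
    unfolding slab_def using D by (simp add: integrable_restrict_space)
  have near: "\<bar>x $ 1 - t\<bar> < \<delta>" "\<bar>x $ 1\<bar> < X" if "bump \<delta> (x $ 1 - t) \<noteq> 0" for x
  proof -
    show "\<bar>x $ 1 - t\<bar> < \<delta>" using bump_eq_0[OF \<delta>(1), of "x $ 1 - t"] that by (meson not_le)
    then show "\<bar>x $ 1\<bar> < X" using \<delta> by linarith
  qed
  show "a ^ 3 * cylinder_mass \<delta> \<le> (LINT x|slab X. bump \<delta> (x $ 1 - t))"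
    if g: "\<And>s. \<bar>s - t\<bar> < \<delta> \<Longrightarrow> a \<le> g s"
    unfolding eq integral_cylinder[OF a, symmetric, of _ t]
  proof (rule integral_mono[OF integrable_cylinder[OF \<delta>(1)] int])
    fix x :: "real^4"
    show "bump \<delta> (x $ 1 - t) * indicator {x. radius x < a} x \<le> indicator ?D x * bump \<delta> (x $ 1 - t)"
      using near[of x] g[of "x $ 1"] bump_nonneg[of \<delta> "x $ 1 - t"]
      by (cases "bump \<delta> (x $ 1 - t) = 0") (auto simp: indicator_def \<Omega>_eq)
  qed
  show "(LINT x|slab X. bump \<delta> (x $ 1 - t)) \<le> a ^ 3 * cylinder_mass \<delta>"
    if g: "\<And>s. \<bar>s - t\<bar> < \<delta> \<Longrightarrow> g s \<le> a"
    unfolding eq integral_cylinder[OF a, symmetric, of _ t]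
  proof (rule integral_mono[OF int integrable_cylinder[OF \<delta>(1)]])
    fix x :: "real^4"
    show "indicator ?D x * bump \<delta> (x $ 1 - t) \<le> bump \<delta> (x $ 1 - t) * indicator {x. radius x < a} x"
      using near[of x] g[of "x $ 1"] bump_nonneg[of \<delta> "x $ 1 - t"]
      by (cases "bump \<delta> (x $ 1 - t) = 0") (auto simp: indicator_def \<Omega>_eq)
  qed
qed

lemma cylinder_mass_pos:
  assumes \<delta>: "0 < \<delta>"
  shows "0 < cylinder_mass \<delta>"
proof -
  define U where "U = {x::real^4. \<bar>x $ 1\<bar> < \<delta>} \<inter> {x. radius x < 1}"
  have "open U"
    unfolding U_def by (intro open_Int open_Collect_less continuous_intros continuous_on_transverse)
  moreover have "0 \<in> U" using \<delta> by (simp add: U_def transverse_def)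
  then have "U \<noteq> {}" by auto
  ultimately show ?thesis
    unfolding cylinder_mass_def using integrable_cylinder[OF \<delta>, of 0 1]
    by (intro lborel_integral_pos[where U = U]) (auto simp: U_def bump_nonneg bump_pos)
qed

lemma no_roof: False
proof -
  have lower: "\<exists>m>0. \<forall>t. \<bar>t\<bar> \<le> R \<longrightarrow> m \<le> g t" for R
  proof (cases "0 \<le> R")
    case True
    have "\<exists>s\<in>{-R..R}. \<forall>t\<in>{-R..R}. g s \<le> g t"
      by (rule continuous_attains_inf) (use True g_cont continuous_on_subset in auto)
    then obtain s where "\<And>t. t \<in> {-R..R} \<Longrightarrow> g s \<le> g t" by blast
    then show ?thesis using g_pos by (intro exI[of _ "g s"]) (auto simp: abs_le_iff)
  next
    case False
    then have "\<not> \<bar>t\<bar> \<le> R" for t by auto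
    then show ?thesis using zero_less_one by blast
  qed
  obtain m where m: "0 < m" "\<And>t. \<bar>t\<bar> \<le> 2 \<Longrightarrow> m \<le> g t" using lower by blast
  obtain M where M: "0 < M" "\<And>t. \<bar>t\<bar> \<le> 2 \<Longrightarrow> g t \<le> M" using g_bounded by blast
  \<comment> \<open>A lower bound for N'' on [-1, 1]: 3 V <= G N'' and G^3 <= 8 V give 8 N'' >= 3
    G^2 >= 3 m^2. The minimum with 1 is a requirement of \<open>slice_ode_contradiction\<close>.
    \<open>Vb\<close> bounds V on [-1, 1], whose bump windows stay in [-2, 2].\<close>
  define c0 where "c0 = min 1 (3 / 8 * m\<^sup>2)"
  define Vb where "Vb = M ^ 3"
  \<comment> \<open>An upper bound for the density \<open>q\<close> below, from the gradient bound
    2^18. \<open>D\<close> then bounds the normalized transverse energy at t = 0, and by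
    conservation at every t.\<close>
  define W :: real where "W = (2 ^ 18)\<^sup>2 + 1"
  have W: "0 < W" by (simp add: W_def)
  define D where "D = W * Vb"
  define L where "L = 1 + (Vb + 1) / c0 + 5 * (1 + 3 * D ^ 3)"
  have c0: "0 < c0" "c0 \<le> 1" "c0 \<le> 3 / 8 * m\<^sup>2" using m by (auto simp: c0_def)
  have Vb: "0 < Vb" using M by (simp add: Vb_def)
  with W have D: "0 < D" by (simp add: D_def)
  have L: "1 \<le> L" using Vb c0 D by (simp add: L_def)
  obtain l where l: "0 < l" "\<And>t. \<bar>t\<bar> \<le> L + 1 \<Longrightarrow> l \<le> g t" using lower by blast
  have "uniformly_continuous_on {-(L+1)..L+1} g"
    by (intro compact_uniformly_continuous continuous_on_subset[OF g_cont]) auto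
  then obtain \<delta>0 where \<delta>0: "0 < \<delta>0" "\<And>s t. s \<in> {-(L+1)..L+1} \<Longrightarrow> t \<in> {-(L+1)..L+1} \<Longrightarrow> dist s t < \<delta>0 \<Longrightarrow> dist (g s) (g t) < l / 4"
    unfolding uniformly_continuous_on_def using l by (metis zero_less_divide_iff zero_less_numeral)
  define \<delta> where "\<delta> = min 1 \<delta>0"
  have \<delta>: "0 < \<delta>" "\<delta> \<le> 1" using \<delta>0 by (auto simp: \<delta>_def)
  \<comment> \<open>These factors make G = 5/4 g an upper bound for g on the window and yet satisfy
    G^3 <= 8 V, because V >= (3/4 g)^3 and 125 <= 8 * 27.\<close>
  have window: "3 / 4 * g t \<le> g s" "g s \<le> 5 / 4 * g t" if t: "\<bar>t\<bar> \<le> L" and s: "\<bar>s - t\<bar> < \<delta>" for s t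
  proof -
    have s': "\<bar>s\<bar> \<le> L + 1" using t s \<delta> by linarith
    have t': "\<bar>t\<bar> \<le> L + 1" using t by linarith
    have "dist s t < \<delta>0" using s by (simp add: \<delta>_def dist_real_def)
    then have "\<bar>g s - g t\<bar> < l / 4"
      using \<delta>0(2)[of s t] s' t' by (simp add: dist_real_def abs_le_iff)
    moreover have "l \<le> g t" by (rule l(2)[OF t'])
    ultimately have close: "\<bar>g s - g t\<bar> < g t / 4" by linarith
    show "3 / 4 * g t \<le> g s" using close by linarith
    show "g s \<le> 5 / 4 * g t" using close by linarith
  qed
  define X where "X = L + 2"
  have YX: "L + 1 < X" by (simp add: X_def)
  have T1: "test_function (L + 1) (\<lambda>s. bump \<delta> (s - t)) (\<lambda>s. bump1 \<delta> (s - t))"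
    and T2: "test_function (L + 1) (\<lambda>s. bump1 \<delta> (s - t)) (\<lambda>s. bump2 \<delta> (s - t))" if "\<bar>t\<bar> \<le> L" for t
    using test_function_mono[OF test_function_bump(1)[OF \<delta>(1), of t], of "L + 1"]
      test_function_mono[OF test_function_bump(2)[OF \<delta>(1), of t], of "L + 1"] that \<delta>(2) by auto
  have S1: "test_function (L + 1) (bump \<delta>) (bump1 \<delta>)" and S2: "test_function (L + 1) (bump1 \<delta>) (bump2 \<delta>)"
    using T1[of 0] T2[of 0] L by auto
  let ?b = "\<lambda>t x. bump \<delta> (x $ 1 - t)"
  define \<kappa> where "\<kappa> = cylinder_mass \<delta>"
  have \<kappa>: "0 < \<kappa>" unfolding \<kappa>_def by (rule cylinder_mass_pos[OF \<delta>(1)])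
  obtain U where U: "\<And>x. x \<in> \<Omega> \<Longrightarrow> \<bar>x $ 1\<bar> < X \<Longrightarrow> \<bar>u x\<bar> \<le> U" using slab_u_bounded[of X] by blast
  define N where "N t = (LINT x|slab X. ?b t x * u x) / \<kappa>" for t
  define N1 where "N1 t = (LINT x|slab X. ?b t x * partial u 1 x) / \<kappa>" for t
  define N2 where "N2 t = (LINT x|slab X. bump2 \<delta> (x $ 1 - t) * u x) / \<kappa>" for t
  define V where "V t = (LINT x|slab X. ?b t x) / \<kappa>" for t
  define V1 where "V1 t = - (LINT x|slab X. bump1 \<delta> (x $ 1 - t)) / \<kappa>" for t
  define e where "e x = norm (transverse (grad u x))" for x
  \<comment> \<open>The conserved density with its sign reversed: the transverse energy e^2 plus 1 -
    (\<partial>_1 u)^2, hence at least e^2.\<close>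
  define q where "q x = (norm (grad u x))\<^sup>2 - 2 * (partial u 1 x)\<^sup>2 + 1" for x
  have cont_e: "continuous_on \<Omega> e"
    unfolding e_def by (intro continuous_intros continuous_on_compose2[OF continuous_on_transverse[of UNIV] grad_cont]) auto
  have cont_q: "continuous_on \<Omega> q"
    unfolding q_def by (intro continuous_intros grad_cont partial_cont)
  have e2: "(e x)\<^sup>2 = (norm (grad u x))\<^sup>2 - (partial u 1 x)\<^sup>2" for x
    using inner_self_transverse[of "grad u x"] by (simp add: e_def dot_square_norm grad_def)
  have u1: "(partial u 1 x)\<^sup>2 \<le> 1" if "x \<in> \<Omega>" for x
    using partial1_bound[OF that] by (simp add: abs_square_le_1)
  have gr: "(norm (grad u x))\<^sup>2 \<le> (2 ^ 18)\<^sup>2" if "x \<in> \<Omega>" for x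
    using norm_grad_bounded[OF that] by (intro power_mono) auto
  have q_bounds: "(e x)\<^sup>2 \<le> q x" "q x \<le> W" if "x \<in> \<Omega>" for x
    using u1[OF that] gr[OF that] zero_le_power2[of "partial u 1 x"] unfolding e2 q_def W_def by linarith+
  have q_abs: "\<bar>q x\<bar> \<le> W" if "x \<in> \<Omega>" for x
    using q_bounds[OF that] zero_le_power2[of "e x"] by linarith
  have int: "integrable (slab X) (\<lambda>x. ?b t x * f x)"
    if "\<bar>t\<bar> \<le> L" "continuous_on \<Omega> f" "\<And>x. x \<in> \<Omega> \<Longrightarrow> \<bar>x $ 1\<bar> < X \<Longrightarrow> \<bar>f x\<bar> \<le> C" for f C t
    by (rule test_bounded_slab(1)[OF T1[OF that(1)] that(2,3)])
  have int1: "integrable (slab X) (\<lambda>x. ?b t x)" if "\<bar>t\<bar> \<le> L" for t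
    using int[OF that, of "\<lambda>_. 1" 1] by simp
  have dint: "((\<lambda>t. (LINT x|slab X. ?b t x * f x) / \<kappa>) has_real_derivative
      - (LINT x|slab X. bump1 \<delta> (x $ 1 - t) * f x) / \<kappa>) (at t)"
    if "continuous_on \<Omega> f" "\<And>x. x \<in> \<Omega> \<Longrightarrow> \<bar>x $ 1\<bar> < X \<Longrightarrow> \<bar>f x\<bar> \<le> C" for f C t
    by (rule DERIV_cdivide[OF slab_shift_derivative[OF S1 that]])
  have dN: "DERIV N t :> N1 t" if t: "\<bar>t\<bar> \<le> L" for t
    using dint[OF u_cont U, of t]
      integral_u_derivative[OF YX T1[OF t]] by (simp add: N_def[abs_def] N1_def)
  have dN1: "DERIV N1 t :> N2 t" if t: "\<bar>t\<bar> \<le> L" for t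
    using dint[OF partial_cont partial1_bound, of t]
      integral_u_derivative[OF YX T2[OF t]] by (simp add: N1_def[abs_def] N2_def)
  have dV: "DERIV V t :> V1 t" for t
    using dint[of "\<lambda>_. 1" 1 t]
    by (simp add: V_def[abs_def] V1_def)
  have V1: "\<bar>V1 t\<bar> \<le> N2 t" if t: "\<bar>t\<bar> \<le> L" for t
    using axial_flux_bound[OF YX T1[OF t] T2[OF t] bump_nonneg] \<kappa>
    by (simp add: V1_def N2_def abs_divide divide_right_mono)
  have NV: "\<bar>N1 t\<bar> \<le> V t" if t: "\<bar>t\<bar> \<le> L" for t
  proof -
    have "\<bar>LINT x|slab X. ?b t x * partial u 1 x\<bar> \<le> (LINT x|slab X. \<bar>?b t x * partial u 1 x\<bar>)"
      by (rule integral_abs_bound)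
    also have "\<dots> \<le> (LINT x|slab X. ?b t x)"
    proof (rule integral_mono[OF integrable_abs[OF int[OF t partial_cont partial1_bound]] int1[OF t]])
      fix x assume "x \<in> space (slab X)"
      then have "\<bar>partial u 1 x\<bar> \<le> 1" by (intro partial1_bound) (simp add: space_slab)
      then show "\<bar>?b t x * partial u 1 x\<bar> \<le> ?b t x"
        using bump_nonneg[of \<delta> "x $ 1 - t"] by (simp add: abs_mult mult_left_le)
    qed
    finally show ?thesis using \<kappa> by (simp add: N1_def V_def abs_divide divide_right_mono)
  qed
  have GN2: "3 * V t \<le> (5 / 4 * g t) * N2 t" if t: "\<bar>t\<bar> \<le> L" for t
  proof -
    have "3 * (LINT x|slab X. ?b t x) \<le> (5 / 4 * g t) * (LINT x|slab X. bump2 \<delta> (x $ 1 - t) * u x)"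
    proof (rule transverse_flux_bound[OF YX T1[OF t] T2[OF t] bump_nonneg])
      show "g s \<le> 5 / 4 * g t" if "bump \<delta> (s - t) \<noteq> 0" for s
        using window(2)[OF t] bump_eq_0[OF \<delta>(1), of "s - t"] that by (meson not_le)
    qed (use g_pos[of t] in simp)
    then show ?thesis
      using \<kappa> divide_right_mono[of _ _ \<kappa>] by (fastforce simp: V_def N2_def)
  qed
  have tX: "\<bar>t\<bar> + \<delta> \<le> X" if "\<bar>t\<bar> \<le> L" for t using that \<delta> by (simp add: X_def)
  have Vlow: "(3 / 4 * g t) ^ 3 \<le> V t" if t: "\<bar>t\<bar> \<le> L" for t
  proof -
    have "(3 / 4 * g t) ^ 3 * \<kappa> \<le> (LINT x|slab X. ?b t x)"
      unfolding \<kappa>_def by (rule slab_volume_bounds(1)[OF \<delta>(1) tX[OF t]]) (use window[OF t] g_pos[of t] in auto)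
    then show ?thesis using \<kappa> by (simp add: V_def field_simps)
  qed
  have Vpos: "0 < V t" if t: "\<bar>t\<bar> \<le> L" for t
    using Vlow[OF t] g_pos[of t] zero_less_power[of "3 / 4 * g t" 3] by linarith
  have Vup: "V t \<le> Vb" if t: "\<bar>t\<bar> \<le> 1" for t
  proof -
    have "(LINT x|slab X. ?b t x) \<le> M ^ 3 * \<kappa>"
      unfolding \<kappa>_def by (rule slab_volume_bounds(2)[OF \<delta>(1) tX]) (use M t L \<delta> in auto)
    then show ?thesis using \<kappa> by (simp add: V_def Vb_def field_simps)
  qed
  have G3: "(5 / 4 * g t) ^ 3 \<le> 8 * V t" if t: "\<bar>t\<bar> \<le> L" for t
  proof -
    have "(3 / 4 * g t) ^ 3 = 27 / 64 * g t ^ 3" "(5 / 4 * g t) ^ 3 = 125 / 64 * g t ^ 3"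
      by (simp_all add: power_mult_distrib power_divide)
    then show ?thesis using Vlow[OF t] zero_less_power[OF g_pos[of t], of 3] by linarith
  qed
  \<comment> \<open>The derivative in t falls on the bump, and \<open>q\<close> is -2 times the
    density whose integral against \<open>bump1\<close> vanishes by
    \<open>stress_conservation\<close>.\<close>
  have Qconst: "(LINT x|slab X. ?b t x * q x) = (LINT x|slab X. ?b 0 x * q x)" if t: "\<bar>t\<bar> \<le> L" for t
  proof -
    have "\<exists>c. \<forall>t\<in>{-L..L}. (LINT x|slab X. ?b t x * q x) = c"
    proof (rule has_field_derivative_zero_constant)
      fix t assume "t \<in> {-L..L}"
      then have t: "\<bar>t\<bar> \<le> L" by auto
      have "(LINT x|slab X. bump1 \<delta> (x $ 1 - t) * q x)
        = (LINT x|slab X. - 2 * (bump1 \<delta> (x $ 1 - t) * ((partial u 1 x)\<^sup>2 - (norm (grad u x))\<^sup>2 / 2 - 1 / 2)))"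
        by (rule Bochner_Integration.integral_cong) (auto simp: q_def algebra_simps)
      also have "\<dots> = 0"
        using stress_conservation[OF YX T1[OF t] T2[OF t] bump_nonneg] by simp
      finally show "((\<lambda>t. LINT x|slab X. ?b t x * q x) has_real_derivative 0) (at t within {-L..L})"
        using slab_shift_derivative[OF S1 cont_q q_abs, where t = t and X = X] by (simp add: has_field_derivative_at_within)
    qed simp
    then obtain C where C: "\<And>t. t \<in> {-L..L} \<Longrightarrow> (LINT x|slab X. ?b t x * q x) = C" by blast
    have "t \<in> {-L..L}" "0 \<in> {-L..L}" using t L by auto
    then show ?thesis by (simp only: C)
  qed
  \<comment> \<open>Poincare's inequality: 3 N is minus the average of grad u against the transverse
    position, so it is at most G times the average of \<open>e\<close>. Cauchy-Schwarz bounds the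
    square of that average by V times the average of e^2, which conservation bounds by D.\<close>
  have GN: "9 * (N t)\<^sup>2 \<le> (5 / 4 * g t)\<^sup>2 * V t * D" if t: "\<bar>t\<bar> \<le> L" for t
  proof -
    define a where "a = (LINT x|slab X. ?b t x * e x)"
    have eb: "\<bar>e x\<bar> \<le> W + 1" if "x \<in> \<Omega>" for x
    proof -
      have "(e x)\<^sup>2 \<le> W" using q_bounds[OF that] by linarith
      moreover have "\<bar>e x\<bar> \<le> 1 + (e x)\<^sup>2"
      proof -
        have "(\<bar>e x\<bar> - 1)\<^sup>2 = (e x)\<^sup>2 - 2 * \<bar>e x\<bar> + 1" by (simp add: power2_diff)
        then show ?thesis using zero_le_power2[of "\<bar>e x\<bar> - 1"] by linarith
      qed
      ultimately show ?thesis by linarith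
    qed
    have e2b: "\<bar>(e x)\<^sup>2\<bar> \<le> W" if "x \<in> \<Omega>" for x using q_bounds[OF that] by simp
    have inte: "integrable (slab X) (\<lambda>x. ?b t x * e x)" by (rule int[OF t cont_e eb])
    have inte2: "integrable (slab X) (\<lambda>x. ?b t x * (e x)\<^sup>2)"
      by (rule int[OF t continuous_on_power[OF cont_e] e2b])
    have "(LINT x|slab X. ?b t x * (e x)\<^sup>2) \<le> (LINT x|slab X. ?b t x * q x)"
      by (rule integral_mono[OF inte2 int[OF t cont_q q_abs]])
        (auto simp: space_slab intro!: mult_left_mono q_bounds bump_nonneg)
    also have "\<dots> = (LINT x|slab X. ?b 0 x * q x)" by (rule Qconst[OF t])
    also have "\<dots> \<le> (LINT x|slab X. ?b 0 x * W)"
      by (rule integral_mono[OF int[OF _ cont_q q_abs] int[of 0 "\<lambda>_. W" W]])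
        (use L W in \<open>auto simp: space_slab intro!: mult_left_mono q_bounds bump_nonneg\<close>)
    also have "\<dots> = W * (\<kappa> * V 0)"
      using \<kappa> int1[of 0] L by (simp add: V_def)
    also have "\<dots> \<le> W * (\<kappa> * Vb)"
      using Vup[of 0] \<kappa> W by (intro mult_left_mono) auto
    finally have E: "(LINT x|slab X. ?b t x * (e x)\<^sup>2) \<le> \<kappa> * D" by (simp add: D_def mult_ac)
    have posV: "0 < (LINT x|slab X. ?b t x)"
      using Vpos[OF t] \<kappa> by (simp add: V_def zero_less_divide_iff)
    have CS: "a\<^sup>2 \<le> (LINT x|slab X. ?b t x) * (LINT x|slab X. ?b t x * (e x)\<^sup>2)"
      unfolding a_def by (rule finite_measure.integral_Cauchy_Schwarz[OF finite_slab bump_nonneg int1[OF t] inte inte2 posV])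
    have "a\<^sup>2 \<le> (LINT x|slab X. ?b t x) * (\<kappa> * D)"
      by (rule order_trans[OF CS mult_left_mono[OF E less_imp_le[OF posV]]])
    moreover have "(LINT x|slab X. ?b t x) = \<kappa> * V t" using \<kappa> by (simp add: V_def)
    ultimately have a2: "a\<^sup>2 \<le> \<kappa>\<^sup>2 * (V t * D)" by (simp add: power2_eq_square mult_ac)
    have "\<bar>3 * (LINT x|slab X. ?b t x * u x)\<bar> \<le> 5 / 4 * g t * a"
    proof -
      have "\<bar>LINT x|slab X. ?b t x * (grad u x \<bullet> transverse x)\<bar>
        \<le> (LINT x|slab X. \<bar>?b t x * (grad u x \<bullet> transverse x)\<bar>)"
        by (rule integral_abs_bound)
      also have "\<dots> \<le> (LINT x|slab X. 5 / 4 * g t * (?b t x * e x))"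
      proof (rule integral_mono')
        show "integrable (slab X) (\<lambda>x. 5 / 4 * g t * (?b t x * e x))"
          by (intro integrable_mult_right inte)
        fix x assume "x \<in> space (slab X)"
        then have "x \<in> \<Omega>" by (simp add: space_slab)
        then have x: "radius x < g (x $ 1)" by (simp add: \<Omega>_eq)
        show "\<bar>?b t x * (grad u x \<bullet> transverse x)\<bar> \<le> 5 / 4 * g t * (?b t x * e x)"
        proof (cases "\<bar>x $ 1 - t\<bar> < \<delta>")
          case True
          have "grad u x \<bullet> transverse x = transverse (grad u x) \<bullet> transverse x"
            by (simp add: inner_vec_def transverse_nth sum_4)
          then have "\<bar>grad u x \<bullet> transverse x\<bar> \<le> e x * radius x"
            unfolding e_def using Cauchy_Schwarz_ineq2 by metis
          also have "\<dots> \<le> e x * (5 / 4 * g t)"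
            using x window(2)[OF t True] by (intro mult_left_mono) (auto simp: e_def)
          finally have "?b t x * \<bar>grad u x \<bullet> transverse x\<bar> \<le> ?b t x * (e x * (5 / 4 * g t))"
            by (intro mult_left_mono bump_nonneg)
          then show ?thesis using bump_nonneg[of \<delta> "x $ 1 - t"] by (simp add: abs_mult mult_ac)
        next
          case False
          then show ?thesis using bump_eq_0[OF \<delta>(1), of "x $ 1 - t"] by simp
        qed
        show "0 \<le> 5 / 4 * g t * (?b t x * e x)"
          using g_pos[of t] bump_nonneg[of \<delta> "x $ 1 - t"] by (simp add: e_def)
      qed
      finally show ?thesis
        unfolding integral_u_transverse[OF YX T1[OF t]] a_def by simp
    qed
    then have "\<bar>3 * (\<kappa> * N t)\<bar> \<le> 5 / 4 * g t * a" using \<kappa> by (simp add: N_def)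
    then have "\<bar>3 * (\<kappa> * N t)\<bar>\<^sup>2 \<le> (5 / 4 * g t * a)\<^sup>2" by (intro power_mono) auto
    also have "\<dots> = (5 / 4 * g t)\<^sup>2 * a\<^sup>2" by (simp only: power_mult_distrib)
    also have "\<dots> \<le> (5 / 4 * g t)\<^sup>2 * (\<kappa>\<^sup>2 * (V t * D))" by (intro mult_left_mono a2) auto
    finally have "\<kappa>\<^sup>2 * (9 * (N t)\<^sup>2) \<le> \<kappa>\<^sup>2 * ((5 / 4 * g t)\<^sup>2 * V t * D)"
      by (simp only: power2_abs power_mult_distrib) (simp add: mult_ac)
    then show ?thesis using \<kappa> by simp
  qed
  define G where "G t = 5 / 4 * g t" for t
  have G_pos: "0 < G t" for t using g_pos by (simp add: G_def)
  note GN2' = GN2[folded G_def] and GN' = GN[folded G_def] and G3' = G3[folded G_def]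
  have Npos: "0 < N t" if t: "\<bar>t\<bar> \<le> L" for t
  proof -
    let ?D = "{x \<in> \<Omega>. \<bar>x $ 1\<bar> < X}"
    have D: "?D \<in> sets lborel" using open_slab by simp
    have "integrable (slab X) (\<lambda>x. ?b t x * u x)" by (rule int[OF t u_cont U])
    then have i: "integrable lborel (\<lambda>x. indicator ?D x * (?b t x * u x))"
      unfolding slab_def using D by (simp add: integrable_restrict_space)
    have "0 < (LINT x|lborel. indicator ?D x * (?b t x * u x))"
    proof (rule lborel_integral_pos[OF i, of "?D \<inter> {x. \<bar>x $ 1 - t\<bar> < \<delta>}"])
      show "open (?D \<inter> {x. \<bar>x $ 1 - t\<bar> < \<delta>})"
        by (intro open_Int open_slab open_Collect_less continuous_intros)
      have "t *\<^sub>R axis 1 1 \<in> ?D \<inter> {x. \<bar>x $ 1 - t\<bar> < \<delta>}"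
        using axis_in[of t] t \<delta> by (simp add: X_def)
      then show "?D \<inter> {x. \<bar>x $ 1 - t\<bar> < \<delta>} \<noteq> {}" by blast
    qed (auto simp: indicator_def u_pos bump_pos bump_nonneg less_imp_le)
    then have "0 < (LINT x|slab X. ?b t x * u x)"
      unfolding slab_def using D by (simp add: integral_restrict_space)
    then show ?thesis using \<kappa> by (simp add: N_def)
  qed
  have "3 / 8 * m\<^sup>2 \<le> N2 t" if t: "\<bar>t\<bar> \<le> 1" for t
  proof -
    have tL: "\<bar>t\<bar> \<le> L" using t L by simp
    have "(5 / 4 * g t) ^ 3 * 3 \<le> 8 * ((5 / 4 * g t) * N2 t)"
      using G3[OF tL] GN2[OF tL] by linarith
    then have "g t * (3 * (5 / 4 * g t)\<^sup>2) \<le> g t * (8 * N2 t)"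
      by (simp add: power2_eq_square power3_eq_cube mult_ac)
    then have "3 * (5 / 4 * g t)\<^sup>2 \<le> 8 * N2 t" using g_pos[of t] by simp
    moreover have "m\<^sup>2 \<le> (5 / 4 * g t)\<^sup>2" using m(1) m(2)[of t] t by (intro power_mono) auto
    ultimately show ?thesis by simp
  qed
  then have N2c0: "c0 \<le> N2 t" if "\<bar>t\<bar> \<le> 1" for t using that c0 by force
  \<comment> \<open>N' increases by at least 2 c0 over [-1, 1], so N grows outwards at a rate of at
    least c0 at one of the two ends. The left end is reduced to the right one by reflecting t, which
    changes the signs of \<open>N1\<close> and \<open>V1\<close> only.\<close>
  have "N1 (-1) - c0 * (-1) \<le> N1 1 - c0 * 1"
  proof (rule DERIV_nonneg_imp_nondecreasing[of "-1" 1 "\<lambda>t. N1 t - c0 * t"])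
    fix t :: real assume "-1 \<le> t" "t \<le> 1"
    then have t: "\<bar>t\<bar> \<le> 1" "\<bar>t\<bar> \<le> L" using L by auto
    show "\<exists>y. DERIV (\<lambda>t. N1 t - c0 * t) t :> y \<and> 0 \<le> y"
      by (rule exI[of _ "N2 t - c0"]) (use N2c0[OF t(1)] in \<open>auto intro!: derivative_eq_intros dN1 t\<close>)
  qed simp
  then have "c0 \<le> N1 1 \<or> c0 \<le> - N1 (-1)" by linarith
  moreover have False if "c0 \<le> N1 1"
  proof -
    have t: "\<bar>t\<bar> \<le> L" if "1 \<le> t" "t \<le> L" for t using that by simp
    show False
    proof (rule slice_ode_contradiction[of Vb c0 D L N N1 N2 V V1 G])
      show "N1 t \<le> V t" if "1 \<le> t" "t \<le> L" for t using NV[OF t[OF that]] by simp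
      show "V 1 \<le> Vb" by (rule Vup) simp
    qed (use \<open>c0 \<le> N1 1\<close> c0 D Vb in \<open>auto intro: t Npos dN dN1 dV V1 GN2' GN' G3' G_pos less_imp_le simp: L_def\<close>)
  qed
  moreover have False if "c0 \<le> - N1 (-1)"
  proof -
    have t: "\<bar>- t\<bar> \<le> L" if "1 \<le> t" "t \<le> L" for t using that by simp
    have refl: "DERIV (\<lambda>t. f (- t)) t :> - f'" if "DERIV f (- t) :> f'" for f f' and t :: real
    proof -
      have "DERIV uminus t :> - 1" by (auto intro!: derivative_eq_intros)
      from DERIV_chain2[where g = uminus and x = t, OF that this] show ?thesis by simp
    qed
    show False
    proof (rule slice_ode_contradiction[of Vb c0 D L "\<lambda>t. N (- t)" "\<lambda>t. - N1 (- t)" "\<lambda>t. N2 (- t)"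
          "\<lambda>t. V (- t)" "\<lambda>t. - V1 (- t)" "\<lambda>t. G (- t)"])
      show "- N1 (- t) \<le> V (- t)" if "1 \<le> t" "t \<le> L" for t using NV[OF t[OF that]] by simp
      show "DERIV (\<lambda>t. N (- t)) t :> - N1 (- t)" if "1 \<le> t" "t \<le> L" for t
        by (rule refl[OF dN[OF t[OF that]]])
      show "DERIV (\<lambda>t. - N1 (- t)) t :> N2 (- t)" if "1 \<le> t" "t \<le> L" for t
        using DERIV_minus[OF refl[OF dN1[OF t[OF that]]]] by simp
      show "\<bar>- V1 (- t)\<bar> \<le> N2 (- t)" if "1 \<le> t" "t \<le> L" for t using V1[OF t[OF that]] by simp
      show "V (- 1) \<le> Vb" by (rule Vup) simp
    qed (use \<open>c0 \<le> - N1 (-1)\<close> c0 D Vb in \<open>auto intro: t refl Npos dN dV GN2' GN' G3' G_pos less_imp_le simp: L_def\<close>)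
  qed
  ultimately show False by blast
qed

end

section \<open>Conclusion for analytic profiles\<close>

lemma real_analytic_continuous:
  assumes "real_analytic g"
  shows "continuous_on UNIV g"
proof -
  have "isCont g x0" for x0
  proof -
    obtain r a where r: "0 < r" and a: "\<And>x. \<bar>x - x0\<bar> < r \<Longrightarrow> (\<lambda>n. a n * (x - x0) ^ n) sums g x"
      using assms unfolding real_analytic_def by blast
    have s: "summable (\<lambda>n. a n * (r / 2) ^ n)"
      using a[of "x0 + r / 2"] r by (simp add: sums_iff)
    have "isCont (\<lambda>y. \<Sum>n. a n * y ^ n) 0"
      by (rule isCont_powser[OF s]) (use r in simp)
    moreover have "isCont (\<lambda>x. x - x0) x0" by (intro continuous_intros)
    ultimately have "isCont (\<lambda>x. \<Sum>n. a n * (x - x0) ^ n) x0"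
      using isCont_o2[of x0 "\<lambda>x. x - x0" "\<lambda>y. \<Sum>n. a n * y ^ n"] by simp
    moreover have "eventually (\<lambda>x. g x = (\<Sum>n. a n * (x - x0) ^ n)) (nhds x0)"
      unfolding eventually_nhds_metric using a r by (auto simp: dist_real_def sums_iff intro!: exI[of _ r])
    ultimately show ?thesis by (subst isCont_cong) auto
  qed
  then show ?thesis by (simp add: continuous_at_imp_continuous_on)
qed

theorem theorem8p1:
  fixes g :: "real \<Rightarrow> real"
  assumes "real_analytic g"
    and "\<And>x. g (- x) = g x"
    and "\<And>x. g x > 0"
  shows "\<not> exceptional_domain
           {x :: real^4. sqrt ((x$2)\<^sup>2 + (x$3)\<^sup>2 + (x$4)\<^sup>2) < g (x$1)}"
proof
  assume "exceptional_domain {x :: real^4. sqrt ((x$2)\<^sup>2 + (x$3)\<^sup>2 + (x$4)\<^sup>2) < g (x$1)}"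
  then obtain u where u: "roof_function {x :: real^4. sqrt ((x$2)\<^sup>2 + (x$3)\<^sup>2 + (x$4)\<^sup>2) < g (x$1)} u"
    by (auto simp: exceptional_domain_def)
  interpret roof_domain g "{x :: real^4. sqrt ((x$2)\<^sup>2 + (x$3)\<^sup>2 + (x$4)\<^sup>2) < g (x$1)}" u
    by standard (use assms u real_analytic_continuous in \<open>auto simp: norm_transverse\<close>)
  show False by (rule no_roof)
qed

end
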